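(* Let $G_1, \dots, G_n$ be locally compact second countable non-amenable bi-exact groups and let $\Gamma$ be a discrete countable ICC subgroup of $G_1\times G_2\times\cdots\times G_n$. Suppose that either for every $i\in\{1,\dots,n\}$ the projection of $\Gamma$ in $G_i$ contains a non-amenable discrete subgroup of $G_i$, or $\Gamma$ is irreducible, i.e. the projection of $\Gamma$ on each factor $G_i$ is dense in $G_i$. Then $\Gamma$ is not inner-amenable.
   Context: "Discrete subgroup" means a subgroup that is discrete in the topology of the ambient group. ICC: $\Gamma$ is infinite and every conjugacy class other than that of the identity $e$ is infinite. Inner-amenable: there is a probability measure on $\Delta_\beta\Gamma\setminus\{e\}$, where $\Delta_\beta\Gamma$ is the Stone-Čech compactification of the discrete space $\Gamma$, that is invariant for the adjoint action of $\Gamma$, i.e. the extension to $\Delta_\beta \Gamma$ of $\mathrm{ad}(\gamma): x\mapsto \gamma x\gamma^{-1}$, $x, \gamma \in \Gamma$. Bi-exactness: Let $G$ be a locally compact second countable group, with left and right translations $(\lambda_g f)(x) = f(g^{-1}x)$ and $(\rho_g f)(x)=f(xg)$. Let $C_b^u(G)$ be the algebra of bounded continuous functions $f$ on $G$ such that $\|\lambda_g f - f\|_\infty\to 0$ and $\|\rho_g f - f\|_\infty\to 0$ as $g\to e$. Let $C(h^uG) = \{f\in C_b^u(G) : \rho_g f - f\in C_0(G)\ \text{for all } g\in G\}$; this is a commutative unital $C^*$-algebra whose spectrum $h^uG$ is a compactification of $G$. Let $\nu^uG = h^uG\setminus G$ be its boundary. Left and right translations of $G$ on itself extend to $h^uG$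 and to $\nu^uG$, and the right action is trivial on $\nu^uG$. $G$ is bi-exact if the left action of $G$ on $\nu^uG$ is topologically amenable. Topological amenability of a continuous action of $G$ on a compact Hausdorff space $Y$: there is a net of weak-* continuous maps $m_j : Y\to \mathrm{Prob}(G)$ such that $\|g\, m_j(y) - m_j(gy)\|_1\to 0$ uniformly for $(g,y)$ in compact subsets of $G\times Y$, where $\|\cdot\|_1$ is the total variation norm. *)

theory Defs
  imports "HOL-Probability.Probability_Measure" "HOL-Algebra.Product_Groups"
begin

section \<open>Locally compact second countable groups\<close>

definition second_countable_space :: "'a topology \<Rightarrow> bool" where
  "second_countable_space T \<longleftrightarrow>
     (\<exists>\<B>. countable \<B> \<and> (\<forall>V\<in>\<B>. openin T V) \<and>
          (\<forall>U x. openin T U \<and> x \<in> U \<longrightarrow> (\<exists>V\<in>\<B>. x \<in> V \<and> V \<subseteq> U)))"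

text \<open>As usual, locally compact groups are Hausdorff.\<close>

locale lcsc_group = group G for G :: "('a, 'm) monoid_scheme" (structure) and T :: "'a topology" +
  assumes topspace_eq: "topspace T = carrier G"
    and continuous_mult: "continuous_map (prod_topology T T) T (\<lambda>(x, y). x \<otimes> y)"
    and continuous_inv: "continuous_map T T (\<lambda>x. inv x)"
    and Hausdorff: "Hausdorff_space T"
    and locally_compact: "locally_compact_space T"
    and second_countable: "second_countable_space T"

definition discrete_subgroup :: "'a set \<Rightarrow> ('a, 'm) monoid_scheme \<Rightarrow> 'a topology \<Rightarrow> bool" where
  "discrete_subgroup H G T \<longleftrightarrow> subgroup H G \<and> subtopology T H = discrete_topology H"


section \<open>Function spaces and translations\<close>

text \<open>Functions on a space \<open>X\<close> are represented by functions that are \<^const>\<open>undefined\<close> outside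
  \<open>X\<close>, so that a function space contains each function on \<open>X\<close> exactly once and a functional
  cannot depend on values outside \<open>X\<close>.\<close>

definition Cb :: "'a topology \<Rightarrow> ('a \<Rightarrow> 'b::real_normed_vector) set" where
  "Cb T = {f \<in> extensional (topspace T). continuous_map T euclidean f \<and> bounded (f ` topspace T)}"

definition C0 :: "'a topology \<Rightarrow> ('a \<Rightarrow> 'b::real_normed_vector) set" where
  "C0 T = {f \<in> Cb T. \<forall>\<epsilon>>0. \<exists>K. compactin T K \<and> (\<forall>x \<in> topspace T - K. norm (f x) < \<epsilon>)}"

definition sup_norm :: "'a set \<Rightarrow> ('a \<Rightarrow> 'b::real_normed_vector) \<Rightarrow> real" where
  "sup_norm X f = (SUP x\<in>X. norm (f x))"

definition ltrans :: "('a, 'm) monoid_scheme \<Rightarrow> 'a \<Rightarrow> ('a \<Rightarrow> 'b) \<Rightarrow> 'a \<Rightarrow> 'b" where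
  "ltrans G g f = (\<lambda>x\<in>carrier G. f (inv\<^bsub>G\<^esub> g \<otimes>\<^bsub>G\<^esub> x))"

definition rtrans :: "('a, 'm) monoid_scheme \<Rightarrow> 'a \<Rightarrow> ('a \<Rightarrow> 'b) \<Rightarrow> 'a \<Rightarrow> 'b" where
  "rtrans G g f = (\<lambda>x\<in>carrier G. f (x \<otimes>\<^bsub>G\<^esub> g))"


section \<open>Amenable groups\<close>

text \<open>Amenability is the existence of a left-invariant mean on the bounded continuous functions;
  for discrete groups these are all bounded functions.\<close>

definition mean_on :: "'a topology \<Rightarrow> (('a \<Rightarrow> real) \<Rightarrow> real) \<Rightarrow> bool" where
  "mean_on T \<mu> \<longleftrightarrow>
     (\<forall>f\<in>Cb T. \<forall>g\<in>Cb T. \<mu> (\<lambda>x\<in>topspace T. f x + g x) = \<mu> f + \<mu> g) \<and>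
     (\<forall>c. \<forall>f\<in>Cb T. \<mu> (\<lambda>x\<in>topspace T. c * f x) = c * \<mu> f) \<and>
     (\<forall>f\<in>Cb T. (\<forall>x\<in>topspace T. 0 \<le> f x) \<longrightarrow> 0 \<le> \<mu> f) \<and>
     \<mu> (\<lambda>x\<in>topspace T. 1) = 1"

definition amenable :: "('a, 'm) monoid_scheme \<Rightarrow> 'a topology \<Rightarrow> bool" where
  "amenable G T \<longleftrightarrow>
     (\<exists>\<mu>. mean_on T \<mu> \<and> (\<forall>g\<in>carrier G. \<forall>f\<in>Cb T. \<mu> (ltrans G g f) = \<mu> f))"


section \<open>Spectra of function algebras\<close>

text \<open>\<open>A\<close> is an algebra of complex functions on \<open>X\<close>. Its characters form a subset of
  \<open>\<Pi>\<^sub>E f\<in>A. \<complex>\<close>, on which the product topology is the weak-* topology.\<close>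

definition characters :: "'a set \<Rightarrow> ('a \<Rightarrow> complex) set \<Rightarrow> (('a \<Rightarrow> complex) \<Rightarrow> complex) set" where
  "characters X A = {\<phi> \<in> extensional A.
     (\<forall>f\<in>A. \<forall>g\<in>A. \<phi> (\<lambda>x\<in>X. f x + g x) = \<phi> f + \<phi> g) \<and>
     (\<forall>c. \<forall>f\<in>A. \<phi> (\<lambda>x\<in>X. c * f x) = c * \<phi> f) \<and>
     (\<forall>f\<in>A. \<forall>g\<in>A. \<phi> (\<lambda>x\<in>X. f x * g x) = \<phi> f * \<phi> g) \<and>
     (\<exists>f\<in>A. \<phi> f \<noteq> 0)}"

definition spectrum :: "'a set \<Rightarrow> ('a \<Rightarrow> complex) set \<Rightarrow> (('a \<Rightarrow> complex) \<Rightarrow> complex) topology" where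
  "spectrum X A = subtopology (product_topology (\<lambda>f. euclidean) A) (characters X A)"

text \<open>The canonical map from \<open>X\<close> to the spectrum.\<close>

definition point_eval :: "('a \<Rightarrow> complex) set \<Rightarrow> 'a \<Rightarrow> ('a \<Rightarrow> complex) \<Rightarrow> complex" where
  "point_eval A x = (\<lambda>f\<in>A. f x)"

text \<open>The extension to the spectrum of a self-map \<open>h\<close> of \<open>X\<close> for which \<open>f \<mapsto> f \<circ> h\<close>
  preserves \<open>A\<close>.\<close>

definition spectrum_map ::
    "'a set \<Rightarrow> ('a \<Rightarrow> complex) set \<Rightarrow> ('a \<Rightarrow> 'a) \<Rightarrow>
     (('a \<Rightarrow> complex) \<Rightarrow> complex) \<Rightarrow> (('a \<Rightarrow> complex) \<Rightarrow> complex)" where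
  "spectrum_map X A h \<phi> = (\<lambda>f\<in>A. \<phi> (\<lambda>x\<in>X. f (h x)))"

lemma topspace_spectrum: "topspace (spectrum X A) = characters X A"
  by (auto simp: spectrum_def characters_def PiE_def)

lemma spectrum_map_point_eval:
  assumes "\<And>f. f \<in> A \<Longrightarrow> (\<lambda>x\<in>X. f (h x)) \<in> A" and "x \<in> X"
  shows "spectrum_map X A h (point_eval A x) = point_eval A (h x)"
  using assms by (auto simp: spectrum_map_def point_eval_def)


section \<open>Probability measures\<close>

definition borel_on :: "'a topology \<Rightarrow> 'a measure" where
  "borel_on T = sigma (topspace T) {U. openin T U}"

definition Prob :: "'a topology \<Rightarrow> 'a measure set" where
  "Prob T = {\<mu>. prob_space \<mu> \<and> sets \<mu> = sets (borel_on T)}"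

text \<open>Total variation norm of \<open>\<mu> - \<nu>\<close>, for finite measures on the same \<open>\<sigma>\<close>-algebra.\<close>

definition tv_norm_diff :: "'a measure \<Rightarrow> 'a measure \<Rightarrow> real" where
  "tv_norm_diff \<mu> \<nu> =
     (SUP P \<in> {P. finite P \<and> P \<subseteq> sets \<mu> \<and> disjoint P \<and> \<Union>P = space \<mu>}.
        \<Sum>A\<in>P. \<bar>measure \<mu> A - measure \<nu> A\<bar>)"

definition translate_measure ::
    "('a, 'm) monoid_scheme \<Rightarrow> 'a topology \<Rightarrow> 'a \<Rightarrow> 'a measure \<Rightarrow> 'a measure" where
  "translate_measure G T g \<mu> = distr \<mu> (borel_on T) (\<lambda>x. g \<otimes>\<^bsub>G\<^esub> x)"

text \<open>Prob(G) carries the weak-* topology coming from the duality with \<open>C0\<close>.\<close>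

definition weak_star_continuous :: "'y topology \<Rightarrow> 'a topology \<Rightarrow> ('y \<Rightarrow> 'a measure) \<Rightarrow> bool" where
  "weak_star_continuous Y T m \<longleftrightarrow>
     (\<forall>y\<in>topspace Y. m y \<in> Prob T) \<and>
     (\<forall>f\<in>(C0 T :: ('a \<Rightarrow> complex) set). continuous_map Y euclidean (\<lambda>y. LINT x|m y. f x))"


section \<open>Topologically amenable actions and bi-exactness\<close>

text \<open>The proper filter \<open>F\<close> on the space of maps \<open>Y \<rightarrow> Prob(G)\<close> plays the role of the net
  \<open>(m\<^sub>j)\<close>.\<close>

definition topologically_amenable ::
    "('a, 'm) monoid_scheme \<Rightarrow> 'a topology \<Rightarrow> 'y topology \<Rightarrow> ('a \<Rightarrow> 'y \<Rightarrow> 'y) \<Rightarrow> bool" where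
  "topologically_amenable G T Y act \<longleftrightarrow>
     (\<exists>F :: ('y \<Rightarrow> 'a measure) filter.
        F \<noteq> bot \<and>
        (\<forall>\<^sub>F m in F. weak_star_continuous Y T m) \<and>
        (\<forall>K. compactin (prod_topology T Y) K \<longrightarrow>
           uniform_limit K
             (\<lambda>m (g, y). tv_norm_diff (translate_measure G T g (m y)) (m (act g y)))
             (\<lambda>_. 0) F))"

definition Cbu :: "('a, 'm) monoid_scheme \<Rightarrow> 'a topology \<Rightarrow> ('a \<Rightarrow> complex) set" where
  "Cbu G T = {f \<in> Cb T.
     ((\<lambda>g. sup_norm (carrier G) (\<lambda>x. ltrans G g f x - f x)) \<longlongrightarrow> 0) (nhdsin T \<one>\<^bsub>G\<^esub>) \<and>
     ((\<lambda>g. sup_norm (carrier G) (\<lambda>x. rtrans G g f x - f x)) \<longlongrightarrow> 0) (nhdsin T \<one>\<^bsub>G\<^esub>)}"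

definition Chu :: "('a, 'm) monoid_scheme \<Rightarrow> 'a topology \<Rightarrow> ('a \<Rightarrow> complex) set" where
  "Chu G T = {f \<in> Cbu G T. \<forall>g\<in>carrier G. (\<lambda>x\<in>carrier G. rtrans G g f x - f x) \<in> C0 T}"

definition hu :: "('a, 'm) monoid_scheme \<Rightarrow> 'a topology \<Rightarrow> (('a \<Rightarrow> complex) \<Rightarrow> complex) topology" where
  "hu G T = spectrum (carrier G) (Chu G T)"

definition nu :: "('a, 'm) monoid_scheme \<Rightarrow> 'a topology \<Rightarrow> (('a \<Rightarrow> complex) \<Rightarrow> complex) topology" where
  "nu G T = subtopology (hu G T) (topspace (hu G T) - point_eval (Chu G T) ` carrier G)"

definition hu_left_action ::
    "('a, 'm) monoid_scheme \<Rightarrow> 'a topology \<Rightarrow> 'a \<Rightarrow>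
     (('a \<Rightarrow> complex) \<Rightarrow> complex) \<Rightarrow> (('a \<Rightarrow> complex) \<Rightarrow> complex)" where
  "hu_left_action G T g = spectrum_map (carrier G) (Chu G T) (\<lambda>x. g \<otimes>\<^bsub>G\<^esub> x)"

definition bi_exact :: "('a, 'm) monoid_scheme \<Rightarrow> 'a topology \<Rightarrow> bool" where
  "bi_exact G T \<longleftrightarrow> topologically_amenable G T (nu G T) (hu_left_action G T)"


section \<open>ICC and inner-amenable discrete groups\<close>

definition icc :: "('a, 'm) monoid_scheme \<Rightarrow> bool" where
  "icc \<Gamma> \<longleftrightarrow> infinite (carrier \<Gamma>) \<and>
     (\<forall>x \<in> carrier \<Gamma> - {\<one>\<^bsub>\<Gamma>\<^esub>}.
        infinite ((\<lambda>\<gamma>. \<gamma> \<otimes>\<^bsub>\<Gamma>\<^esub> x \<otimes>\<^bsub>\<Gamma>\<^esub> inv\<^bsub>\<Gamma>\<^esub> \<gamma>) ` carrier \<Gamma>))"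

text \<open>The Stone-Cech compactification of the discrete space \<open>X\<close>, as the spectrum of the algebra of
  all bounded functions on \<open>X\<close>.\<close>

definition stone_cech :: "'a set \<Rightarrow> (('a \<Rightarrow> complex) \<Rightarrow> complex) topology" where
  "stone_cech X = spectrum X (Cb (discrete_topology X))"

definition stone_cech_ad ::
    "('a, 'm) monoid_scheme \<Rightarrow> 'a \<Rightarrow>
     (('a \<Rightarrow> complex) \<Rightarrow> complex) \<Rightarrow> (('a \<Rightarrow> complex) \<Rightarrow> complex)" where
  "stone_cech_ad \<Gamma> \<gamma> =
     spectrum_map (carrier \<Gamma>) (Cb (discrete_topology (carrier \<Gamma>)))
       (\<lambda>x. \<gamma> \<otimes>\<^bsub>\<Gamma>\<^esub> x \<otimes>\<^bsub>\<Gamma>\<^esub> inv\<^bsub>\<Gamma>\<^esub> \<gamma>)"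

definition stone_cech_minus_one ::
    "('a, 'm) monoid_scheme \<Rightarrow> (('a \<Rightarrow> complex) \<Rightarrow> complex) topology" where
  "stone_cech_minus_one \<Gamma> =
     subtopology (stone_cech (carrier \<Gamma>))
       (topspace (stone_cech (carrier \<Gamma>)) -
        {point_eval (Cb (discrete_topology (carrier \<Gamma>))) \<one>\<^bsub>\<Gamma>\<^esub>})"

definition inner_amenable :: "('a, 'm) monoid_scheme \<Rightarrow> bool" where
  "inner_amenable \<Gamma> \<longleftrightarrow>
     (\<exists>\<mu> \<in> Prob (stone_cech_minus_one \<Gamma>).
        \<forall>\<gamma>\<in>carrier \<Gamma>. distr \<mu> (borel_on (stone_cech_minus_one \<Gamma>)) (stone_cech_ad \<Gamma> \<gamma>) = \<mu>)"

end

theory Submission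
  imports Defs "HOL-Probability.Giry_Monad"
begin

text \<open>An invariant probability measure \<open>\<mu>\<close> on \<open>\<Delta>\<^sub>\<beta>\<Gamma> - {e}\<close> is pushed forward to each \<open>h\<^sup>uG\<^sub>i\<close>. On the
  boundary \<open>\<nu>\<^sup>uG\<^sub>i\<close> the right action is trivial, so the adjoint action of \<open>\<Gamma>\<close> becomes left translation by
  its projection. If the boundary had positive mass, the normalized restriction of the measure would be
  invariant under the projection, hence by continuity under its closure, and integrating the almost
  equivariant kernels of the amenable boundary action against it would give an invariant mean on
  bounded Borel functions. This makes discrete subgroups of the projection amenable (through a Borel
  fundamental domain), and \<open>G\<^sub>i\<close> itself if the projection is dense. So \<open>\<mu>\<close> lives over the interior of every factor. As
  \<open>\<Gamma>\<close> is discrete, it meets products of compact sets in finite sets, and \<open>\<mu>\<close> is a sum of point masses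
  at elements of \<open>\<Gamma> - {e}\<close>, which the ICC property excludes.\<close>

section \<open>Borel measures on topological spaces\<close>

text \<open>Two difficulties shape the argument. A mean on bounded Borel functions need not depend
  continuously on translations, so invariance under a dense projection cannot be extended to the
  closure once the mean has been formed. The extension is made earlier, on the boundary: for
  \<open>f\<close> in \<open>Chu\<close> the translates by \<open>g\<close> vary continuously in sup
  norm, characters are contractive, and dominated convergence carries invariance of the measure to
  limits. Moreover, the boundary need not be metrizable and \<open>\<mu>\<close> is not assumed
  regular. Invariance is therefore tested only on continuous functions of the boundary point, and
  measurability of the kernels comes from second countability of the group: the mass of an open set
  is a limit of integrals of one fixed sequence of compactly supported functions. Borel functions
  rather than continuous ones are used for the mean because functions on a discrete subgroup are
  transported to the group by a Borel section, which is in general discontinuous.\<close>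

lemma space_borel_on [simp]: "space (borel_on T) = topspace T"
  by (simp add: borel_on_def space_measure_of_conv)

lemma sets_borel_on: "sets (borel_on T) = sigma_sets (topspace T) {U. openin T U}"
  unfolding borel_on_def by (rule sets_measure_of) (auto dest: openin_subset)

lemma openin_borel_on: "openin T U \<Longrightarrow> U \<in> sets (borel_on T)"
  by (auto simp: sets_borel_on)

lemma continuous_map_measurable_borel_on:
  assumes "continuous_map X Y f" shows "f \<in> borel_on X \<rightarrow>\<^sub>M borel_on Y"
proof -
  have "f \<in> borel_on X \<rightarrow>\<^sub>M sigma (topspace Y) {U. openin Y U}"
  proof (rule measurable_measure_of)
    show "{U. openin Y U} \<subseteq> Pow (topspace Y)" by (auto dest: openin_subset)
    show "f \<in> space (borel_on X) \<rightarrow> topspace Y"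
      using assms by (auto simp: continuous_map)
    fix U assume "U \<in> {U. openin Y U}"
    then have "openin X {x \<in> topspace X. f x \<in> U}"
      using assms by (auto simp: continuous_map)
    moreover have "f -` U \<inter> space (borel_on X) = {x \<in> topspace X. f x \<in> U}" by auto
    ultimately show "f -` U \<inter> space (borel_on X) \<in> sets (borel_on X)"
      by (simp add: openin_borel_on)
  qed
  then show ?thesis by (simp add: borel_on_def)
qed

lemma continuous_map_borel_measurable:
  fixes f :: "'a \<Rightarrow> 'b::topological_space"
  assumes "continuous_map X euclidean f" shows "f \<in> borel_measurable (borel_on X)"
proof (rule borel_measurableI)
  fix S :: "'b set" assume "open S"
  then have "openin X {x \<in> topspace X. f x \<in> S}"
    using assms by (auto simp: continuous_map)
  moreover have "f -` S \<inter> space (borel_on X) = {x \<in> topspace X. f x \<in> S}" by auto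
  ultimately show "f -` S \<inter> space (borel_on X) \<in> sets (borel_on X)"
    by (simp add: openin_borel_on)
qed

lemma ProbD:
  assumes "\<mu> \<in> Prob T"
  shows "prob_space \<mu>" "sets \<mu> = sets (borel_on T)" "space \<mu> = topspace T"
proof -
  show *: "prob_space \<mu>" "sets \<mu> = sets (borel_on T)"
    using assms by (auto simp: Prob_def)
  show "space \<mu> = topspace T"
    using sets_eq_imp_space_eq[OF *(2)] by simp
qed

section \<open>Total variation distance and integrals\<close>

lemma measure_diff_le_tv_norm_diff:
  assumes "prob_space \<mu>" "prob_space \<nu>" and sets: "sets \<nu> = sets \<mu>" and A: "A \<in> sets \<mu>"
  shows "\<bar>measure \<mu> A - measure \<nu> A\<bar> \<le> tv_norm_diff \<mu> \<nu>"
  unfolding tv_norm_diff_def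
proof (rule cSUP_upper2)
  interpret \<mu>: prob_space \<mu> by fact
  interpret \<nu>: prob_space \<nu> by fact
  let ?P = "{A, space \<mu> - A}"
  show "?P \<in> {P. finite P \<and> P \<subseteq> sets \<mu> \<and> disjoint P \<and> \<Union>P = space \<mu>}"
    using A sets.sets_into_space[OF A] by (auto simp: disjoint_def)
  show "\<bar>measure \<mu> A - measure \<nu> A\<bar> \<le> (\<Sum>A\<in>?P. \<bar>measure \<mu> A - measure \<nu> A\<bar>)"
    by (rule member_le_sum) auto
  \<comment> \<open>A real supremum is meaningful only for a set bounded above; disjointness bounds
    each sum by the two total masses, hence by 2.\<close>
  have "(\<Sum>A\<in>P. \<bar>measure \<mu> A - measure \<nu> A\<bar>) \<le> 2"
    if P: "finite P" "P \<subseteq> sets \<mu>" "disjoint P" "\<Union>P = space \<mu>" for P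
  proof -
    have "(\<Sum>A\<in>P. \<bar>measure \<mu> A - measure \<nu> A\<bar>) \<le> (\<Sum>A\<in>P. measure \<mu> A + measure \<nu> A)"
      by (intro sum_mono) (smt (verit) measure_nonneg)
    also have "\<dots> = measure \<mu> (\<Union>P) + measure \<nu> (\<Union>P)"
      using P sets \<mu>.finite_measure_finite_Union[of P "\<lambda>x. x"]
        \<nu>.finite_measure_finite_Union[of P "\<lambda>x. x"]
      by (simp add: sum.distrib disjoint_def disjoint_family_on_def subset_iff)
    also have "\<dots> \<le> 2"
      using \<mu>.prob_le_1[of "\<Union>P"] \<nu>.prob_le_1[of "\<Union>P"] by linarith
    finally show ?thesis .
  qed
  then show "bdd_above ((\<lambda>P. \<Sum>A\<in>P. \<bar>measure \<mu> A - measure \<nu> A\<bar>) `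
      {P. finite P \<and> P \<subseteq> sets \<mu> \<and> disjoint P \<and> \<Union>P = space \<mu>})"
    by (intro bdd_aboveI[of _ 2]) auto
qed

text \<open>The sum counts the integer thresholds at most \<open>y\<close>; the bound
  \<open>y \<le> real n\<close> ensures that none of them lies beyond the range.\<close>

lemma sum_of_bool_le_eq_floor:
  assumes "0 \<le> y" "y \<le> real n"
  shows "(\<Sum>k=1..n. of_bool (real k \<le> y)) = real_of_int \<lfloor>y\<rfloor>"
proof -
  have "{k \<in> {1..n}. real k \<le> y} = {1..nat \<lfloor>y\<rfloor>}"
    using assms by (auto simp: le_nat_iff le_floor_iff)
  then have "card ({1..n} \<inter> {k. real k \<le> y}) = nat \<lfloor>y\<rfloor>"
    by (simp add: Int_def conj_commute)
  then show ?thesis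
    using assms by simp
qed

text \<open>A function with values in [0,1] is within \<open>1 / n\<close> of the average of the
  indicators of its superlevel sets at \<open>1/n, ..., n/n\<close>. Each indicator contributes at
  most \<open>\<delta>\<close>, and an average of such contributions is again at most
  \<open>\<delta>\<close>, so only the approximation error depends on \<open>n\<close>.\<close>

lemma integral_diff_le_unit:
  fixes f :: "'a \<Rightarrow> real"
  assumes "prob_space \<mu>" "prob_space \<nu>" and sets: "sets \<nu> = sets \<mu>"
    and f [measurable]: "f \<in> borel_measurable \<mu>"
    and f01: "\<And>x. x \<in> space \<mu> \<Longrightarrow> 0 \<le> f x \<and> f x \<le> 1"
    and \<delta>: "\<And>A. A \<in> sets \<mu> \<Longrightarrow> \<bar>measure \<mu> A - measure \<nu> A\<bar> \<le> \<delta>"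
  shows "\<bar>(\<integral>x. f x \<partial>\<mu>) - (\<integral>x. f x \<partial>\<nu>)\<bar> \<le> \<delta>"
proof -
  interpret \<mu>: prob_space \<mu> by fact
  interpret \<nu>: prob_space \<nu> by fact
  have sp: "space \<nu> = space \<mu>" using sets by (rule sets_eq_imp_space_eq)
  note [measurable_cong] = sets
  have "\<bar>(\<integral>x. f x \<partial>\<mu>) - (\<integral>x. f x \<partial>\<nu>)\<bar> \<le> \<delta> + 2 / real n" if n: "n > 0" for n :: nat
  proof -
    define E where "E k = {x \<in> space \<mu>. real k \<le> real n * f x}" for k
    have E [measurable]: "E k \<in> sets \<mu>" for k unfolding E_def by measurable
    define h where "h x = (\<Sum>k=1..n. indicator (E k) x) / real n" for x
    have h: "\<bar>f x - h x\<bar> \<le> 1 / real n" if "x \<in> space \<mu>" for x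
    proof -
      have "(\<Sum>k=1..n. indicator (E k) x) = (\<Sum>k=1..n. of_bool (real k \<le> real n * f x) :: real)"
        using that by (intro sum.cong) (auto simp: E_def indicator_def)
      also have "\<dots> = real_of_int \<lfloor>real n * f x\<rfloor>"
        using f01[OF that] by (intro sum_of_bool_le_eq_floor) (auto simp: mult_left_le)
      finally have "real n * h x = real_of_int \<lfloor>real n * f x\<rfloor>"
        using n by (simp add: h_def)
      then have "\<bar>real n * f x - real n * h x\<bar> \<le> 1" by linarith
      then have "real n * \<bar>f x - h x\<bar> \<le> 1"
        by (simp add: abs_mult flip: right_diff_distrib)
      then show ?thesis using n by (simp add: field_simps)
    qed
    have approx: "\<bar>(\<integral>x. f x \<partial>M) - (\<Sum>k=1..n. measure M (E k)) / real n\<bar> \<le> 1 / real n"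
      if "prob_space M" and M: "sets M = sets \<mu>" for M
    proof -
      interpret M: prob_space M by fact
      note [measurable_cong] = M
      have spM: "space M = space \<mu>" using M by (rule sets_eq_imp_space_eq)
      have intf: "integrable M f"
        using f01 by (intro M.integrable_const_bound[of _ 1]) (auto simp: spM)
      have intE: "integrable M (indicator (E k) :: _ \<Rightarrow> real)" for k
        by (intro M.integrable_const_bound[of _ 1]) (auto simp: indicator_def)
      have inth: "integrable M h"
        unfolding h_def by (intro integrable_divide Bochner_Integration.integrable_sum intE)
      have "(\<integral>x. h x \<partial>M) = (\<Sum>k=1..n. \<integral>x. indicator (E k) x \<partial>M) / real n"
        unfolding h_def integral_divide_zero Bochner_Integration.integral_sum[OF intE] ..
      also have "\<dots> = (\<Sum>k=1..n. measure M (E k)) / real n"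
        by (simp add: M)
      finally have "(\<integral>x. f x \<partial>M) - (\<Sum>k=1..n. measure M (E k)) / real n = (\<integral>x. f x - h x \<partial>M)"
        using intf inth by simp
      also have "\<bar>\<dots>\<bar> \<le> (\<integral>x. \<bar>f x - h x\<bar> \<partial>M)"
        by (rule integral_abs_bound)
      also have "\<dots> \<le> (\<integral>x. 1 / real n \<partial>M)"
        using intf inth h by (intro integral_mono) (auto simp: spM)
      finally show ?thesis by (simp add: M.prob_space)
    qed
    have "\<bar>(\<Sum>k=1..n. measure \<mu> (E k)) / real n - (\<Sum>k=1..n. measure \<nu> (E k)) / real n\<bar>
        = \<bar>\<Sum>k=1..n. measure \<mu> (E k) - measure \<nu> (E k)\<bar> / real n"
      using n by (simp add: sum_subtractf abs_divide flip: diff_divide_distrib)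
    also have "\<dots> \<le> (\<Sum>k=1..n. \<bar>measure \<mu> (E k) - measure \<nu> (E k)\<bar>) / real n"
      by (intro divide_right_mono sum_abs) auto
    also have "\<dots> \<le> (\<Sum>k=1..n. \<delta>) / real n"
      by (intro divide_right_mono sum_mono \<delta>) auto
    also have "\<dots> = \<delta>" using n by simp
    finally show ?thesis
      using approx[OF \<open>prob_space \<mu>\<close> refl] approx[OF \<open>prob_space \<nu>\<close> sets] by linarith
  qed
  then have "\<forall>\<^sub>F n in sequentially. \<bar>(\<integral>x. f x \<partial>\<mu>) - (\<integral>x. f x \<partial>\<nu>)\<bar> \<le> \<delta> + 2 / real n"
    by (intro eventually_mono[OF eventually_gt_at_top[of 0]])
  moreover have "(\<lambda>n. \<delta> + 2 / real n) \<longlonglongrightarrow> \<delta> + 0"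
    by (intro tendsto_add tendsto_const lim_const_over_n)
  ultimately show ?thesis
    using tendsto_lowerbound[of "\<lambda>n. \<delta> + 2 / real n" "\<delta> + 0" sequentially] by simp
qed

text \<open>The affine map of [-C, C] onto [0,1] has slope \<open>1 / (2 * C)\<close>, which is the
  origin of the factor \<open>2 * C\<close>; the additive constant cancels because both measures
  have mass one.\<close>

lemma integral_diff_le:
  fixes f :: "'a \<Rightarrow> real"
  assumes \<mu>: "prob_space \<mu>" and \<nu>: "prob_space \<nu>" and sets: "sets \<nu> = sets \<mu>"
    and f [measurable]: "f \<in> borel_measurable \<mu>"
    and C: "\<And>x. x \<in> space \<mu> \<Longrightarrow> \<bar>f x\<bar> \<le> C" "C > 0"
    and \<delta>: "\<And>A. A \<in> sets \<mu> \<Longrightarrow> \<bar>measure \<mu> A - measure \<nu> A\<bar> \<le> \<delta>"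
  shows "\<bar>(\<integral>x. f x \<partial>\<mu>) - (\<integral>x. f x \<partial>\<nu>)\<bar> \<le> 2 * C * \<delta>"
proof -
  define g where "g x = (f x + C) / (2 * C)" for x
  have g01: "0 \<le> g x \<and> g x \<le> 1" if "x \<in> space \<mu>" for x
    using C(1)[OF that] C(2) by (auto simp: g_def field_simps)
  have [measurable]: "g \<in> borel_measurable \<mu>" unfolding g_def by measurable
  have *: "(\<integral>x. f x \<partial>M) = 2 * C * (\<integral>x. g x \<partial>M) - C" if "prob_space M" and M: "sets M = sets \<mu>" for M
  proof -
    interpret M: prob_space M by fact
    note [measurable_cong] = M
    have spM: "space M = space \<mu>" using M by (rule sets_eq_imp_space_eq)
    have "integrable M g"
      using g01 by (intro M.integrable_const_bound[of _ 1]) (auto simp: spM)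
    then have "(\<integral>x. 2 * C * g x - C \<partial>M) = 2 * C * (\<integral>x. g x \<partial>M) - C"
      by (simp add: M.prob_space)
    moreover have "2 * C * g x - C = f x" for x using C(2) by (simp add: g_def field_simps)
    ultimately show ?thesis by simp
  qed
  have "\<bar>(\<integral>x. g x \<partial>\<mu>) - (\<integral>x. g x \<partial>\<nu>)\<bar> \<le> \<delta>"
    by (rule integral_diff_le_unit[OF \<mu> \<nu> sets]) (use g01 \<delta> in auto)
  then have "2 * C * \<bar>(\<integral>x. g x \<partial>\<mu>) - (\<integral>x. g x \<partial>\<nu>)\<bar> \<le> 2 * C * \<delta>"
    using C(2) by simp
  also have "2 * C * \<bar>(\<integral>x. g x \<partial>\<mu>) - (\<integral>x. g x \<partial>\<nu>)\<bar> = \<bar>2 * C * ((\<integral>x. g x \<partial>\<mu>) - (\<integral>x. g x \<partial>\<nu>))\<bar>"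
    using C(2) by (simp add: abs_mult)
  finally show ?thesis
    unfolding *[OF \<mu> refl] *[OF \<nu> sets] by (simp add: algebra_simps)
qed

section \<open>Locally compact second countable Hausdorff spaces\<close>

definition Cc :: "'a topology \<Rightarrow> ('a \<Rightarrow> 'b::real_normed_vector) set" where
  "Cc T = {f \<in> Cb T. \<exists>K. compactin T K \<and> (\<forall>x \<in> topspace T - K. f x = 0)}"

lemma second_countable_space_iff: "second_countable_space T \<longleftrightarrow> second_countable T"
  by (simp add: second_countable_space_def second_countable_def)

lemma Cc_subset_C0: "Cc T \<subseteq> C0 T"
  unfolding Cc_def C0_def by fastforce

lemma restrict_Cb:
  assumes "continuous_map T euclidean f" "\<And>x. x \<in> topspace T \<Longrightarrow> norm (f x) \<le> C"
  shows "restrict f (topspace T) \<in> Cb T"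
proof -
  have "continuous_map T euclidean (restrict f (topspace T))"
    using assms(1) by (rule continuous_map_eq) auto
  then show ?thesis
    using assms(2) by (auto simp: Cb_def bounded_iff intro!: exI[of _ C])
qed

lemma Cb_bound:
  assumes "f \<in> Cb T" obtains C where "C > 0" "\<And>x. x \<in> topspace T \<Longrightarrow> norm (f x) \<le> C"
  using assms by (auto simp: Cb_def bounded_pos)

lemma Cb_continuous: "f \<in> Cb T \<Longrightarrow> continuous_map T euclidean f"
  by (auto simp: Cb_def)

text \<open>Finitely many open sets with compact neighbourhoods inside \<open>U\<close> cover
  \<open>K\<close>. A Urysohn function that separates \<open>K\<close> from the complement of their
  union \<open>V'\<close> vanishes outside the compact set \<open>L'\<close>.\<close>

lemma compact_cutoff:
  assumes "locally_compact_space T" "Hausdorff_space T" and U: "openin T U" and K: "compactin T K" "K \<subseteq> U"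
  shows "\<exists>c L. continuous_map T euclideanreal c \<and> (\<forall>x \<in> topspace T. 0 \<le> c x \<and> c x \<le> 1) \<and>
    compactin T L \<and> L \<subseteq> U \<and> (\<forall>x\<in>K. c x = 1) \<and> (\<forall>x \<in> topspace T - L. c x = 0)"
proof -
  have "neighbourhood_base_of (\<lambda>C. compactin T C \<and> closedin T C) T"
    using assms(1,2) locally_compact_space_neighbourhood_base_closedin by blast
  then have "\<forall>x\<in>K. \<exists>V L. openin T V \<and> compactin T L \<and> x \<in> V \<and> V \<subseteq> L \<and> L \<subseteq> U"
    using U K(2) unfolding neighbourhood_base_of by (meson subsetD)
  then obtain V L where VL: "\<And>x. x \<in> K \<Longrightarrow> openin T (V x) \<and> compactin T (L x) \<and> x \<in> V x \<and> V x \<subseteq> L x \<and> L x \<subseteq> U"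
    by metis
  then obtain D where D: "finite D" "D \<subseteq> K" "K \<subseteq> \<Union>(V ` D)"
    using compactinD[OF K(1), of "V ` K"]
    by (smt (verit) UN_I finite_subset_image imageE subsetI)
  define V' where "V' = \<Union>(V ` D)"
  define L' where "L' = \<Union>(L ` D)"
  have V': "openin T V'" "K \<subseteq> V'" "V' \<subseteq> L'" and L': "compactin T L'" "L' \<subseteq> U"
    using D VL by (auto simp: V'_def L'_def intro!: openin_Union compactin_Union) (blast, blast)
  have cr: "completely_regular_space T"
    using assms(1,2) locally_compact_regular_imp_completely_regular_space by blast
  have "closedin T (topspace T - V')" "disjnt K (topspace T - V')"
    using V' by (auto simp: disjnt_def)
  then obtain c where c: "continuous_map T (top_of_set {0..1::real}) c" "c ` (topspace T - V') \<subseteq> {0}" "c ` K \<subseteq> {1}"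
    using Urysohn_completely_regular_compact_closed[OF zero_le_one cr K(1)] by blast
  show ?thesis
  proof (intro exI[of _ c] exI[of _ L'] conjI ballI)
    show "continuous_map T euclideanreal c"
      using c(1) continuous_map_into_fulltopology by blast
    show "0 \<le> c x" "c x \<le> 1" if "x \<in> topspace T" for x
      using c(1) that by (auto simp: continuous_map_in_subtopology)
    show "c x = 1" if "x \<in> K" for x using c(3) that by auto
    show "c x = 0" if "x \<in> topspace T - L'" for x using c(2) V'(3) that by blast
  qed (use L' in auto)
qed

text \<open>The sets \<open>K k\<close> are finite unions of closures of basic open sets that are
  relatively compact in \<open>U\<close>. The basic sets themselves are open and cover
  \<open>U\<close>, so a compact subset of \<open>U\<close> lies in \<open>K k\<close> from some
  index on; there the cutoffs are exactly 1, not merely close to 1.\<close>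

lemma open_cutoffs:
  assumes lc: "locally_compact_space T" and Hd: "Hausdorff_space T" and "second_countable T"
    and U: "openin T U"
  obtains c :: "nat \<Rightarrow> 'a \<Rightarrow> real" where
    "\<And>k. c k \<in> Cc T" "\<And>k x. x \<in> topspace T \<Longrightarrow> 0 \<le> c k x \<and> c k x \<le> 1"
    "\<And>k x. x \<in> topspace T - U \<Longrightarrow> c k x = 0"
    "\<And>K. compactin T K \<Longrightarrow> K \<subseteq> U \<Longrightarrow> \<forall>\<^sub>F k in sequentially. \<forall>x\<in>K. c k x = 1"
proof -
  obtain \<B> where \<B>: "countable \<B>" "\<And>V. V \<in> \<B> \<Longrightarrow> openin T V"
    "\<And>W x. openin T W \<Longrightarrow> x \<in> W \<Longrightarrow> \<exists>V\<in>\<B>. x \<in> V \<and> V \<subseteq> W"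
    using assms(3) unfolding second_countable_def by metis
  \<comment> \<open>The empty set is added so that the family can be enumerated by
    \<open>nat\<close> even if \<open>\<B>\<close> offers no suitable set.\<close>
  define \<C> where "\<C> = {V \<in> insert {} \<B>. compactin T (T closure_of V) \<and> T closure_of V \<subseteq> U}"
  have "{} \<in> \<C>" by (simp add: \<C>_def)
  moreover have "countable \<C>" using \<B>(1) by (auto simp: \<C>_def intro: countable_subset[of _ "insert {} \<B>"])
  ultimately obtain V :: "nat \<Rightarrow> 'a set" where V: "range V = \<C>"
    using range_from_nat_into[of \<C>] by blast
  have VC: "compactin T (T closure_of V k)" "T closure_of V k \<subseteq> U" "openin T (V k)" for k
  proof -
    have "V k \<in> \<C>" using V by blast
    then show "compactin T (T closure_of V k)" "T closure_of V k \<subseteq> U" "openin T (V k)"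
      using \<B>(2) by (auto simp: \<C>_def)
  qed
  define K where "K k = (\<Union>l\<le>k. T closure_of V l)" for k
  have K: "compactin T (K k)" "K k \<subseteq> U" for k
    unfolding K_def using VC by (auto intro!: compactin_Union)
  define P where "P k c \<longleftrightarrow> (\<exists>L. continuous_map T euclideanreal c \<and> (\<forall>x \<in> topspace T. 0 \<le> c x \<and> c x \<le> 1) \<and>
    compactin T L \<and> L \<subseteq> U \<and> (\<forall>x\<in>K k. c x = 1) \<and> (\<forall>x \<in> topspace T - L. c x = 0))" for k c
  have "\<exists>c. P k c" for k
    using compact_cutoff[OF lc Hd U K[of k]] by (simp add: P_def)
  then obtain c where c: "\<And>k. P k (c k)" by metis
  have c_cont: "continuous_map T euclideanreal (c k)" and c_01: "x \<in> topspace T \<Longrightarrow> 0 \<le> c k x \<and> c k x \<le> 1"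
    and c_L: "\<exists>L. compactin T L \<and> L \<subseteq> U \<and> (\<forall>x \<in> topspace T - L. c k x = 0)"
    and c_K: "x \<in> K k \<Longrightarrow> c k x = 1" for k x
    using c[of k] by (auto simp: P_def)
  show ?thesis
  proof (rule that[of "\<lambda>k. restrict (c k) (topspace T)"])
    fix k
    have "restrict (c k) (topspace T) \<in> Cb T"
      using c_cont c_01 by (intro restrict_Cb[where C = 1]) auto
    then show "restrict (c k) (topspace T) \<in> Cc T"
      using c_L[of k] by (auto simp: Cc_def)
  next
    fix k x assume "x \<in> topspace T - U"
    then show "restrict (c k) (topspace T) x = 0" using c_L[of k] by auto
  next
    fix C assume C: "compactin T C" "C \<subseteq> U"
    have "\<exists>k. x \<in> V k" if "x \<in> C" for x
    proof -
      have xU: "x \<in> U" using that C(2) by blast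
      have "neighbourhood_base_of (\<lambda>C. compactin T C \<and> closedin T C) T"
        using lc Hd locally_compact_space_neighbourhood_base_closedin by blast
      then obtain W L where WL: "openin T W" "compactin T L" "closedin T L" "x \<in> W" "W \<subseteq> L" "L \<subseteq> U"
        using U xU unfolding neighbourhood_base_of by meson
      obtain V' where V': "V' \<in> \<B>" "x \<in> V'" "V' \<subseteq> W" using \<B>(3)[OF WL(1,4)] by blast
      then have "T closure_of V' \<subseteq> L"
        using WL by (meson closure_of_minimal subset_trans)
      then have "V' \<in> \<C>"
        using V' WL by (auto simp: \<C>_def intro: closed_compactin)
      then show ?thesis using V V'(2) by blast
    qed
    then have "C \<subseteq> \<Union>(range V)" by blast
    then obtain F where F: "finite F" "F \<subseteq> range V" "C \<subseteq> \<Union>F"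
      using compactinD[OF C(1), of "range V"] VC(3) by blast
    then obtain D where "finite D" "F = V ` D"
      by (meson finite_subset_image)
    with F have D: "finite D" "C \<subseteq> \<Union>(V ` D)" by auto
    then obtain m where m: "\<And>l. l \<in> D \<Longrightarrow> l \<le> m"
      using D(1) finite_nat_set_iff_bounded_le[of D] by auto
    have "\<forall>x\<in>C. restrict (c k) (topspace T) x = 1" if "m \<le> k" for k
    proof
      fix x assume x: "x \<in> C"
      then obtain l where "l \<in> D" "x \<in> V l" using D(2) by blast
      then have "x \<in> K k"
        using m[of l] that closure_of_subset[OF openin_subset[OF VC(3)[of l]]] by (auto simp: K_def)
      then show "restrict (c k) (topspace T) x = 1"
        using c_K x compactin_subset_topspace[OF C(1)] by auto
    qed
    then show "\<forall>\<^sub>F k in sequentially. \<forall>x\<in>C. restrict (c k) (topspace T) x = 1"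
      using eventually_sequentially by blast
  qed (use c_01 in auto)
qed

lemma cutoffs_tendsto:
  assumes "\<And>x. x \<in> topspace T - U \<Longrightarrow> \<forall>k. c k x = (0::real)" "openin T U"
    "\<And>K. compactin T K \<Longrightarrow> K \<subseteq> U \<Longrightarrow> \<forall>\<^sub>F k in sequentially. \<forall>x\<in>K. c k x = 1" "x \<in> topspace T"
  shows "(\<lambda>k. c k x) \<longlonglongrightarrow> indicator U x"
proof (cases "x \<in> U")
  case True
  then have "\<forall>\<^sub>F k in sequentially. c k x = 1"
    using assms(3)[of "{x}"] assms(4) by simp
  then have "(\<lambda>k. c k x) \<longlonglongrightarrow> 1"
    by (rule tendsto_eventually)
  then show ?thesis using True by simp
next
  case False
  then have "c k x = 0" for k using assms(1,4) by auto
  then show ?thesis using False by simp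
qed

text \<open>Dominated convergence along the cutoffs of \<open>U\<close>. The sequence depends on
  \<open>U\<close> alone and serves all measures at once, which is what allows two measures to be
  compared and a kernel to be shown measurable.\<close>

lemma measure_open_lim:
  assumes "locally_compact_space T" "Hausdorff_space T" "second_countable T" and U: "openin T U"
  obtains c :: "nat \<Rightarrow> 'a \<Rightarrow> real" where "\<And>k. c k \<in> Cc T"
    "\<And>\<mu>. \<mu> \<in> Prob T \<Longrightarrow> (\<lambda>k. \<integral>x. c k x \<partial>\<mu>) \<longlonglongrightarrow> measure \<mu> U"
proof -
  obtain c :: "nat \<Rightarrow> 'a \<Rightarrow> real" where
    c: "\<And>k. c k \<in> Cc T" "\<And>k x. x \<in> topspace T \<Longrightarrow> 0 \<le> c k x \<and> c k x \<le> 1"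
    "\<And>k x. x \<in> topspace T - U \<Longrightarrow> c k x = 0"
    "\<And>K. compactin T K \<Longrightarrow> K \<subseteq> U \<Longrightarrow> \<forall>\<^sub>F k in sequentially. \<forall>x\<in>K. c k x = 1"
    by (fact open_cutoffs[OF assms])
  show ?thesis
  proof (rule that[OF c(1)])
    fix \<mu> assume \<mu>: "\<mu> \<in> Prob T"
    interpret \<mu>: prob_space \<mu> using ProbD(1)[OF \<mu>] .
    note [measurable_cong] = ProbD(2)[OF \<mu>]
    have [measurable]: "c k \<in> borel_measurable (borel_on T)" for k
      using c(1) by (auto simp: Cc_def intro!: continuous_map_borel_measurable Cb_continuous)
    have [measurable]: "U \<in> sets (borel_on T)" using U by (rule openin_borel_on)
    have "(\<lambda>k. \<integral>x. c k x \<partial>\<mu>) \<longlonglongrightarrow> (\<integral>x. indicator U x \<partial>\<mu>)"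
    proof (rule integral_dominated_convergence[where w = "\<lambda>_. 1"])
      show "AE x in \<mu>. (\<lambda>k. c k x) \<longlonglongrightarrow> indicator U x"
        using c U by (intro AE_I2 cutoffs_tendsto) (auto simp: ProbD(3)[OF \<mu>])
      show "AE x in \<mu>. norm (c k x) \<le> 1" for k
        using c(2) by (intro AE_I2) (auto simp: ProbD(3)[OF \<mu>])
    qed simp_all
    also have "(\<integral>x. indicator U x \<partial>\<mu>) = measure \<mu> U"
      using openin_subset[OF U] by (simp add: ProbD[OF \<mu>] inf_absorb1)
    finally show "(\<lambda>k. \<integral>x. c k x \<partial>\<mu>) \<longlonglongrightarrow> measure \<mu> U" .
  qed
qed

section \<open>Measures and kernels tested on compactly supported functions\<close>

lemma Int_stable_openin: "Int_stable {U. openin T U}"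
  by (auto simp: Int_stable_def)

lemma Prob_eqI:
  assumes T: "locally_compact_space T" "Hausdorff_space T" "second_countable T"
    and \<mu>: "\<mu> \<in> Prob T" and \<nu>: "\<nu> \<in> Prob T"
    and eq: "\<And>c :: 'a \<Rightarrow> real. c \<in> Cc T \<Longrightarrow> (\<integral>x. c x \<partial>\<mu>) = (\<integral>x. c x \<partial>\<nu>)"
  shows "\<mu> = \<nu>"
proof (rule measure_eqI_generator_eq[OF Int_stable_openin[of T], where \<Omega> = "topspace T" and A = "\<lambda>_. topspace T"])
  interpret \<mu>: prob_space \<mu> using ProbD(1)[OF \<mu>] .
  interpret \<nu>: prob_space \<nu> using ProbD(1)[OF \<nu>] .
  show "{U. openin T U} \<subseteq> Pow (topspace T)" by (auto dest: openin_subset)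
  show "sets \<mu> = sigma_sets (topspace T) {U. openin T U}" "sets \<nu> = sigma_sets (topspace T) {U. openin T U}"
    using \<mu> \<nu> by (simp_all add: ProbD sets_borel_on)
  fix U assume "U \<in> {U. openin T U}"
  then have U: "openin T U" by simp
  obtain c :: "nat \<Rightarrow> 'a \<Rightarrow> real" where c: "\<And>k. c k \<in> Cc T"
    "\<And>\<mu>. \<mu> \<in> Prob T \<Longrightarrow> (\<lambda>k. \<integral>x. c k x \<partial>\<mu>) \<longlonglongrightarrow> measure \<mu> U"
    by (fact measure_open_lim[OF T U])
  have "measure \<mu> U = measure \<nu> U"
    using LIMSEQ_unique[of "\<lambda>k. \<integral>x. c k x \<partial>\<mu>"] c(2)[OF \<mu>] c(2)[OF \<nu>] eq[OF c(1)] by simp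
  then show "emeasure \<mu> U = emeasure \<nu> U"
    by (simp add: \<mu>.emeasure_eq_measure \<nu>.emeasure_eq_measure)
qed (auto simp: prob_space.emeasure_space_1 ProbD[OF \<mu>] finite_measure.emeasure_finite prob_space.finite_measure)

text \<open>The mass of an open set is a pointwise limit of functions measurable by assumption,
  whatever space parametrizes the kernel. In the application the kernels are indexed through
  boundary points, where no metrizability is available.\<close>

lemma Prob_kernel_measurable:
  assumes T: "locally_compact_space T" "Hausdorff_space T" "second_countable T"
    and N: "\<And>y. y \<in> space M \<Longrightarrow> N y \<in> Prob T"
    and meas: "\<And>c :: 'a \<Rightarrow> real. c \<in> Cc T \<Longrightarrow> (\<lambda>y. \<integral>x. c x \<partial>N y) \<in> borel_measurable M"
  shows "N \<in> M \<rightarrow>\<^sub>M prob_algebra (borel_on T)"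
proof (rule measurable_prob_algebra_generated[OF sets_borel_on Int_stable_openin])
  fix U assume "U \<in> {U. openin T U}"
  then have U: "openin T U" by simp
  obtain c :: "nat \<Rightarrow> 'a \<Rightarrow> real" where c: "\<And>k. c k \<in> Cc T"
    "\<And>\<mu>. \<mu> \<in> Prob T \<Longrightarrow> (\<lambda>k. \<integral>x. c k x \<partial>\<mu>) \<longlonglongrightarrow> measure \<mu> U"
    by (fact measure_open_lim[OF T U])
  have "(\<lambda>y. measure (N y) U) \<in> borel_measurable M"
    by (rule borel_measurable_LIMSEQ_real[OF c(2)[OF N] meas[OF c(1)]])
  then have "(\<lambda>y. ennreal (measure (N y) U)) \<in> borel_measurable M" by measurable
  then show "(\<lambda>y. emeasure (N y) U) \<in> borel_measurable M"
    by (rule measurable_cong[THEN iffD1, rotated])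
      (metis N ProbD(1) finite_measure.emeasure_eq_measure prob_space.finite_measure)
qed (use ProbD[OF N] in \<open>auto dest: openin_subset\<close>)

section \<open>Invariant means from topologically amenable actions\<close>

text \<open>By Tychonoff the families \<open>I m\<close>, bounded coordinate by coordinate, have a
  cluster point in a product of intervals. The finer filter \<open>F'\<close> then turns clustering
  into convergence in all coordinates of \<open>S\<close> at once, like the passage to a
  subnet.\<close>

lemma pointwise_cluster_filter:
  fixes I :: "'m \<Rightarrow> 'f \<Rightarrow> real"
  assumes F: "F \<noteq> bot" and bd: "\<And>f. f \<in> S \<Longrightarrow> \<exists>C. \<forall>\<^sub>F m in F. \<bar>I m f\<bar> \<le> C"
  obtains F' where "F' \<le> F" "F' \<noteq> bot" "\<And>f. f \<in> S \<Longrightarrow> \<exists>l. ((\<lambda>m. I m f) \<longlongrightarrow> l) F'"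
proof -
  obtain C where C: "\<And>f. f \<in> S \<Longrightarrow> \<forall>\<^sub>F m in F. \<bar>I m f\<bar> \<le> C f"
    using bd by metis
  \<comment> \<open>Clamping puts every \<open>J m\<close> into the compact box \<open>K\<close>,
    although the bound on \<open>I m f\<close> holds only eventually and from a stage that depends
    on \<open>f\<close>. For each \<open>f\<close> in \<open>S\<close> both eventually
    agree.\<close>
  define J where "J m f = max (- \<bar>C f\<bar>) (min \<bar>C f\<bar> (I m f))" for m f
  define K where "K = Pi UNIV (\<lambda>f. {- \<bar>C f\<bar>..\<bar>C f\<bar>})"
  have "compactin (product_topology (\<lambda>_. euclidean) UNIV) (PiE UNIV (\<lambda>f. {- \<bar>C f\<bar>..\<bar>C f\<bar>}))"
    unfolding compactin_PiE by auto
  then have K: "compact K"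
    by (simp add: K_def PiE_UNIV_domain euclidean_product_topology)
  have "J m \<in> K" for m
    by (auto simp: K_def J_def)
  then have "\<forall>\<^sub>F y in filtermap J F. y \<in> K"
    by (simp add: eventually_filtermap)
  moreover have "filtermap J F \<noteq> bot"
    using F by (simp add: filtermap_bot_iff)
  ultimately obtain x where x: "inf (nhds x) (filtermap J F) \<noteq> bot"
    using K unfolding compact_filter by meson
  define F' where "F' = inf F (filtercomap J (nhds x))"
  have "F' \<noteq> bot"
  proof
    assume "F' = bot"
    then have "eventually (\<lambda>_. False) (inf F (filtercomap J (nhds x)))"
      by (simp add: F'_def)
    then obtain P Q where PQ: "eventually P F" "eventually Q (filtercomap J (nhds x))" "\<And>m. P m \<Longrightarrow> Q m \<Longrightarrow> False"
      unfolding eventually_inf by auto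
    then obtain Q' where Q': "eventually Q' (nhds x)" "\<And>m. Q' (J m) \<Longrightarrow> Q m"
      unfolding eventually_filtercomap by blast
    have "eventually (\<lambda>y. \<not> Q' y) (filtermap J F)"
      unfolding eventually_filtermap using PQ(1) by eventually_elim (use PQ(3) Q'(2) in blast)
    then have "eventually (\<lambda>_. False) (inf (nhds x) (filtermap J F))"
      using Q'(1) unfolding eventually_inf by blast
    then show False using x by (simp add: eventually_False)
  qed
  moreover have le: "F' \<le> F" by (simp add: F'_def)
  moreover have "\<exists>l. ((\<lambda>m. I m f) \<longlongrightarrow> l) F'" if f: "f \<in> S" for f
  proof
    have "filterlim J (nhds x) F'"
      unfolding F'_def by (rule filterlim_mono[OF filterlim_filtercomap order_refl inf_le2])
    then have "((\<lambda>m. J m f) \<longlongrightarrow> x f) F'"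
      by (rule continuous_on_tendsto_compose[OF continuous_on_product_coordinates[of f]]) auto
    moreover have "\<forall>\<^sub>F m in F'. J m f = I m f"
      using filter_leD[OF le C[OF f]] by eventually_elim (auto simp: J_def)
    ultimately show "((\<lambda>m. I m f) \<longlongrightarrow> x f) F'"
      by (rule Lim_transform_eventually)
  qed
  ultimately show ?thesis using that[of F'] by blast
qed

section \<open>Means on bounded Borel functions\<close>

definition bounded_Borel :: "'a topology \<Rightarrow> ('a \<Rightarrow> real) set" where
  "bounded_Borel T = {f \<in> borel_measurable (borel_on T). \<exists>C. \<forall>x\<in>topspace T. \<bar>f x\<bar> \<le> C}"

lemma bounded_BorelE:
  assumes "f \<in> bounded_Borel T"
  obtains C where "f \<in> borel_measurable (borel_on T)" "C > 0" "\<And>x. x \<in> topspace T \<Longrightarrow> \<bar>f x\<bar> \<le> C"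
proof -
  obtain C where C: "f \<in> borel_measurable (borel_on T)" "\<forall>x\<in>topspace T. \<bar>f x\<bar> \<le> C"
    using assms by (auto simp: bounded_Borel_def)
  show ?thesis
    by (rule that[of "max C 1"]) (use C in \<open>auto simp: le_max_iff_disj\<close>)
qed

lemma Cb_bounded_Borel: "f \<in> Cb T \<Longrightarrow> f \<in> bounded_Borel T"
  by (auto simp: bounded_Borel_def bounded_iff Cb_def continuous_map_borel_measurable)

lemma bounded_Borel_integrable:
  assumes "f \<in> bounded_Borel T" and \<mu>: "\<mu> \<in> Prob T"
  shows "integrable \<mu> f"
proof -
  interpret \<mu>: prob_space \<mu> using ProbD(1)[OF \<mu>] .
  obtain C where C: "f \<in> borel_measurable (borel_on T)" "C > 0" "\<And>x. x \<in> topspace T \<Longrightarrow> \<bar>f x\<bar> \<le> C"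
    by (fact bounded_BorelE[OF assms(1)])
  show ?thesis
    using C(1,3) by (intro \<mu>.integrable_const_bound[of _ C] AE_I2)
      (auto simp: ProbD(3)[OF \<mu>] measurable_cong_sets[OF ProbD(2)[OF \<mu>] refl])
qed

lemma bounded_Borel_integral_bound:
  fixes f :: "'a \<Rightarrow> real"
  assumes \<mu>: "\<mu> \<in> Prob T" and C: "\<And>x. x \<in> topspace T \<Longrightarrow> \<bar>f x\<bar> \<le> C" "f \<in> borel_measurable (borel_on T)"
  shows "\<bar>\<integral>x. f x \<partial>\<mu>\<bar> \<le> C"
proof -
  interpret \<mu>: prob_space \<mu> using ProbD(1)[OF \<mu>] .
  have int: "integrable \<mu> f"
    using C by (intro bounded_Borel_integrable[OF _ \<mu>]) (auto simp: bounded_Borel_def)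
  have "\<bar>\<integral>x. f x \<partial>\<mu>\<bar> \<le> (\<integral>x. \<bar>f x\<bar> \<partial>\<mu>)" by (rule integral_abs_bound)
  also have "\<dots> \<le> (\<integral>x. C \<partial>\<mu>)"
    using int C by (intro integral_mono) (auto simp: ProbD(3)[OF \<mu>])
  finally show ?thesis by (simp add: \<mu>.prob_space)
qed

lemma bind_Prob:
  assumes "prob_space M" "N \<in> M \<rightarrow>\<^sub>M prob_algebra (borel_on T)"
  shows "M \<bind> N \<in> Prob T"
proof -
  have "M \<in> space (prob_algebra M)" using assms(1) by (simp add: space_prob_algebra)
  with assms(2) show ?thesis
    by (auto simp: Prob_def intro!: prob_space_bind' sets_bind')
qed

lemma bind_bounded_Borel:
  assumes M: "prob_space M" and N: "N \<in> M \<rightarrow>\<^sub>M prob_algebra (borel_on T)" and f: "f \<in> bounded_Borel T"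
  shows "(\<integral>x. f x \<partial>(M \<bind> N)) = (\<integral>z. \<integral>x. f x \<partial>N z \<partial>M)"
proof -
  obtain C where C: "f \<in> borel_measurable (borel_on T)" "C > 0" "\<And>x. x \<in> topspace T \<Longrightarrow> \<bar>f x\<bar> \<le> C"
    by (fact bounded_BorelE[OF f])
  show ?thesis
  proof (rule integral_bind[where B' = 1])
    show "AE z in M. emeasure (N z) (space (N z)) \<le> ennreal 1"
      using measurable_space[OF N]
      by (intro AE_I2) (auto simp: space_prob_algebra prob_space.emeasure_space_1)
  qed (use C M N in \<open>auto simp: prob_space.finite_measure measurable_prob_algebraD\<close>)
qed

lemma bind_measure:
  assumes M: "prob_space M" and N: "N \<in> M \<rightarrow>\<^sub>M prob_algebra (borel_on T)" and A: "A \<in> sets (borel_on T)"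
  shows "measure (M \<bind> N) A = (\<integral>z. measure (N z) A \<partial>M)"
  by (rule subprob_space.measure_bind[OF prob_space_imp_subprob_space[OF M] measurable_prob_algebraD[OF N] A])

text \<open>The functions are not normalized outside the space, hence the last clause, by which the
  mean sees only the values on it. The set \<open>H\<close> is arbitrary; it is later a discrete
  subgroup or the whole carrier.\<close>

definition invariant_Borel_mean ::
    "('a, 'm) monoid_scheme \<Rightarrow> 'a topology \<Rightarrow> 'a set \<Rightarrow> (('a \<Rightarrow> real) \<Rightarrow> real) \<Rightarrow> bool" where
  "invariant_Borel_mean G T H \<Phi> \<longleftrightarrow>
    (\<forall>f\<in>bounded_Borel T. \<forall>f'\<in>bounded_Borel T. \<Phi> (\<lambda>x. f x + f' x) = \<Phi> f + \<Phi> f') \<and>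
    (\<forall>c. \<forall>f\<in>bounded_Borel T. \<Phi> (\<lambda>x. c * f x) = c * \<Phi> f) \<and>
    (\<forall>f\<in>bounded_Borel T. (\<forall>x\<in>topspace T. 0 \<le> f x) \<longrightarrow> 0 \<le> \<Phi> f) \<and>
    \<Phi> (\<lambda>x. 1) = 1 \<and>
    (\<forall>g\<in>H. \<forall>f\<in>bounded_Borel T. \<Phi> (\<lambda>x. f (g \<otimes>\<^bsub>G\<^esub> x)) = \<Phi> f) \<and>
    (\<forall>f\<in>bounded_Borel T. \<forall>f'. (\<forall>x\<in>topspace T. f x = f' x) \<longrightarrow> \<Phi> f = \<Phi> f')"

lemma invariant_Borel_meanD:
  assumes "invariant_Borel_mean G T H \<Phi>"
  shows "\<And>f f'. f \<in> bounded_Borel T \<Longrightarrow> f' \<in> bounded_Borel T \<Longrightarrow> \<Phi> (\<lambda>x. f x + f' x) = \<Phi> f + \<Phi> f'"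
    "\<And>c f. f \<in> bounded_Borel T \<Longrightarrow> \<Phi> (\<lambda>x. c * f x) = c * \<Phi> f"
    "\<And>f. f \<in> bounded_Borel T \<Longrightarrow> (\<And>x. x \<in> topspace T \<Longrightarrow> 0 \<le> f x) \<Longrightarrow> 0 \<le> \<Phi> f"
    "\<Phi> (\<lambda>x. 1) = 1"
    "\<And>g f. g \<in> H \<Longrightarrow> f \<in> bounded_Borel T \<Longrightarrow> \<Phi> (\<lambda>x. f (g \<otimes>\<^bsub>G\<^esub> x)) = \<Phi> f"
    "\<And>f f'. f \<in> bounded_Borel T \<Longrightarrow> (\<And>x. x \<in> topspace T \<Longrightarrow> f x = f' x) \<Longrightarrow> \<Phi> f = \<Phi> f'"
  using assms unfolding invariant_Borel_mean_def by blast+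

context lcsc_group
begin

lemma continuous_map_lmult:
  assumes "g \<in> carrier G" shows "continuous_map T T (\<lambda>x. g \<otimes> x)"
proof -
  have "continuous_map T (prod_topology T T) (\<lambda>x. (g, x))"
    using assms by (simp add: continuous_map_pairwise o_def topspace_eq)
  from continuous_map_compose[OF this continuous_mult]
  show ?thesis by (simp add: o_def)
qed

lemma continuous_map_rmult:
  assumes "g \<in> carrier G" shows "continuous_map T T (\<lambda>x. x \<otimes> g)"
proof -
  have "continuous_map T (prod_topology T T) (\<lambda>x. (x, g))"
    using assms by (simp add: continuous_map_pairwise o_def topspace_eq)
  from continuous_map_compose[OF this continuous_mult]
  show ?thesis by (simp add: o_def)
qed

text \<open>The kernels \<open>m\<close> become more and more equivariant along the filter \<open>F\<close>. Integrated over an invariant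
  measure \<open>M\<close> on the boundary they yield more and more invariant measures on \<open>G\<close>, of
  which \<open>\<Phi>\<close> is a cluster point.\<close>

lemma amenable_action_invariant_mean:
  fixes Y :: "'y topology" and M :: "'z measure" and q :: "'z \<Rightarrow> 'y"
  assumes amen: "topologically_amenable G T Y act"
    and M: "prob_space M"
    and C: "compactin Y C" "\<And>z. z \<in> space M \<Longrightarrow> q z \<in> C"
    and H: "H \<subseteq> carrier G"
    and act: "\<And>g z. g \<in> H \<Longrightarrow> z \<in> space M \<Longrightarrow> act g (q z) \<in> topspace Y"
    and q_meas: "\<And>h :: 'y \<Rightarrow> real. continuous_map Y euclidean h \<Longrightarrow> (\<lambda>z. h (q z)) \<in> borel_measurable M"
    and act_meas: "\<And>g (h :: 'y \<Rightarrow> real). g \<in> H \<Longrightarrow> continuous_map Y euclidean h \<Longrightarrow>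
      (\<lambda>z. h (act g (q z))) \<in> borel_measurable M"
    and inv: "\<And>g (h :: 'y \<Rightarrow> real). g \<in> H \<Longrightarrow> continuous_map Y euclidean h \<Longrightarrow> bounded (h ` topspace Y) \<Longrightarrow>
      (\<integral>z. h (act g (q z)) \<partial>M) = (\<integral>z. h (q z) \<partial>M)"
  shows "\<exists>\<Phi>. invariant_Borel_mean G T H \<Phi>"
proof -
  interpret M: prob_space M by fact
  have sc: "second_countable T" using second_countable by (simp add: second_countable_space_iff)
  note T = locally_compact Hausdorff sc
  obtain F where "F \<noteq> bot \<and> (\<forall>\<^sub>F m in F. weak_star_continuous Y T m) \<and>
      (\<forall>K. compactin (prod_topology T Y) K \<longrightarrow> uniform_limit K
         (\<lambda>m (g, y). tv_norm_diff (translate_measure G T g (m y)) (m (act g y))) (\<lambda>_. 0) F)"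
    using amen unfolding topologically_amenable_def by (elim exE)
  then have F: "F \<noteq> bot" "\<forall>\<^sub>F m in F. weak_star_continuous Y T m"
    and unif: "\<And>K. compactin (prod_topology T Y) K \<Longrightarrow> uniform_limit K
        (\<lambda>m (g, y). tv_norm_diff (translate_measure G T g (m y)) (m (act g y))) (\<lambda>_. 0) F"
    by auto
  define P where "P m = M \<bind> (\<lambda>z. m (q z))" for m :: "'y \<Rightarrow> 'a measure"
  have qY: "q z \<in> topspace Y" if "z \<in> space M" for z
    using C(2)[OF that] compactin_subset_topspace[OF C(1)] by blast
  \<comment> \<open>Weak-* continuity is given for complex functions in \<open>C0\<close>; embedding
    \<open>c\<close> into them and taking real parts gives it for real functions of compact
    support.\<close>
  have weak: "continuous_map Y euclidean (\<lambda>y. \<integral>x. c x \<partial>m y)" 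
    if m: "weak_star_continuous Y T m" and c: "c \<in> Cc T" for m and c :: "'a \<Rightarrow> real"
  proof -
    have cb: "c \<in> bounded_Borel T" using c by (auto simp: Cc_def intro: Cb_bounded_Borel)
    obtain K where K: "compactin T K" "\<forall>x\<in>topspace T - K. c x = 0" and "c \<in> Cb T"
      using c by (auto simp: Cc_def)
    then obtain B where B: "\<And>x. x \<in> topspace T \<Longrightarrow> norm (c x) \<le> B" "continuous_map T euclidean c"
      by (metis Cb_bound Cb_continuous)
    have "continuous_map T euclidean (\<lambda>x. complex_of_real (c x))"
      using continuous_map_compose[OF B(2), of euclidean complex_of_real]
      by (simp add: o_def continuous_on_of_real_id)
    then have "restrict (\<lambda>x. complex_of_real (c x)) (topspace T) \<in> Cb T"
      using B(1) by (intro restrict_Cb[where C = B]) auto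
    then have "restrict (\<lambda>x. complex_of_real (c x)) (topspace T) \<in> C0 T"
      using K Cc_subset_C0 by (fastforce simp: Cc_def)
    then have "continuous_map Y euclidean (\<lambda>y. \<integral>x. restrict (\<lambda>x. complex_of_real (c x)) (topspace T) x \<partial>m y)"
      by (rule bspec[OF conjunct2[OF m[unfolded weak_star_continuous_def]]])
    then have "continuous_map Y euclidean (Re \<circ> (\<lambda>y. \<integral>x. restrict (\<lambda>x. complex_of_real (c x)) (topspace T) x \<partial>m y))"
      by (rule continuous_map_compose) (simp add: continuous_on_Re)
    then show ?thesis
    proof (rule continuous_map_eq)
      fix y assume "y \<in> topspace Y"
      then have my: "m y \<in> Prob T" using m by (simp add: weak_star_continuous_def)
      have "(\<integral>x. restrict (\<lambda>x. complex_of_real (c x)) (topspace T) x \<partial>m y) = (\<integral>x. complex_of_real (c x) \<partial>m y)"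
        by (rule Bochner_Integration.integral_cong) (auto simp: ProbD(3)[OF my])
      then show "(Re \<circ> (\<lambda>y. \<integral>x. restrict (\<lambda>x. complex_of_real (c x)) (topspace T) x \<partial>m y)) y = (\<integral>x. c x \<partial>m y)"
        by simp
    qed
  qed
  have kernel: "(\<lambda>z. m (q z)) \<in> M \<rightarrow>\<^sub>M prob_algebra (borel_on T)" if m: "weak_star_continuous Y T m" for m
    by (rule Prob_kernel_measurable[OF T])
      (use m qY in \<open>auto simp: weak_star_continuous_def intro: q_meas[OF weak[OF m]]\<close>)
  have kernel_act: "(\<lambda>z. m (act g (q z))) \<in> M \<rightarrow>\<^sub>M prob_algebra (borel_on T)"
    if m: "weak_star_continuous Y T m" and g: "g \<in> H" for m g
    by (rule Prob_kernel_measurable[OF T])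
      (use m act g in \<open>auto simp: weak_star_continuous_def intro: act_meas[OF g weak[OF m]]\<close>)
  have P: "P m \<in> Prob T" if "weak_star_continuous Y T m" for m
    unfolding P_def by (rule bind_Prob[OF M kernel[OF that]])
  \<comment> \<open>The integral of \<open>c\<close> against \<open>m y\<close> is a bounded
    continuous function of \<open>y\<close>, so the invariance of \<open>M\<close> applies to it.
    Averaging the kernels over the moved points thus reproduces \<open>P m\<close> exactly; only the
    equivariance of \<open>m\<close> is approximate.\<close>
  have P_act: "P m = M \<bind> (\<lambda>z. m (act g (q z)))" if m: "weak_star_continuous Y T m" and g: "g \<in> H" for m g
  proof (rule Prob_eqI[OF T P[OF m] bind_Prob[OF M kernel_act[OF m g]]])
    fix c :: "'a \<Rightarrow> real" assume c: "c \<in> Cc T"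
    then have cb: "c \<in> bounded_Borel T" by (auto simp: Cc_def intro: Cb_bounded_Borel)
    obtain B where B: "c \<in> borel_measurable (borel_on T)" "B > 0" "\<And>x. x \<in> topspace T \<Longrightarrow> \<bar>c x\<bar> \<le> B"
      by (fact bounded_BorelE[OF cb])
    have "bounded ((\<lambda>y. \<integral>x. c x \<partial>m y) ` topspace Y)"
      unfolding bounded_iff
      using m B by (auto simp: weak_star_continuous_def intro!: exI[of _ B] bounded_Borel_integral_bound)
    then show "(\<integral>x. c x \<partial>P m) = (\<integral>x. c x \<partial>(M \<bind> (\<lambda>z. m (act g (q z)))))"
      unfolding P_def bind_bounded_Borel[OF M kernel[OF m] cb] bind_bounded_Borel[OF M kernel_act[OF m g] cb]
      using inv[OF g weak[OF m c]] by simp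
  qed
  have g_meas: "(\<lambda>x. g \<otimes> x) \<in> borel_on T \<rightarrow>\<^sub>M borel_on T" if "g \<in> carrier G" for g
    by (rule continuous_map_measurable_borel_on[OF continuous_map_lmult[OF that]])
  have translate: "translate_measure G T g \<mu> \<in> Prob T" "\<And>A. A \<in> sets (borel_on T) \<Longrightarrow>
      measure (translate_measure G T g \<mu>) A = measure \<mu> ((\<lambda>x. g \<otimes> x) -` A \<inter> topspace T)"
    "\<And>f :: 'a \<Rightarrow> real. f \<in> borel_measurable (borel_on T) \<Longrightarrow> (\<integral>x. f x \<partial>translate_measure G T g \<mu>) = (\<integral>x. f (g \<otimes> x) \<partial>\<mu>)"
    if \<mu>: "\<mu> \<in> Prob T" and g: "g \<in> carrier G" for \<mu> g
  proof -
    have gm: "(\<lambda>x. g \<otimes> x) \<in> \<mu> \<rightarrow>\<^sub>M borel_on T"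
      using g_meas[OF g] ProbD(2)[OF \<mu>] measurable_cong_sets by blast
    show "translate_measure G T g \<mu> \<in> Prob T"
      unfolding Prob_def translate_measure_def
      using prob_space.prob_space_distr[OF ProbD(1)[OF \<mu>] gm] by simp
    show "measure (translate_measure G T g \<mu>) A = measure \<mu> ((\<lambda>x. g \<otimes> x) -` A \<inter> topspace T)"
      if "A \<in> sets (borel_on T)" for A
      unfolding translate_measure_def using measure_distr[OF gm that] by (simp add: ProbD(3)[OF \<mu>])
    show "(\<integral>x. f x \<partial>translate_measure G T g \<mu>) = (\<integral>x. f (g \<otimes> x) \<partial>\<mu>)"
      if "f \<in> borel_measurable (borel_on T)" for f :: "'a \<Rightarrow> real"
      unfolding translate_measure_def by (rule integral_distr[OF gm that])
  qed
  have asymp: "\<forall>\<^sub>F m in F. \<bar>(\<integral>x. f (g \<otimes> x) \<partial>P m) - (\<integral>x. f x \<partial>P m)\<bar> < \<epsilon>"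
    if g: "g \<in> H" and f: "f \<in> bounded_Borel T" and "\<epsilon> > 0" for g f \<epsilon>
  proof -
    have gG: "g \<in> carrier G" using H g by blast
    obtain B where B: "f \<in> borel_measurable (borel_on T)" "B > 0" "\<And>x. x \<in> topspace T \<Longrightarrow> \<bar>f x\<bar> \<le> B"
      by (fact bounded_BorelE[OF f])
    \<comment> \<open>The comparison of integrals costs a factor \<open>2 * B\<close>, so this
      choice leaves \<open>\<epsilon> / 2\<close>.\<close>
    define \<delta> where "\<delta> = \<epsilon> / (4 * B)"
    have \<delta>: "\<delta> > 0" "2 * B * \<delta> < \<epsilon>" using B(2) \<open>\<epsilon> > 0\<close> by (auto simp: \<delta>_def)
    \<comment> \<open>The uniformity over compact sets is exploited for a single group element and
      the compact set \<open>C\<close> that contains all points \<open>q z\<close>.\<close>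
    have "compactin (prod_topology T Y) ({g} \<times> C)"
      using C(1) gG by (simp add: compactin_Times topspace_eq)
    from uniform_limitD[OF unif[OF this] \<delta>(1)]
    have "\<forall>\<^sub>F m in F. \<forall>y\<in>C. \<bar>tv_norm_diff (translate_measure G T g (m y)) (m (act g y))\<bar> < \<delta>"
      by simp
    with F(2) show ?thesis
    proof eventually_elim
      case (elim m)
      note m = elim(1)
      have Pm: "P m \<in> Prob T" by (rule P[OF m])
      have "\<bar>(\<integral>x. f x \<partial>translate_measure G T g (P m)) - (\<integral>x. f x \<partial>P m)\<bar> \<le> 2 * B * \<delta>"
      proof (rule integral_diff_le)
        show "prob_space (translate_measure G T g (P m))" "prob_space (P m)"
          "sets (P m) = sets (translate_measure G T g (P m))"
          using Pm translate(1)[OF Pm gG] by (simp_all add: ProbD)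
        show "f \<in> borel_measurable (translate_measure G T g (P m))"
          using B(1) ProbD(2)[OF translate(1)[OF Pm gG]] measurable_cong_sets by blast
        show "\<bar>f x\<bar> \<le> B" if "x \<in> space (translate_measure G T g (P m))" for x
          using that B(3) by (simp add: ProbD(3)[OF translate(1)[OF Pm gG]])
        show "B > 0" by fact
        fix A assume "A \<in> sets (translate_measure G T g (P m))"
        then have A: "A \<in> sets (borel_on T)" by (simp add: ProbD(2)[OF translate(1)[OF Pm gG]])
        have A': "(\<lambda>x. g \<otimes> x) -` A \<inter> topspace T \<in> sets (borel_on T)"
          using measurable_sets[OF g_meas[OF gG] A] by simp
        have meas: "(\<lambda>z. measure (N z) A) \<in> borel_measurable M"
          if "N \<in> M \<rightarrow>\<^sub>M prob_algebra (borel_on T)" and "A \<in> sets (borel_on T)" for N and A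
          using measurable_compose[OF measurable_prob_algebraD[OF that(1)] measurable_measure_subprob_algebra[OF that(2)]] .
        have int: "integrable M (\<lambda>z. measure (N z) A)"
          if N: "N \<in> M \<rightarrow>\<^sub>M prob_algebra (borel_on T)" and "A \<in> sets (borel_on T)" for N and A
          using measurable_space[OF N] meas[OF that]
          by (intro M.integrable_const_bound[of _ 1] AE_I2) (auto simp: space_prob_algebra prob_space.prob_le_1)
        \<comment> \<open>The first measure is expanded over the points \<open>q z\<close>, the
          second by \<open>P_act\<close> over the points \<open>act g (q z)\<close>. The integrand
          then compares the translated kernel at a point with the kernel at the moved point, and
          this is small uniformly in \<open>z\<close>.\<close>
        have "measure (translate_measure G T g (P m)) A - measure (P m) A
          = (\<integral>z. measure (m (q z)) ((\<lambda>x. g \<otimes> x) -` A \<inter> topspace T) \<partial>M) - (\<integral>z. measure (m (act g (q z))) A \<partial>M)"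
          unfolding translate(2)[OF Pm gG A]
          unfolding bind_measure[OF M kernel_act[OF m g] A, symmetric] P_act[OF m g, symmetric]
          unfolding bind_measure[OF M kernel[OF m] A', symmetric] P_def ..
        also have "\<dots> = (\<integral>z. measure (m (q z)) ((\<lambda>x. g \<otimes> x) -` A \<inter> topspace T) - measure (m (act g (q z))) A \<partial>M)"
          using int[OF kernel[OF m] A'] int[OF kernel_act[OF m g] A] by simp
        also have "\<bar>\<dots>\<bar> \<le> (\<integral>z. \<bar>measure (m (q z)) ((\<lambda>x. g \<otimes> x) -` A \<inter> topspace T) - measure (m (act g (q z))) A\<bar> \<partial>M)"
          by (rule integral_abs_bound)
        also have "\<dots> \<le> (\<integral>z. \<delta> \<partial>M)"
        proof (rule integral_mono)
          fix z assume z: "z \<in> space M"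
          have mz: "m (q z) \<in> Prob T" "m (act g (q z)) \<in> Prob T"
            using m qY[OF z] act[OF g z] by (auto simp: weak_star_continuous_def)
          have "\<bar>measure (translate_measure G T g (m (q z))) A - measure (m (act g (q z))) A\<bar>
             \<le> tv_norm_diff (translate_measure G T g (m (q z))) (m (act g (q z)))"
            using mz translate(1)[OF mz(1) gG] A
            by (intro measure_diff_le_tv_norm_diff) (auto simp: ProbD)
          also have "\<dots> \<le> \<delta>"
            using elim(2) C(2)[OF z] by fastforce
          finally show "\<bar>measure (m (q z)) ((\<lambda>x. g \<otimes> x) -` A \<inter> topspace T) - measure (m (act g (q z))) A\<bar> \<le> \<delta>"
            by (simp add: translate(2)[OF mz(1) gG A])
        qed (use int[OF kernel[OF m] A'] int[OF kernel_act[OF m g] A] in auto)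
        finally show "\<bar>measure (translate_measure G T g (P m)) A - measure (P m) A\<bar> \<le> \<delta>"
          by (simp add: M.prob_space)
      qed
      also note \<delta>(2)
      finally show ?case
        unfolding translate(3)[OF Pm gG B(1)] .
    qed
  qed
  have "\<exists>C. \<forall>\<^sub>F m in F. \<bar>\<integral>x. f x \<partial>P m\<bar> \<le> C" if f: "f \<in> bounded_Borel T" for f
  proof -
    obtain B where B: "f \<in> borel_measurable (borel_on T)" "B > 0" "\<And>x. x \<in> topspace T \<Longrightarrow> \<bar>f x\<bar> \<le> B"
      by (fact bounded_BorelE[OF f])
    have "\<forall>\<^sub>F m in F. \<bar>\<integral>x. f x \<partial>P m\<bar> \<le> B"
      using F(2) by eventually_elim (auto intro!: bounded_Borel_integral_bound P B)
    then show ?thesis ..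
  qed
  then obtain F' where F': "F' \<le> F" "F' \<noteq> bot"
    "\<And>f. f \<in> bounded_Borel T \<Longrightarrow> \<exists>l. ((\<lambda>m. \<integral>x. f x \<partial>P m) \<longlongrightarrow> l) F'"
    using pointwise_cluster_filter[OF F(1), of "bounded_Borel T" "\<lambda>m f. \<integral>x. f x \<partial>P m"] by blast
  \<comment> \<open>The limit is formed for each function separately, so \<open>\<Phi>\<close> need
    not come from a countably additive measure; finite additivity is all that a mean asks
    for.\<close>
  define \<Phi> where "\<Phi> f = Lim F' (\<lambda>m. \<integral>x. f x \<partial>P m)" for f :: "'a \<Rightarrow> real"
  have lim: "((\<lambda>m. \<integral>x. f x \<partial>P m) \<longlongrightarrow> \<Phi> f) F'" if "f \<in> bounded_Borel T" for f
    using F'(3)[OF that] tendsto_Lim[OF F'(2)] unfolding \<Phi>_def by metis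
  have lim_eq: "\<Phi> f = l" if "((\<lambda>m. \<integral>x. f x \<partial>P m) \<longlongrightarrow> l) F'" for f l
    unfolding \<Phi>_def by (rule tendsto_Lim[OF F'(2) that])
  have evP: "\<forall>\<^sub>F m in F'. P m \<in> Prob T"
    using filter_leD[OF F'(1) F(2)] by eventually_elim (rule P)
  show ?thesis
    unfolding invariant_Borel_mean_def
  proof (intro exI[of _ \<Phi>] conjI ballI allI impI)
    fix f f' assume f: "f \<in> bounded_Borel T" "f' \<in> bounded_Borel T"
    have "\<forall>\<^sub>F m in F'. (\<integral>x. f x \<partial>P m) + (\<integral>x. f' x \<partial>P m) = (\<integral>x. f x + f' x \<partial>P m)"
      using evP by eventually_elim (simp add: bounded_Borel_integrable[OF f(1)] bounded_Borel_integrable[OF f(2)])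
    then show "\<Phi> (\<lambda>x. f x + f' x) = \<Phi> f + \<Phi> f'"
      by (rule lim_eq[OF Lim_transform_eventually[OF tendsto_add[OF lim[OF f(1)] lim[OF f(2)]]]])
  next
    fix c f assume f: "f \<in> bounded_Borel T"
    show "\<Phi> (\<lambda>x. c * f x) = c * \<Phi> f"
      by (rule lim_eq) (simp add: tendsto_mult_left lim[OF f])
  next
    fix f assume f: "f \<in> bounded_Borel T" "\<forall>x\<in>topspace T. 0 \<le> f x"
    have "\<forall>\<^sub>F m in F'. 0 \<le> (\<integral>x. f x \<partial>P m)"
      using evP by eventually_elim (use f(2) in \<open>auto intro!: integral_nonneg_AE AE_I2 simp: ProbD(3)\<close>)
    then show "0 \<le> \<Phi> f"
      by (rule tendsto_lowerbound[OF lim[OF f(1)] _ F'(2)])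
  next
    have "\<forall>\<^sub>F m in F'. (1::real) = (\<integral>x. 1 \<partial>P m)"
      using evP by eventually_elim (auto simp: prob_space.prob_space dest!: ProbD(1))
    then show "\<Phi> (\<lambda>x. 1) = 1"
      by (rule lim_eq[OF Lim_transform_eventually[OF tendsto_const]])
  next
    fix g f assume g: "g \<in> H" and f: "f \<in> bounded_Borel T"
    have "((\<lambda>m. (\<integral>x. f (g \<otimes> x) \<partial>P m) - (\<integral>x. f x \<partial>P m)) \<longlongrightarrow> 0) F'"
      unfolding tendsto_iff dist_real_def using asymp[OF g f] filter_leD[OF F'(1)] by simp
    from tendsto_add[OF this lim[OF f]] show "\<Phi> (\<lambda>x. f (g \<otimes> x)) = \<Phi> f"
      by (intro lim_eq) simp
  next
    fix f f' assume f: "f \<in> bounded_Borel T" "\<forall>x\<in>topspace T. f x = f' x"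
    have "\<forall>\<^sub>F m in F'. (\<integral>x. f' x \<partial>P m) = (\<integral>x. f x \<partial>P m)"
      using evP by eventually_elim (auto intro!: Bochner_Integration.integral_cong simp: f ProbD(3))
    then have "((\<lambda>m. \<integral>x. f' x \<partial>P m) \<longlongrightarrow> \<Phi> f) F'"
      using lim[OF f(1)] by (simp add: tendsto_cong)
    then show "\<Phi> f = \<Phi> f'" using lim_eq by metis
  qed
qed

end

section \<open>Amenability of the group and of its discrete subgroups\<close>

lemma bounded_Borel_add:
  assumes "f \<in> bounded_Borel T" "g \<in> bounded_Borel T"
  shows "(\<lambda>x. f x + g x) \<in> bounded_Borel T"
proof -
  obtain C where C: "f \<in> borel_measurable (borel_on T)" "C > 0" "\<And>x. x \<in> topspace T \<Longrightarrow> \<bar>f x\<bar> \<le> C"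
    by (fact bounded_BorelE[OF assms(1)])
  obtain D where D: "g \<in> borel_measurable (borel_on T)" "D > 0" "\<And>x. x \<in> topspace T \<Longrightarrow> \<bar>g x\<bar> \<le> D"
    by (fact bounded_BorelE[OF assms(2)])
  have "\<bar>f x + g x\<bar> \<le> C + D" if "x \<in> topspace T" for x
    using C(3)[OF that] D(3)[OF that] by linarith
  then show ?thesis
    using C(1) D(1) by (auto simp: bounded_Borel_def)
qed

lemma bounded_Borel_cmult:
  assumes "f \<in> bounded_Borel T"
  shows "(\<lambda>x. c * f x) \<in> bounded_Borel T"
proof -
  obtain C where C: "f \<in> borel_measurable (borel_on T)" "C > 0" "\<And>x. x \<in> topspace T \<Longrightarrow> \<bar>f x\<bar> \<le> C"
    by (fact bounded_BorelE[OF assms(1)])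
  have "\<bar>c * f x\<bar> \<le> \<bar>c\<bar> * C" if "x \<in> topspace T" for x
    using C(3)[OF that] by (simp add: abs_mult mult_left_mono)
  then show ?thesis
    using C(1) by (auto simp: bounded_Borel_def)
qed

lemma bounded_Borel_const: "(\<lambda>x. c) \<in> bounded_Borel T"
  by (auto simp: bounded_Borel_def)

section \<open>Discrete subgroups and compact sets\<close>

lemma (in group) discrete_subgroup_small_nhds:
  assumes top: "topspace T = carrier G"
    and cont: "continuous_map (prod_topology T T) T (\<lambda>(a, b). a \<otimes> inv b)"
    and "discrete_subgroup \<Lambda> G T" and x: "x \<in> carrier G"
  obtains V where "openin T V" "x \<in> V" "\<And>a b. a \<in> V \<Longrightarrow> b \<in> V \<Longrightarrow> a \<otimes> inv b \<in> \<Lambda> \<Longrightarrow> a = b"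
proof -
  have \<Lambda>: "subgroup \<Lambda> G" and disc: "subtopology T \<Lambda> = discrete_topology \<Lambda>"
    using assms(3) by (auto simp: discrete_subgroup_def)
  have "openin (subtopology T \<Lambda>) {\<one>}"
    unfolding disc using subgroup.one_closed[OF \<Lambda>] by simp
  then obtain U where U: "openin T U" "{\<one>} = U \<inter> \<Lambda>"
    by (auto simp: openin_subtopology)
  \<comment> \<open>The division map sends \<open>(x, x)\<close> to the identity, and
    \<open>U\<close> isolates the identity within \<open>\<Lambda>\<close>. A box around
    \<open>(x, x)\<close> that is mapped into \<open>U\<close> yields the neighbourhood.\<close>
  have "openin (prod_topology T T) {p \<in> topspace (prod_topology T T). (case p of (a, b) \<Rightarrow> a \<otimes> inv b) \<in> U}"
    using cont U(1) unfolding continuous_map by blast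
  moreover have "(x, x) \<in> {p \<in> topspace (prod_topology T T). (case p of (a, b) \<Rightarrow> a \<otimes> inv b) \<in> U}"
    using x U(2) by (auto simp: top)
  ultimately obtain V1 V2 where V: "openin T V1" "openin T V2" "x \<in> V1" "x \<in> V2"
    "V1 \<times> V2 \<subseteq> {p \<in> topspace (prod_topology T T). (case p of (a, b) \<Rightarrow> a \<otimes> inv b) \<in> U}"
    unfolding openin_prod_topology_alt by meson
  show ?thesis
  proof (rule that[of "V1 \<inter> V2"])
    fix a b assume ab: "a \<in> V1 \<inter> V2" "b \<in> V1 \<inter> V2" "a \<otimes> inv b \<in> \<Lambda>"
    then have "(a, b) \<in> V1 \<times> V2" by auto
    then have "a \<otimes> inv b \<in> U" "a \<in> carrier G" "b \<in> carrier G"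
      using V(5) by (auto simp: top)
    moreover from this have "a \<otimes> inv b = \<one>" using ab(3) U(2) by blast
    ultimately show "a = b"
      by (metis inv_closed inv_equality inv_inv)
  qed (use V in auto)
qed

text \<open>Each small open set meets \<open>\<Lambda>\<close> in at most one point, and finitely
  many of them cover \<open>K\<close>. The hypotheses ask for continuous division instead of an
  \<open>lcsc_group\<close>, so that the product of all factors can be inserted directly.\<close>

lemma (in group) finite_discrete_subgroup_Int_compact:
  assumes top: "topspace T = carrier G"
    and cont: "continuous_map (prod_topology T T) T (\<lambda>(a, b). a \<otimes> inv b)"
    and disc: "discrete_subgroup \<Lambda> G T" and K: "compactin T K"
  shows "finite (\<Lambda> \<inter> K)"
proof -
  have \<Lambda>: "subgroup \<Lambda> G" using disc by (auto simp: discrete_subgroup_def)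
  define small where "small V \<longleftrightarrow> (\<forall>a\<in>V. \<forall>b\<in>V. a \<otimes> inv b \<in> \<Lambda> \<longrightarrow> a = b)" for V
  have "\<exists>V. openin T V \<and> x \<in> V \<and> small V" if "x \<in> carrier G" for x
    by (rule discrete_subgroup_small_nhds[OF top cont disc that]) (auto simp: small_def)
  then have "K \<subseteq> \<Union>{V. openin T V \<and> small V}"
    using compactin_subset_topspace[OF K] top by blast
  then obtain F where F: "finite F" "F \<subseteq> {V. openin T V \<and> small V}" "K \<subseteq> \<Union>F"
    using compactinD[OF K, of "{V. openin T V \<and> small V}"] by blast
  have "finite (\<Lambda> \<inter> V)" if "V \<in> F" for V
  proof (cases "\<Lambda> \<inter> V = {}")
    case False
    then obtain a where a: "a \<in> \<Lambda>" "a \<in> V" by blast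
    have "b = a" if "b \<in> \<Lambda> \<inter> V" for b
    proof -
      have "b \<otimes> inv a \<in> \<Lambda>"
        using that a subgroup.m_closed[OF \<Lambda>] subgroup.m_inv_closed[OF \<Lambda>] by blast
      then show ?thesis using F(2) \<open>V \<in> F\<close> a that by (auto simp: small_def)
    qed
    then have "\<Lambda> \<inter> V \<subseteq> {a}" by blast
    then show ?thesis by (rule finite_subset) simp
  qed simp
  then have "finite (\<Union>V\<in>F. \<Lambda> \<inter> V)" using F(1) by blast
  then show ?thesis by (rule rev_finite_subset) (use F(3) in blast)
qed

section \<open>From invariant Borel means to amenability\<close>

context lcsc_group
begin

lemma bounded_Borel_ltrans:
  assumes g: "g \<in> carrier G" and "f \<in> bounded_Borel T"
  shows "(\<lambda>x. f (g \<otimes> x)) \<in> bounded_Borel T"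
proof -
  obtain C where C: "f \<in> borel_measurable (borel_on T)" "C > 0" "\<And>x. x \<in> topspace T \<Longrightarrow> \<bar>f x\<bar> \<le> C"
    by (fact bounded_BorelE[OF assms(2)])
  have "(\<lambda>x. f (g \<otimes> x)) \<in> borel_measurable (borel_on T)"
    using measurable_compose[OF continuous_map_measurable_borel_on[OF continuous_map_lmult[OF g]] C(1)] .
  then show ?thesis
    using C(3) g by (auto simp: bounded_Borel_def topspace_eq)
qed

lemma invariant_Borel_mean_amenable:
  assumes \<Phi>: "invariant_Borel_mean G T (carrier G) \<Phi>"
  shows "amenable G T"
  unfolding amenable_def mean_on_def
proof (intro exI[of _ \<Phi>] conjI ballI allI impI)
  note D = invariant_Borel_meanD[OF \<Phi>]
  fix f :: "'a \<Rightarrow> real" assume "f \<in> Cb T"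
  then have f: "f \<in> bounded_Borel T" by (rule Cb_bounded_Borel)
  show "\<Phi> (\<lambda>x\<in>topspace T. f x + h x) = \<Phi> f + \<Phi> h" if "h \<in> Cb T" for h
    using D(1)[OF f Cb_bounded_Borel[OF that]]
      D(6)[OF bounded_Borel_add[OF f Cb_bounded_Borel[OF that]], of "\<lambda>x\<in>topspace T. f x + h x"] by simp
  show "\<Phi> (\<lambda>x\<in>topspace T. c * f x) = c * \<Phi> f" for c
    using D(2)[OF f] D(6)[OF bounded_Borel_cmult[OF f], where f' = "\<lambda>x\<in>topspace T. c * f x"] by simp
  show "0 \<le> \<Phi> f" if "\<forall>x\<in>topspace T. 0 \<le> f x"
    using D(3)[OF f] that by blast
  fix g assume g: "g \<in> carrier G"
  show "\<Phi> (ltrans G g f) = \<Phi> f"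
    using D(5)[OF _ f, of "inv g"] D(6)[OF bounded_Borel_ltrans[OF _ f], of "inv g" "ltrans G g f"] g
    by (simp add: ltrans_def topspace_eq)
next
  show "\<Phi> (\<lambda>x\<in>topspace T. 1) = 1"
    using invariant_Borel_meanD(4,6)[OF \<Phi>] bounded_Borel_const[of 1 T] by (metis (mono_tags, lifting) restrict_apply)
qed

lemma continuous_map_mult_inv: "continuous_map (prod_topology T T) T (\<lambda>(a, b). a \<otimes> inv b)"
proof -
  have "continuous_map (prod_topology T T) (prod_topology T T) (\<lambda>p. (fst p, inv (snd p)))"
    using continuous_map_compose[OF continuous_map_snd continuous_inv]
    by (intro continuous_map_pairedI continuous_map_fst) (simp add: o_def)
  from continuous_map_compose[OF this continuous_mult]
  show ?thesis by (simp add: o_def case_prod_unfold)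
qed

text \<open>\<open>s\<close> sends \<open>x\<close> to the element \<open>\<lambda>\<close> of \<open>\<Lambda>\<close> for which \<open>\<lambda>\<inverse>x\<close> lies in a Borel fundamental domain.\<close>

lemma discrete_subgroup_section:
  assumes disc: "discrete_subgroup \<Lambda> G T" and count: "countable \<Lambda>"
  obtains s where "s \<in> borel_on T \<rightarrow>\<^sub>M count_space \<Lambda>"
    "\<And>g x. g \<in> \<Lambda> \<Longrightarrow> x \<in> carrier G \<Longrightarrow> s (g \<otimes> x) = g \<otimes> s x"
proof -
  have \<Lambda>: "subgroup \<Lambda> G" using disc by (auto simp: discrete_subgroup_def)
  note \<Lambda>c = subgroup.mem_carrier[OF \<Lambda>] and \<Lambda>i = subgroup.m_inv_closed[OF \<Lambda>] and \<Lambda>m = subgroup.m_closed[OF \<Lambda>]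
  define small where "small V \<longleftrightarrow> openin T V \<and> (\<forall>a\<in>V. \<forall>b\<in>V. a \<otimes> inv b \<in> \<Lambda> \<longrightarrow> a = b)" for V
  obtain \<B> where \<B>: "countable \<B>" "\<And>V. V \<in> \<B> \<Longrightarrow> openin T V"
    "\<And>W x. openin T W \<Longrightarrow> x \<in> W \<Longrightarrow> \<exists>V\<in>\<B>. x \<in> V \<and> V \<subseteq> W"
    using second_countable unfolding second_countable_space_def by metis
  define \<C> where "\<C> = insert {} {V \<in> \<B>. small V}"
  have "countable \<C>" "\<C> \<noteq> {}" using \<B>(1) by (auto simp: \<C>_def)
  then obtain V :: "nat \<Rightarrow> 'a set" where V: "range V = \<C>"
    using range_from_nat_into[of \<C>] by blast
  have small: "small (V k)" for k
  proof -
    have "V k \<in> \<C>" using V by blast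
    then show ?thesis by (auto simp: \<C>_def small_def)
  qed
  then have openV: "openin T (V k)" for k by (auto simp: small_def)
  have cover: "\<exists>k. x \<in> V k" if x: "x \<in> carrier G" for x
  proof -
    obtain W where W: "openin T W" "x \<in> W" "\<And>a b. a \<in> W \<Longrightarrow> b \<in> W \<Longrightarrow> a \<otimes> inv b \<in> \<Lambda> \<Longrightarrow> a = b"
      by (fact discrete_subgroup_small_nhds[OF topspace_eq continuous_map_mult_inv disc x])
    obtain B where B: "B \<in> \<B>" "x \<in> B" "B \<subseteq> W" using \<B>(3)[OF W(1,2)] by blast
    have "small B" unfolding small_def using W(3) B(3) \<B>(2)[OF B(1)] by (meson subsetD)
    with B have "B \<in> \<C>" by (auto simp: \<C>_def)
    then show ?thesis using B(2) V by blast
  qed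
  \<comment> \<open>\<open>Q k x\<close> says that the orbit of \<open>x\<close> under
    \<open>\<Lambda>\<close> meets \<open>V k\<close>. It is invariant under
    \<open>\<Lambda>\<close>, so the first such index \<open>\<kappa> x\<close> is constant on
    orbits, and by smallness exactly one point of the orbit lies in that set: the representative of
    the orbit.\<close>
  define Q where "Q k x \<longleftrightarrow> (\<exists>l\<in>\<Lambda>. inv l \<otimes> x \<in> V k)" for k x
  define \<kappa> where "\<kappa> x = (LEAST k. Q k x)" for x
  define s where "s x = (THE l. l \<in> \<Lambda> \<and> inv l \<otimes> x \<in> V (\<kappa> x))" for x
  have ex: "\<exists>k. Q k x" if x: "x \<in> carrier G" for x
    using cover[OF x] subgroup.one_closed[OF \<Lambda>] x unfolding Q_def by (intro bexI[of _ \<one>] ex_forward[OF cover[OF x]]) auto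
  have uniq: "l = l'" if "l \<in> \<Lambda>" "l' \<in> \<Lambda>" "inv l \<otimes> x \<in> V k" "inv l' \<otimes> x \<in> V k" "x \<in> carrier G" for l l' x k
  proof -
    \<comment> \<open>Two points of one orbit have their quotient in \<open>\<Lambda>\<close>, which
      is the situation excluded in a small set unless they coincide.\<close>
    have "(inv l \<otimes> x) \<otimes> inv (inv l' \<otimes> x) = inv l \<otimes> l'"
      using that \<Lambda>c by (simp add: inv_mult_group m_assoc) (simp add: m_assoc[symmetric])
    then have "inv l \<otimes> x = inv l' \<otimes> x"
      using small[of k] that \<Lambda>i \<Lambda>m by (auto simp: small_def)
    then show ?thesis using that \<Lambda>c by (metis inv_closed inv_inv right_cancel)
  qed
  have s_iff: "s x = l \<longleftrightarrow> l \<in> \<Lambda> \<and> inv l \<otimes> x \<in> V (\<kappa> x)" if x: "x \<in> carrier G" for x l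
  proof -
    have "Q (\<kappa> x) x" using LeastI_ex[OF ex[OF x]] by (simp add: \<kappa>_def)
    then have ex1: "\<exists>!l. l \<in> \<Lambda> \<and> inv l \<otimes> x \<in> V (\<kappa> x)"
      using uniq[OF _ _ _ _ x] unfolding Q_def by blast
    show ?thesis
      using theI'[OF ex1] the1_equality[OF ex1] unfolding s_def by blast
  qed
  have s_in: "s x \<in> \<Lambda>" "inv (s x) \<otimes> x \<in> V (\<kappa> x)" if "x \<in> carrier G" for x
    using s_iff[OF that] by blast+
  have Q_inv: "Q k (g \<otimes> x) = Q k x" if g: "g \<in> \<Lambda>" and x: "x \<in> carrier G" for k g x
  proof
    assume "Q k (g \<otimes> x)"
    then obtain l where l: "l \<in> \<Lambda>" "inv l \<otimes> (g \<otimes> x) \<in> V k" by (auto simp: Q_def)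
    moreover have "inv (inv g \<otimes> l) \<otimes> x = inv l \<otimes> (g \<otimes> x)"
      using g l x \<Lambda>c by (simp add: inv_mult_group m_assoc)
    ultimately show "Q k x" unfolding Q_def using g \<Lambda>i \<Lambda>m by metis
  next
    assume "Q k x"
    then obtain l where l: "l \<in> \<Lambda>" "inv l \<otimes> x \<in> V k" by (auto simp: Q_def)
    moreover have "inv (g \<otimes> l) \<otimes> (g \<otimes> x) = inv l \<otimes> x"
      using g l x \<Lambda>c by (simp add: inv_mult_group m_assoc) (simp add: m_assoc[symmetric])
    ultimately show "Q k (g \<otimes> x)" unfolding Q_def using g \<Lambda>m by metis
  qed
  show ?thesis
  proof (rule that[of s])
    fix g x assume g: "g \<in> \<Lambda>" and x: "x \<in> carrier G"
    have "\<kappa> (g \<otimes> x) = \<kappa> x" by (simp add: \<kappa>_def Q_inv[OF g x])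
    moreover have "inv (g \<otimes> s x) \<otimes> (g \<otimes> x) = inv (s x) \<otimes> x"
      using g x \<Lambda>c s_in[OF x] by (simp add: inv_mult_group m_assoc) (simp add: m_assoc[symmetric])
    ultimately show "s (g \<otimes> x) = g \<otimes> s x"
      using s_iff[of "g \<otimes> x" "g \<otimes> s x"] g x s_in[OF x] \<Lambda>m \<Lambda>c by simp
  next
    have VM: "{x \<in> carrier G. inv l \<otimes> x \<in> V k} \<in> sets (borel_on T)" if "l \<in> \<Lambda>" for l k
      using continuous_map_lmult[of "inv l"] openV[of k] \<Lambda>c[OF that]
      by (intro openin_borel_on) (auto simp: continuous_map topspace_eq)
    \<comment> \<open>Countability of \<open>\<Lambda>\<close> enters here: the saturation of an
      open set is written as a countable union of translates.\<close>
    have "{x \<in> carrier G. Q k x} = (\<Union>l\<in>\<Lambda>. {x \<in> carrier G. inv l \<otimes> x \<in> V k})" for k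
      by (auto simp: Q_def)
    then have QM: "{x \<in> carrier G. Q k x} \<in> sets (borel_on T)" for k
      using VM count by (auto intro!: sets.countable_UN')
    have \<kappa>_iff: "\<kappa> x = k \<longleftrightarrow> Q k x \<and> (\<forall>j<k. \<not> Q j x)" if x: "x \<in> carrier G" for x k
      unfolding \<kappa>_def using LeastI_ex[OF ex[OF x]] not_less_Least
      by (metis Least_equality linorder_not_less)
    have "{x \<in> carrier G. \<kappa> x = k} = {x \<in> carrier G. Q k x} - (\<Union>j\<in>{..<k}. {x \<in> carrier G. Q j x})" for k
      using \<kappa>_iff by auto
    then have \<kappa>M: "{x \<in> carrier G. \<kappa> x = k} \<in> sets (borel_on T)" for k
      using QM by (auto intro!: sets.Diff sets.finite_UN)
    have "s -` {l} \<inter> carrier G = (\<Union>k. {x \<in> carrier G. \<kappa> x = k} \<inter> {x \<in> carrier G. inv l \<otimes> x \<in> V k})" if "l \<in> \<Lambda>" for l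
      using s_iff that by auto
    then have "s -` {l} \<inter> carrier G \<in> sets (borel_on T)" if "l \<in> \<Lambda>" for l
      using VM \<kappa>M that by (auto intro!: sets.countable_UN sets.Int)
    then show "s \<in> borel_on T \<rightarrow>\<^sub>M count_space \<Lambda>"
      using s_in(1) count by (auto simp: measurable_count_space_eq_countable topspace_eq)
  qed
qed

text \<open>Functions on \<open>\<Lambda>\<close> are pulled back along the equivariant section
  \<open>s\<close>, which turns translation on \<open>\<Lambda>\<close> into translation on the
  group. The pullback is Borel but in general not continuous, so a mean on continuous functions
  could not be applied to it.\<close>

lemma invariant_Borel_mean_discrete_amenable:
  assumes \<Phi>: "invariant_Borel_mean G T H \<Phi>" and "\<Lambda> \<subseteq> H"
    and disc: "discrete_subgroup \<Lambda> G T" and count: "countable \<Lambda>"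
  shows "amenable (G\<lparr>carrier := \<Lambda>\<rparr>) (subtopology T \<Lambda>)"
proof -
  note D = invariant_Borel_meanD[OF \<Phi>]
  have \<Lambda>: "subgroup \<Lambda> G" and sub: "subtopology T \<Lambda> = discrete_topology \<Lambda>"
    using disc by (auto simp: discrete_subgroup_def)
  obtain s where s: "s \<in> borel_on T \<rightarrow>\<^sub>M count_space \<Lambda>"
    "\<And>g x. g \<in> \<Lambda> \<Longrightarrow> x \<in> carrier G \<Longrightarrow> s (g \<otimes> x) = g \<otimes> s x"
    by (fact discrete_subgroup_section[OF disc count])
  have s_in: "s x \<in> \<Lambda>" if "x \<in> topspace T" for x
    using measurable_space[OF s(1), of x] that by simp
  have fs: "(\<lambda>x. f (s x)) \<in> bounded_Borel T" if f: "f \<in> Cb (discrete_topology \<Lambda>)" for f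
  proof -
    obtain C where C: "\<And>x. x \<in> \<Lambda> \<Longrightarrow> norm (f x) \<le> C"
      using Cb_bound[OF f] by auto
    have "(\<lambda>x. f (s x)) \<in> borel_measurable (borel_on T)"
      by (rule measurable_compose[OF s(1)]) simp
    then show ?thesis
      using C s_in by (auto simp: bounded_Borel_def)
  qed
  show ?thesis
    unfolding amenable_def mean_on_def sub topspace_discrete_topology
  proof (intro exI[of _ "\<lambda>f. \<Phi> (\<lambda>x. f (s x))"] conjI ballI allI impI)
    fix f :: "'a \<Rightarrow> real" assume f: "f \<in> Cb (discrete_topology \<Lambda>)"
    show "\<Phi> (\<lambda>x. (\<lambda>x\<in>\<Lambda>. f x + h x) (s x)) = \<Phi> (\<lambda>x. f (s x)) + \<Phi> (\<lambda>x. h (s x))"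
      if h: "h \<in> Cb (discrete_topology \<Lambda>)" for h
      using D(1)[OF fs[OF f] fs[OF h]] s_in
        D(6)[OF bounded_Borel_add[OF fs[OF f] fs[OF h]], of "\<lambda>x. (\<lambda>x\<in>\<Lambda>. f x + h x) (s x)"] by simp
    show "\<Phi> (\<lambda>x. (\<lambda>x\<in>\<Lambda>. c * f x) (s x)) = c * \<Phi> (\<lambda>x. f (s x))" for c
      using D(2)[OF fs[OF f]] s_in
        D(6)[OF bounded_Borel_cmult[OF fs[OF f]], where f' = "\<lambda>x. (\<lambda>x\<in>\<Lambda>. c * f x) (s x)"] by simp
    show "0 \<le> \<Phi> (\<lambda>x. f (s x))" if "\<forall>x\<in>\<Lambda>. 0 \<le> f x"
      using that s_in by (intro D(3)[OF fs[OF f]]) auto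
    fix g assume "g \<in> carrier (G\<lparr>carrier := \<Lambda>\<rparr>)"
    then have g: "g \<in> \<Lambda>" by simp
    have ig: "inv g \<in> \<Lambda>" "inv g \<in> carrier G"
      using subgroup.m_inv_closed[OF \<Lambda> g] subgroup.mem_carrier[OF \<Lambda>] by auto
    have "\<Phi> (\<lambda>x. f (s (inv g \<otimes> x))) = \<Phi> (\<lambda>x. ltrans (G\<lparr>carrier := \<Lambda>\<rparr>) g f (s x))"
    proof (rule D(6)[OF bounded_Borel_ltrans[OF ig(2) fs[OF f]]])
      fix x assume x: "x \<in> topspace T"
      then show "f (s (inv g \<otimes> x)) = ltrans (G\<lparr>carrier := \<Lambda>\<rparr>) g f (s x)"
        using s_in[OF x] s(2)[OF ig(1)] m_inv_consistent[OF \<Lambda> g] by (simp add: ltrans_def topspace_eq)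
    qed
    moreover have "inv g \<in> H" using ig(1) assms(2) by blast
    ultimately show "\<Phi> (\<lambda>x. ltrans (G\<lparr>carrier := \<Lambda>\<rparr>) g f (s x)) = \<Phi> (\<lambda>x. f (s x))"
      using D(5)[OF _ fs[OF f]] by simp
  next
    show "\<Phi> (\<lambda>x. (\<lambda>x\<in>\<Lambda>. 1) (s x)) = 1"
      using D(4) s_in D(6)[OF bounded_Borel_const[of 1 T], of "\<lambda>x. (\<lambda>x\<in>\<Lambda>. 1) (s x)"] by simp
  qed
qed

end

section \<open>Function algebras on locally compact groups\<close>

lemma continuous_map_times:
  fixes f g :: "'a \<Rightarrow> 'b::real_normed_algebra"
  assumes "continuous_map X euclidean f" "continuous_map X euclidean g"
  shows "continuous_map X euclidean (\<lambda>x. f x * g x)"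
  using assms by (auto simp: continuous_map_atin intro: tendsto_mult)

lemma Cb_iff:
  "f \<in> Cb T \<longleftrightarrow> f \<in> extensional (topspace T) \<and> continuous_map T euclidean f \<and>
     (\<exists>C. \<forall>x\<in>topspace T. norm (f x) \<le> C)"
  by (auto simp: Cb_def bounded_iff)

lemma Cb_add:
  assumes "f \<in> Cb T" "g \<in> Cb T" shows "(\<lambda>x\<in>topspace T. f x + g x) \<in> Cb T"
proof -
  obtain C where C: "\<And>x. x \<in> topspace T \<Longrightarrow> norm (f x) \<le> C" using Cb_bound[OF assms(1)] by blast
  obtain D where D: "\<And>x. x \<in> topspace T \<Longrightarrow> norm (g x) \<le> D" using Cb_bound[OF assms(2)] by blast
  show ?thesis
    using assms by (intro restrict_Cb[where C = "C + D"] continuous_map_add Cb_continuous norm_triangle_mono C D) auto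
qed

lemma Cb_mult:
  fixes f g :: "'a \<Rightarrow> 'b::real_normed_algebra"
  assumes "f \<in> Cb T" "g \<in> Cb T" shows "(\<lambda>x\<in>topspace T. f x * g x) \<in> Cb T"
proof -
  obtain C where C: "\<And>x. x \<in> topspace T \<Longrightarrow> norm (f x) \<le> C" using Cb_bound[OF assms(1)] by blast
  obtain D where D: "\<And>x. x \<in> topspace T \<Longrightarrow> norm (g x) \<le> D" using Cb_bound[OF assms(2)] by blast
  show ?thesis
  proof (intro restrict_Cb[where C = "C * D"] continuous_map_times)
    fix x assume "x \<in> topspace T"
    then show "norm (f x * g x) \<le> C * D"
      using C D by (meson mult_mono' norm_ge_zero norm_mult_ineq order_trans)
  qed (use assms in \<open>auto intro: Cb_continuous\<close>)
qed

lemma Cb_const: "(\<lambda>x\<in>topspace T. c) \<in> Cb T"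
  by (rule restrict_Cb[where C = "norm c"]) auto

lemma Cb_compose:
  assumes "f \<in> Cb T" "continuous_map S T \<alpha>"
  shows "(\<lambda>x\<in>topspace S. f (\<alpha> x)) \<in> Cb S"
proof -
  obtain C where C: "\<And>x. x \<in> topspace T \<Longrightarrow> norm (f x) \<le> C" using Cb_bound[OF assms(1)] by blast
  show ?thesis
  proof (rule restrict_Cb[where C = C])
    show "continuous_map S euclidean (\<lambda>x. f (\<alpha> x))"
      using continuous_map_compose[OF assms(2) Cb_continuous[OF assms(1)]] by (simp add: o_def)
    show "norm (f (\<alpha> x)) \<le> C" if "x \<in> topspace S" for x
      using C continuous_map_image_subset_topspace[OF assms(2)] that by blast
  qed
qed

text \<open>If \<open>f (\<alpha> x)\<close> is nonzero then \<open>\<alpha> x\<close> lies in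
  \<open>K\<close>, and \<open>x\<close> is its image under \<open>\<beta>\<close>. Hence the
  composite vanishes off the compact image of \<open>K\<close> under \<open>\<beta>\<close>.\<close>

lemma Cc_compose:
  assumes f: "f \<in> Cc T" and \<alpha>: "continuous_map T T \<alpha>" and \<beta>: "continuous_map T T \<beta>"
    and inv: "\<And>x. x \<in> topspace T \<Longrightarrow> \<beta> (\<alpha> x) = x"
  shows "(\<lambda>x\<in>topspace T. f (\<alpha> x)) \<in> Cc T"
proof -
  obtain K where K: "compactin T K" "\<forall>x\<in>topspace T - K. f x = 0" and "f \<in> Cb T"
    using f by (auto simp: Cc_def)
  have "f (\<alpha> x) = 0" if "x \<in> topspace T - \<beta> ` K" for x
    using that inv K(2) continuous_map_image_subset_topspace[OF \<alpha>] by (metis DiffD1 DiffD2 DiffI imageI subsetD)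
  moreover have "compactin T (\<beta> ` K)"
    by (rule image_compactin[OF K(1) \<beta>])
  ultimately show ?thesis
    using Cb_compose[OF \<open>f \<in> Cb T\<close> \<alpha>] by (auto simp: Cc_def)
qed

lemma C0_compose:
  assumes f: "f \<in> C0 T" and \<alpha>: "continuous_map T T \<alpha>" and \<beta>: "continuous_map T T \<beta>"
    and inv: "\<And>x. x \<in> topspace T \<Longrightarrow> \<beta> (\<alpha> x) = x"
  shows "(\<lambda>x\<in>topspace T. f (\<alpha> x)) \<in> C0 T"
  unfolding C0_def
proof (intro CollectI conjI allI impI)
  show "(\<lambda>x\<in>topspace T. f (\<alpha> x)) \<in> Cb T"
    using f \<alpha> by (auto simp: C0_def intro: Cb_compose)
  fix \<epsilon> :: real assume "\<epsilon> > 0"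
  then obtain K where K: "compactin T K" "\<forall>x\<in>topspace T - K. norm (f x) < \<epsilon>"
    using f by (auto simp: C0_def)
  have "norm (f (\<alpha> x)) < \<epsilon>" if "x \<in> topspace T - \<beta> ` K" for x
    using that inv K(2) continuous_map_image_subset_topspace[OF \<alpha>] by (metis DiffD1 DiffD2 DiffI imageI subsetD)
  then show "\<exists>K. compactin T K \<and> (\<forall>x\<in>topspace T - K. norm ((\<lambda>x\<in>topspace T. f (\<alpha> x)) x) < \<epsilon>)"
    using image_compactin[OF K(1) \<beta>] by auto
qed

lemma C0_add:
  assumes f: "f \<in> C0 T" and g: "g \<in> C0 T" shows "(\<lambda>x\<in>topspace T. f x + g x) \<in> C0 T"
  unfolding C0_def
proof (intro CollectI conjI allI impI)
  show "(\<lambda>x\<in>topspace T. f x + g x) \<in> Cb T"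
    using f g by (auto simp: C0_def intro: Cb_add)
  fix \<epsilon> :: real assume "\<epsilon> > 0"
  then have "\<epsilon> / 2 > 0" by simp
  then obtain K L where K: "compactin T K" "\<forall>x\<in>topspace T - K. norm (f x) < \<epsilon> / 2"
    and L: "compactin T L" "\<forall>x\<in>topspace T - L. norm (g x) < \<epsilon> / 2"
    using f g unfolding C0_def by blast
  have "norm (f x + g x) < \<epsilon>" if "x \<in> topspace T - (K \<union> L)" for x
  proof -
    have "norm (f x) < \<epsilon> / 2" "norm (g x) < \<epsilon> / 2" using that K(2) L(2) by auto
    then show ?thesis using norm_triangle_ineq[of "f x" "g x"] by linarith
  qed
  then show "\<exists>K. compactin T K \<and> (\<forall>x\<in>topspace T - K. norm ((\<lambda>x\<in>topspace T. f x + g x) x) < \<epsilon>)"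
    using compactin_Un[OF K(1) L(1)] by (intro exI[of _ "K \<union> L"]) auto
qed

lemma C0_mult:
  fixes f g :: "'a \<Rightarrow> 'b::real_normed_algebra"
  assumes f: "f \<in> C0 T" and g: "g \<in> Cb T" shows "(\<lambda>x\<in>topspace T. f x * g x) \<in> C0 T"
  unfolding C0_def
proof (intro CollectI conjI allI impI)
  show "(\<lambda>x\<in>topspace T. f x * g x) \<in> Cb T"
    using f g by (auto simp: C0_def intro: Cb_mult)
  obtain C where C: "C > 0" "\<And>x. x \<in> topspace T \<Longrightarrow> norm (g x) \<le> C" using Cb_bound[OF g] by blast
  fix \<epsilon> :: real assume "\<epsilon> > 0"
  then have "\<epsilon> / C > 0" using C(1) by simp
  then obtain K where K: "compactin T K" "\<forall>x\<in>topspace T - K. norm (f x) < \<epsilon> / C"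
    using f unfolding C0_def by blast
  have "norm (f x * g x) < \<epsilon>" if "x \<in> topspace T - K" for x
  proof -
    have "norm (f x * g x) \<le> norm (f x) * C"
      using C(2)[of x] that by (meson DiffD1 mult_left_mono norm_ge_zero norm_mult_ineq order_trans)
    also have "\<dots> < \<epsilon>"
      using K(2) that C(1) by (metis pos_less_divide_eq)
    finally show ?thesis .
  qed
  then show "\<exists>K. compactin T K \<and> (\<forall>x\<in>topspace T - K. norm ((\<lambda>x\<in>topspace T. f x * g x) x) < \<epsilon>)"
    using K(1) by (intro exI[of _ K]) auto
qed

lemma filterlim_nhdsin:
  assumes "continuous_map X Y f" "a \<in> topspace X"
  shows "filterlim f (nhdsin Y (f a)) (nhdsin X a)"
  unfolding filterlim_def le_filter_def eventually_filtermap
proof (intro allI impI)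
  fix P assume P: "eventually P (nhdsin Y (f a))"
  have fa: "f a \<in> topspace Y" using assms by (auto simp: continuous_map)
  then obtain S where S: "openin Y S" "f a \<in> S" "\<forall>y\<in>S. P y"
    using P unfolding eventually_nhdsin by blast
  have "openin X {x \<in> topspace X. f x \<in> S}"
    using assms(1) S(1) by (auto simp: continuous_map)
  then show "eventually (\<lambda>x. P (f x)) (nhdsin X a)"
    unfolding eventually_nhdsin using S assms(2) by (intro disjI2 exI[of _ "{x \<in> topspace X. f x \<in> S}"]) auto
qed

lemma eventually_nhdsin_topspace: "\<forall>\<^sub>F x in nhdsin X a. x \<in> topspace X"
  by (auto simp: eventually_nhdsin)

section \<open>Uniform continuity and the algebra \<open>Chu\<close>\<close>

context lcsc_group
begin

text \<open>This is the epsilon form of the sup norm condition in \<open>Cbu\<close>. The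
  translation \<open>\<phi>\<close> is left open so that the left and the right condition share
  their lemmas.\<close>

definition equicontinuous_translates :: "('a \<Rightarrow> 'a \<Rightarrow> 'a) \<Rightarrow> ('a \<Rightarrow> complex) \<Rightarrow> bool" where
  "equicontinuous_translates \<phi> f \<longleftrightarrow>
    (\<forall>\<epsilon>>0. \<forall>\<^sub>F g in nhdsin T \<one>. \<forall>x\<in>carrier G. norm (f (\<phi> g x) - f x) < \<epsilon>)"

lemma equicontinuous_translatesD:
  assumes "equicontinuous_translates \<phi> f" "\<epsilon> > 0"
  shows "\<forall>\<^sub>F g in nhdsin T \<one>. \<forall>x\<in>carrier G. norm (f (\<phi> g x) - f x) < \<epsilon>"
  using assms by (simp add: equicontinuous_translates_def)

lemma sup_norm_tendsto_iff:
  fixes f :: "'a \<Rightarrow> complex"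
  assumes f: "f \<in> Cb T" and \<phi>: "\<And>g x. g \<in> carrier G \<Longrightarrow> x \<in> carrier G \<Longrightarrow> \<phi> g x \<in> carrier G"
  shows "((\<lambda>g. sup_norm (carrier G) (\<lambda>x. (\<lambda>x\<in>carrier G. f (\<phi> g x)) x - f x)) \<longlongrightarrow> 0) (nhdsin T \<one>)
    \<longleftrightarrow> equicontinuous_translates \<phi> f"
    (is "(?s \<longlongrightarrow> 0) _ \<longleftrightarrow> _")
proof -
  obtain C where C: "\<And>x. x \<in> topspace T \<Longrightarrow> norm (f x) \<le> C" using Cb_bound[OF f] by blast
  have upper: "norm (f (\<phi> g x) - f x) \<le> ?s g" if "g \<in> carrier G" "x \<in> carrier G" for g x
  proof -
    have "bdd_above ((\<lambda>x. norm ((\<lambda>x\<in>carrier G. f (\<phi> g x)) x - f x)) ` carrier G)"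
    proof (rule bdd_aboveI2[where M = "C + C"])
      fix x assume "x \<in> carrier G"
      then show "norm ((\<lambda>x\<in>carrier G. f (\<phi> g x)) x - f x) \<le> C + C"
        using order_trans[OF norm_triangle_ineq4 add_mono[OF C C], of "\<phi> g x" x] \<phi> that
        by (simp add: topspace_eq)
    qed
    from cSUP_upper[OF that(2) this] show ?thesis
      using that by (simp add: sup_norm_def)
  qed
  have lower: "?s g \<le> \<epsilon>" if "\<And>x. x \<in> carrier G \<Longrightarrow> norm (f (\<phi> g x) - f x) \<le> \<epsilon>" for g \<epsilon>
    unfolding sup_norm_def by (rule cSUP_least) (use that in auto)
  have nonneg: "0 \<le> ?s g" if "g \<in> carrier G" for g
    by (rule order_trans[OF norm_ge_zero upper[OF that one_closed]])
  have ev: "\<forall>\<^sub>F g in nhdsin T \<one>. g \<in> carrier G"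
    using eventually_nhdsin_topspace[of T] by (simp add: topspace_eq)
  show ?thesis
  proof
    assume lim: "(?s \<longlongrightarrow> 0) (nhdsin T \<one>)"
    show "equicontinuous_translates \<phi> f"
      unfolding equicontinuous_translates_def
    proof (intro allI impI)
      fix \<epsilon> :: real assume "\<epsilon> > 0"
      from order_tendstoD(2)[OF lim this] ev
      show "\<forall>\<^sub>F g in nhdsin T \<one>. \<forall>x\<in>carrier G. norm (f (\<phi> g x) - f x) < \<epsilon>"
        by eventually_elim (use upper in fastforce)
    qed
  next
    assume eq: "equicontinuous_translates \<phi> f"
    show "(?s \<longlongrightarrow> 0) (nhdsin T \<one>)"
      unfolding tendsto_iff
    proof (intro allI impI)
      fix \<epsilon> :: real assume "\<epsilon> > 0"
      \<comment> \<open>A strict pointwise bound gives only a weak bound on the supremum, hence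
        \<open>\<epsilon> / 2\<close>.\<close>
      then have "\<forall>\<^sub>F g in nhdsin T \<one>. \<forall>x\<in>carrier G. norm (f (\<phi> g x) - f x) < \<epsilon> / 2"
        using equicontinuous_translatesD[OF eq, of "\<epsilon> / 2"] by simp
      with ev show "\<forall>\<^sub>F g in nhdsin T \<one>. dist (?s g) 0 < \<epsilon>"
      proof eventually_elim
        case (elim g)
        then have "?s g \<le> \<epsilon> / 2" by (intro lower) (auto intro: less_imp_le)
        then show ?case using nonneg[OF elim(1)] \<open>\<epsilon> > 0\<close> by simp
      qed
    qed
  qed
qed

lemma Cbu_iff:
  "f \<in> Cbu G T \<longleftrightarrow> f \<in> Cb T \<and> equicontinuous_translates (\<lambda>g x. inv g \<otimes> x) f \<and>
    equicontinuous_translates (\<lambda>g x. x \<otimes> g) f"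
proof (cases "f \<in> Cb T")
  case True
  have "((\<lambda>g. sup_norm (carrier G) (\<lambda>x. ltrans G g f x - f x)) \<longlongrightarrow> 0) (nhdsin T \<one>)
      \<longleftrightarrow> equicontinuous_translates (\<lambda>g x. inv g \<otimes> x) f"
    unfolding ltrans_def by (rule sup_norm_tendsto_iff[OF True]) simp
  moreover have "((\<lambda>g. sup_norm (carrier G) (\<lambda>x. rtrans G g f x - f x)) \<longlongrightarrow> 0) (nhdsin T \<one>)
      \<longleftrightarrow> equicontinuous_translates (\<lambda>g x. x \<otimes> g) f"
    unfolding rtrans_def by (rule sup_norm_tendsto_iff[OF True]) simp
  ultimately show ?thesis using True by (simp add: Cbu_def)
qed (simp add: Cbu_def)

lemma equicontinuous_translates_add:
  assumes "equicontinuous_translates \<phi> f" "equicontinuous_translates \<phi> f'"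
    and \<phi>: "\<And>g x. g \<in> carrier G \<Longrightarrow> x \<in> carrier G \<Longrightarrow> \<phi> g x \<in> carrier G"
  shows "equicontinuous_translates \<phi> (\<lambda>x\<in>carrier G. f x + f' x)"
  unfolding equicontinuous_translates_def
proof (intro allI impI)
  fix \<epsilon> :: real assume "\<epsilon> > 0"
  then have "\<epsilon> / 2 > 0" by simp
  from equicontinuous_translatesD[OF assms(1) this] equicontinuous_translatesD[OF assms(2) this] eventually_nhdsin_topspace[of T \<one>]
  show "\<forall>\<^sub>F g in nhdsin T \<one>. \<forall>x\<in>carrier G.
      norm ((\<lambda>x\<in>carrier G. f x + f' x) (\<phi> g x) - (\<lambda>x\<in>carrier G. f x + f' x) x) < \<epsilon>"
  proof eventually_elim
    case (elim g)
    show ?case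
    proof
      fix x assume x: "x \<in> carrier G"
      have "norm ((f (\<phi> g x) - f x) + (f' (\<phi> g x) - f' x)) < \<epsilon> / 2 + \<epsilon> / 2"
        using elim x norm_triangle_ineq by (intro norm_add_less) auto
      then show "norm ((\<lambda>x\<in>carrier G. f x + f' x) (\<phi> g x) - (\<lambda>x\<in>carrier G. f x + f' x) x) < \<epsilon>"
        using x \<phi>[of g x] elim(3) by (simp add: topspace_eq algebra_simps)
    qed
  qed
qed

lemma equicontinuous_translates_mult:
  assumes "equicontinuous_translates \<phi> f" "equicontinuous_translates \<phi> f'" and f: "f \<in> Cb T" and f': "f' \<in> Cb T"
    and \<phi>: "\<And>g x. g \<in> carrier G \<Longrightarrow> x \<in> carrier G \<Longrightarrow> \<phi> g x \<in> carrier G"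
  shows "equicontinuous_translates \<phi> (\<lambda>x\<in>carrier G. f x * f' x)"
  unfolding equicontinuous_translates_def
proof (intro allI impI)
  obtain C where C: "C > 0" "\<And>x. x \<in> topspace T \<Longrightarrow> norm (f x) \<le> C" using Cb_bound[OF f] by blast
  obtain D where D: "D > 0" "\<And>x. x \<in> topspace T \<Longrightarrow> norm (f' x) \<le> D" using Cb_bound[OF f'] by blast
  fix \<epsilon> :: real assume "\<epsilon> > 0"
  then have "\<epsilon> / (2 * D) > 0" "\<epsilon> / (2 * C) > 0" using C D by auto
  from equicontinuous_translatesD[OF assms(1) this(1)] equicontinuous_translatesD[OF assms(2) this(2)] eventually_nhdsin_topspace[of T \<one>]
  show "\<forall>\<^sub>F g in nhdsin T \<one>. \<forall>x\<in>carrier G.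
      norm ((\<lambda>x\<in>carrier G. f x * f' x) (\<phi> g x) - (\<lambda>x\<in>carrier G. f x * f' x) x) < \<epsilon>"
  proof eventually_elim
    case (elim g)
    show ?case
    proof
      fix x assume x: "x \<in> carrier G"
      have \<phi>x: "\<phi> g x \<in> carrier G" using \<phi> x elim(3) by (simp add: topspace_eq)
      have "f (\<phi> g x) * f' (\<phi> g x) - f x * f' x = (f (\<phi> g x) - f x) * f' (\<phi> g x) + f x * (f' (\<phi> g x) - f' x)"
        by (simp add: algebra_simps)
      also have "norm \<dots> \<le> norm (f (\<phi> g x) - f x) * norm (f' (\<phi> g x)) + norm (f x) * norm (f' (\<phi> g x) - f' x)"
        by (metis norm_mult norm_triangle_ineq)
      also have "\<dots> \<le> norm (f (\<phi> g x) - f x) * D + C * norm (f' (\<phi> g x) - f' x)"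
        using C D x \<phi>x by (intro add_mono mult_mono) (auto simp: topspace_eq)
      also have "\<dots> < \<epsilon> / (2 * D) * D + C * (\<epsilon> / (2 * C))"
        using elim(1,2) x C(1) D(1) by (intro add_strict_mono mult_strict_right_mono mult_strict_left_mono) auto
      also have "\<dots> = \<epsilon>" using C(1) D(1) by simp
      finally show "norm ((\<lambda>x\<in>carrier G. f x * f' x) (\<phi> g x) - (\<lambda>x\<in>carrier G. f x * f' x) x) < \<epsilon>"
        using x \<phi>x by simp
    qed
  qed
qed

lemma equicontinuous_translates_const:
  assumes "\<And>g x. g \<in> carrier G \<Longrightarrow> x \<in> carrier G \<Longrightarrow> \<phi> g x \<in> carrier G"
  shows "equicontinuous_translates \<phi> (\<lambda>x\<in>carrier G. c)"
  unfolding equicontinuous_translates_def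
proof (intro allI impI)
  fix \<epsilon> :: real assume "\<epsilon> > 0"
  show "\<forall>\<^sub>F g in nhdsin T \<one>. \<forall>x\<in>carrier G. norm ((\<lambda>x\<in>carrier G. c) (\<phi> g x) - (\<lambda>x\<in>carrier G. c) x) < \<epsilon>"
    using eventually_nhdsin_topspace[of T \<one>]
    by eventually_elim (use assms \<open>\<epsilon> > 0\<close> in \<open>auto simp: topspace_eq\<close>)
qed

text \<open>On a compact set \<open>L\<close> the tube lemma makes the estimate at the identity
  uniform in \<open>x\<close>; outside \<open>L\<close> both values vanish once \<open>g\<close> is
  close to the identity. The map \<open>\<psi>\<close>, which undoes \<open>\<phi>\<close>, is used
  to construct \<open>L\<close>.\<close>

lemma Cc_equicontinuous_translates:
  assumes f: "f \<in> Cc T"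
    and \<phi>: "continuous_map (prod_topology T T) T (\<lambda>(g, x). \<phi> g x)"
    and \<psi>: "continuous_map (prod_topology T T) T (\<lambda>(g, x). \<psi> g x)"
    and \<psi>\<phi>: "\<And>g x. g \<in> carrier G \<Longrightarrow> x \<in> carrier G \<Longrightarrow> \<psi> g (\<phi> g x) = x"
    and one: "\<And>x. x \<in> carrier G \<Longrightarrow> \<phi> \<one> x = x"
  shows "equicontinuous_translates \<phi> f"
  unfolding equicontinuous_translates_def
proof (intro allI impI)
  fix \<epsilon> :: real assume "\<epsilon> > 0"
  obtain K where K: "compactin T K" "\<forall>x\<in>topspace T - K. f x = 0" and "f \<in> Cb T"
    using f by (auto simp: Cc_def)
  have f_cont: "continuous_map T euclidean f" using \<open>f \<in> Cb T\<close> by (rule Cb_continuous)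
  obtain U W where UW: "openin T U" "compactin T W" "\<one> \<in> U" "U \<subseteq> W"
    using locally_compact unfolding locally_compact_space_def by (metis one_closed topspace_eq)
  \<comment> \<open>If \<open>g\<close> lies in \<open>W\<close> and \<open>\<phi> g x\<close> in
    \<open>K\<close>, then \<open>x = \<psi> g (\<phi> g x)\<close> lies in \<open>L\<close>.
    Outside \<open>L\<close> neither \<open>x\<close> nor its translate can therefore be in
    \<open>K\<close>.\<close>
  define L where "L = (\<lambda>(g, x). \<psi> g x) ` (W \<times> K) \<union> K"
  have L: "compactin T L"
    unfolding L_def using K(1) UW(2) by (intro compactin_Un image_compactin[OF _ \<psi>]) (auto simp: compactin_Times)
  define h where "h p = norm (f (case p of (g, x) \<Rightarrow> \<phi> g x) - f (snd p))" for p
  have "continuous_map (prod_topology T T) euclideanreal h"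
    unfolding h_def
    using continuous_map_compose[OF \<phi> f_cont] continuous_map_compose[OF continuous_map_snd f_cont]
    by (intro continuous_map_norm continuous_map_diff) (auto simp: o_def)
  then have "openin (prod_topology T T) {p \<in> topspace (prod_topology T T). h p \<in> {..<\<epsilon>}}"
    unfolding continuous_map by (metis open_lessThan open_openin)
  moreover have "{\<one>} \<times> L \<subseteq> {p \<in> topspace (prod_topology T T). h p \<in> {..<\<epsilon>}}"
    using compactin_subset_topspace[OF L] one \<open>\<epsilon> > 0\<close> by (auto simp: h_def topspace_eq)
  moreover have "\<one> \<in> topspace T" by (simp add: topspace_eq)
  ultimately have "\<exists>V V'. openin T V \<and> openin T V' \<and> \<one> \<in> V \<and> L \<subseteq> V' \<and>
      V \<times> V' \<subseteq> {p \<in> topspace (prod_topology T T). h p \<in> {..<\<epsilon>}}"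
    by (intro tube_lemma_right[OF _ L])
  then obtain V V' where V: "openin T V" "openin T V'" "\<one> \<in> V" "L \<subseteq> V'"
    "V \<times> V' \<subseteq> {p \<in> topspace (prod_topology T T). h p \<in> {..<\<epsilon>}}"
    by (elim exE conjE)
  have "norm (f (\<phi> g x) - f x) < \<epsilon>" if g: "g \<in> U \<inter> V" and x: "x \<in> carrier G" for g x
  proof (cases "x \<in> L")
    case True
    then have "(g, x) \<in> V \<times> V'" using g V(4) by auto
    then show ?thesis using V(5) by (auto simp: h_def)
  next
    case False
    have gG: "g \<in> carrier G" using g openin_subset[OF UW(1)] by (auto simp: topspace_eq)
    have \<phi>G: "\<phi> g x \<in> carrier G"
      using continuous_map_image_subset_topspace[OF \<phi>] gG x by (fastforce simp: topspace_eq)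
    have "\<phi> g x \<notin> K"
    proof
      assume "\<phi> g x \<in> K"
      then have "(g, \<phi> g x) \<in> W \<times> K" using g UW(4) by auto
      then have "\<psi> g (\<phi> g x) \<in> L" unfolding L_def by force
      then show False using \<psi>\<phi>[OF gG x] False by simp
    qed
    moreover have "x \<notin> K" using False by (simp add: L_def)
    ultimately show ?thesis using K(2) \<phi>G x \<open>\<epsilon> > 0\<close> by (simp add: topspace_eq)
  qed
  then show "\<forall>\<^sub>F g in nhdsin T \<one>. \<forall>x\<in>carrier G. norm (f (\<phi> g x) - f x) < \<epsilon>"
    unfolding eventually_nhdsin using UW V by (intro disjI2 exI[of _ "U \<inter> V"]) auto
qed

lemma continuous_map_inv_mult: "continuous_map (prod_topology T T) T (\<lambda>(g, x). inv g \<otimes> x)"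
  and continuous_map_mult_swap: "continuous_map (prod_topology T T) T (\<lambda>(g, x). x \<otimes> g)"
  and continuous_map_mult_inv_swap: "continuous_map (prod_topology T T) T (\<lambda>(g, x). x \<otimes> inv g)"
proof -
  have inv_fst: "continuous_map (prod_topology T T) T (\<lambda>p. inv (fst p))"
    using continuous_map_compose[OF continuous_map_fst continuous_inv] by (simp add: o_def)
  have *: "continuous_map (prod_topology T T) T (\<lambda>p. a p \<otimes> b p)"
    if "continuous_map (prod_topology T T) T a" "continuous_map (prod_topology T T) T b" for a b
    using continuous_map_compose[OF continuous_map_pairedI[OF that] continuous_mult] by (simp add: o_def)
  show "continuous_map (prod_topology T T) T (\<lambda>(g, x). inv g \<otimes> x)"
    using *[OF inv_fst continuous_map_snd] by (simp add: case_prod_unfold)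
  show "continuous_map (prod_topology T T) T (\<lambda>(g, x). x \<otimes> g)"
    using *[OF continuous_map_snd continuous_map_fst] by (simp add: case_prod_unfold)
  show "continuous_map (prod_topology T T) T (\<lambda>(g, x). x \<otimes> inv g)"
    using *[OF continuous_map_snd inv_fst] by (simp add: case_prod_unfold)
qed

lemma Cc_Cbu: "f \<in> Cc T \<Longrightarrow> f \<in> Cbu G T"
  unfolding Cbu_iff
  using Cc_equicontinuous_translates[OF _ continuous_map_inv_mult continuous_mult, of f]
    Cc_equicontinuous_translates[OF _ continuous_map_mult_swap continuous_map_mult_inv_swap, of f]
  by (auto simp: Cc_def m_assoc[symmetric] inv_solve_right) (simp_all add: m_assoc)

lemma Cc_rtrans: "f \<in> Cc T \<Longrightarrow> g \<in> carrier G \<Longrightarrow> rtrans G g f \<in> Cc T"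
  using Cc_compose[of f T "\<lambda>x. x \<otimes> g" "\<lambda>x. x \<otimes> inv g"]
  by (simp add: rtrans_def topspace_eq continuous_map_rmult[unfolded topspace_eq] m_assoc)

lemma Cc_ltrans: "f \<in> Cc T \<Longrightarrow> g \<in> carrier G \<Longrightarrow> (\<lambda>x\<in>carrier G. f (g \<otimes> x)) \<in> Cc T"
  using Cc_compose[of f T "\<lambda>x. g \<otimes> x" "\<lambda>x. inv g \<otimes> x"]
  by (simp add: topspace_eq continuous_map_lmult m_assoc[symmetric])

lemma C0_ltrans: "f \<in> C0 T \<Longrightarrow> g \<in> carrier G \<Longrightarrow> (\<lambda>x\<in>carrier G. f (g \<otimes> x)) \<in> C0 T"
  using C0_compose[of f T "\<lambda>x. g \<otimes> x" "\<lambda>x. inv g \<otimes> x"]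
  by (simp add: topspace_eq continuous_map_lmult m_assoc[symmetric])

text \<open>A compactly supported function and its right translates vanish at infinity, and so do
  their differences. In particular the algebra contains the cutoffs, which are what distinguishes
  points of the group from boundary points.\<close>

lemma Cc_Chu:
  assumes f: "f \<in> Cc T" shows "f \<in> Chu G T"
proof -
  have "(\<lambda>x\<in>carrier G. rtrans G g f x - f x) \<in> C0 T" if g: "g \<in> carrier G" for g
  proof -
    have f0: "f \<in> C0 T" "rtrans G g f \<in> C0 T"
      using f Cc_rtrans[OF f g] Cc_subset_C0 by blast+
    have "(\<lambda>x\<in>topspace T. - 1) \<in> (Cb T :: ('a \<Rightarrow> complex) set)" by (rule Cb_const)
    from C0_add[OF f0(2) C0_mult[OF f0(1) this]]
    show ?thesis by (simp add: topspace_eq cong: restrict_cong)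
  qed
  then show ?thesis using Cc_Cbu[OF f] by (auto simp: Chu_def)
qed

lemma Chu_Cb: "f \<in> Chu G T \<Longrightarrow> f \<in> Cb T"
  by (auto simp: Chu_def Cbu_def)

lemma Chu_const: "(\<lambda>x\<in>carrier G. c) \<in> Chu G T"
proof -
  have "(\<lambda>x\<in>carrier G. 0) \<in> (C0 T :: ('a \<Rightarrow> complex) set)"
    using Cb_const[where T = T and c = "0 :: complex"] by (auto simp: C0_def topspace_eq intro!: exI[of _ "{}"])
  then have "(\<lambda>x\<in>carrier G. rtrans G g (\<lambda>x\<in>carrier G. c) x - (\<lambda>x\<in>carrier G. c) x) \<in> C0 T" if "g \<in> carrier G" for g
    using that by (simp add: rtrans_def cong: restrict_cong)
  moreover have "(\<lambda>x\<in>carrier G. c) \<in> Cbu G T"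
    unfolding Cbu_iff using Cb_const[where T = T and c = c] equicontinuous_translates_const by (auto simp: topspace_eq)
  ultimately show ?thesis by (simp add: Chu_def)
qed

lemma Chu_add:
  assumes f: "f \<in> Chu G T" and f': "f' \<in> Chu G T" shows "(\<lambda>x\<in>carrier G. f x + f' x) \<in> Chu G T"
proof -
  have "(\<lambda>x\<in>carrier G. rtrans G g (\<lambda>x\<in>carrier G. f x + f' x) x - (\<lambda>x\<in>carrier G. f x + f' x) x) \<in> C0 T"
    if g: "g \<in> carrier G" for g
  proof -
    have "(\<lambda>x\<in>carrier G. rtrans G g f x - f x) \<in> C0 T" "(\<lambda>x\<in>carrier G. rtrans G g f' x - f' x) \<in> C0 T"
      using f f' g by (auto simp: Chu_def)
    from C0_add[OF this] show ?thesis
      using g by (simp add: rtrans_def topspace_eq algebra_simps cong: restrict_cong)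
  qed
  moreover have "(\<lambda>x\<in>carrier G. f x + f' x) \<in> Cbu G T"
    using f f' Cb_add[of f T f'] equicontinuous_translates_add
    unfolding Chu_def Cbu_iff by (auto simp: topspace_eq)
  ultimately show ?thesis by (simp add: Chu_def)
qed

lemma Chu_mult:
  assumes f: "f \<in> Chu G T" and f': "f' \<in> Chu G T" shows "(\<lambda>x\<in>carrier G. f x * f' x) \<in> Chu G T"
proof -
  have "(\<lambda>x\<in>carrier G. rtrans G g (\<lambda>x\<in>carrier G. f x * f' x) x - (\<lambda>x\<in>carrier G. f x * f' x) x) \<in> C0 T"
    if g: "g \<in> carrier G" for g
  proof -
    have 0: "(\<lambda>x\<in>carrier G. rtrans G g f x - f x) \<in> C0 T" "(\<lambda>x\<in>carrier G. rtrans G g f' x - f' x) \<in> C0 T"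
      using f f' g by (auto simp: Chu_def)
    have "rtrans G g f' \<in> Cb T"
      using Cb_compose[OF Chu_Cb[OF f'] continuous_map_rmult[OF g]] by (simp add: rtrans_def topspace_eq)
    \<comment> \<open>With \<open>\<rho>\<close> for the right translation,
      \<open>\<rho> f * \<rho> f' - f * f'\<close> equals
      \<open>(\<rho> f - f) * \<rho> f' + (\<rho> f' - f') * f\<close>, and \<open>C0\<close>
      absorbs products with \<open>Cb\<close>.\<close>
    from C0_add[OF C0_mult[OF 0(1) this] C0_mult[OF 0(2) Chu_Cb[OF f]]] show ?thesis
      using g by (simp add: rtrans_def topspace_eq algebra_simps cong: restrict_cong)
  qed
  moreover have "(\<lambda>x\<in>carrier G. f x * f' x) \<in> Cbu G T"
    using f f' Cb_mult[of f T f'] equicontinuous_translates_mult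
    unfolding Chu_def Cbu_iff by (auto simp: topspace_eq)
  ultimately show ?thesis by (simp add: Chu_def)
qed

lemma Chu_cmult:
  assumes "f \<in> Chu G T" shows "(\<lambda>x\<in>carrier G. c * f x) \<in> Chu G T"
  using Chu_mult[OF Chu_const[of c] assms] by (simp cong: restrict_cong)

text \<open>Uniform continuity at the identity is moved to \<open>g\<close> by writing
  \<open>h \<otimes> x\<close> as \<open>inv (g \<otimes> inv h) \<otimes> (g \<otimes> x)\<close>.
  This is the norm continuity of translation that later lets invariance pass to the closure of the
  projection.\<close>

lemma Chu_left_uniformly_continuous:
  assumes f: "f \<in> Chu G T" and g: "g \<in> carrier G" and "\<epsilon> > 0"
  shows "\<forall>\<^sub>F h in nhdsin T g. \<forall>x\<in>carrier G. norm (f (h \<otimes> x) - f (g \<otimes> x)) < \<epsilon>"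
proof -
  have eq: "\<forall>\<^sub>F h in nhdsin T \<one>. \<forall>x\<in>carrier G. norm (f (inv h \<otimes> x) - f x) < \<epsilon>"
    using f by (intro equicontinuous_translatesD \<open>\<epsilon> > 0\<close>) (simp add: Chu_def Cbu_iff)
  have "continuous_map T T (\<lambda>h. g \<otimes> inv h)"
    using continuous_map_compose[OF continuous_inv continuous_map_lmult[OF g]] by (simp add: o_def)
  from filterlim_nhdsin[OF this, of g] have "filterlim (\<lambda>h. g \<otimes> inv h) (nhdsin T \<one>) (nhdsin T g)"
    using g by (simp add: topspace_eq)
  from eventually_compose_filterlim[OF eq this] eventually_nhdsin_topspace[of T g]
  show ?thesis
  proof eventually_elim
    case (elim h)
    show ?case
    proof
      fix x assume x: "x \<in> carrier G"
      have "h \<in> carrier G" using elim(2) by (simp add: topspace_eq)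
      then have "inv (g \<otimes> inv h) \<otimes> (g \<otimes> x) = h \<otimes> x"
        using g x by (simp add: inv_mult_group m_assoc) (simp add: m_assoc[symmetric])
      then show "norm (f (h \<otimes> x) - f (g \<otimes> x)) < \<epsilon>"
        using elim(1) g x by (metis m_closed)
    qed
  qed
qed

text \<open>Left and right translations commute, so the conditions on right translates are
  inherited. The condition on left translates amounts to uniform continuity at \<open>g\<close>
  instead of the identity, since \<open>g \<otimes> inv h\<close> tends to \<open>g\<close>.\<close>

lemma Chu_ltrans:
  assumes f: "f \<in> Chu G T" and g: "g \<in> carrier G"
  shows "(\<lambda>x\<in>carrier G. f (g \<otimes> x)) \<in> Chu G T"
proof -
  have Cb: "(\<lambda>x\<in>carrier G. f (g \<otimes> x)) \<in> Cb T"
    using Cb_compose[OF Chu_Cb[OF f] continuous_map_lmult[OF g]] by (simp add: topspace_eq)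
  have "(\<lambda>x\<in>carrier G. rtrans G h (\<lambda>x\<in>carrier G. f (g \<otimes> x)) x - (\<lambda>x\<in>carrier G. f (g \<otimes> x)) x) \<in> C0 T"
    if h: "h \<in> carrier G" for h
  proof -
    have "(\<lambda>x\<in>carrier G. rtrans G h f x - f x) \<in> C0 T" using f h by (auto simp: Chu_def)
    from C0_ltrans[OF this g] show ?thesis
      using g h by (simp add: rtrans_def topspace_eq m_assoc cong: restrict_cong)
  qed
  moreover have "equicontinuous_translates (\<lambda>h x. inv h \<otimes> x) (\<lambda>x\<in>carrier G. f (g \<otimes> x))"
    unfolding equicontinuous_translates_def
  proof (intro allI impI)
    fix \<epsilon> :: real assume "\<epsilon> > 0"
    have "continuous_map T T (\<lambda>h. g \<otimes> inv h)"
      using continuous_map_compose[OF continuous_inv continuous_map_lmult[OF g]] by (simp add: o_def)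
    from filterlim_nhdsin[OF this, of \<one>] have "filterlim (\<lambda>h. g \<otimes> inv h) (nhdsin T g) (nhdsin T \<one>)"
      using g by (simp add: topspace_eq)
    from eventually_compose_filterlim[OF Chu_left_uniformly_continuous[OF f g \<open>\<epsilon> > 0\<close>] this]
      eventually_nhdsin_topspace[of T \<one>]
    show "\<forall>\<^sub>F h in nhdsin T \<one>. \<forall>x\<in>carrier G.
        norm ((\<lambda>x\<in>carrier G. f (g \<otimes> x)) (inv h \<otimes> x) - (\<lambda>x\<in>carrier G. f (g \<otimes> x)) x) < \<epsilon>"
      by eventually_elim (use g in \<open>auto simp: topspace_eq m_assoc\<close>)
  qed
  moreover have "equicontinuous_translates (\<lambda>h x. x \<otimes> h) (\<lambda>x\<in>carrier G. f (g \<otimes> x))"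
    unfolding equicontinuous_translates_def
  proof (intro allI impI)
    fix \<epsilon> :: real assume "\<epsilon> > 0"
    then have "\<forall>\<^sub>F h in nhdsin T \<one>. \<forall>x\<in>carrier G. norm (f (x \<otimes> h) - f x) < \<epsilon>"
      using f by (intro equicontinuous_translatesD) (simp_all add: Chu_def Cbu_iff)
    with eventually_nhdsin_topspace[of T \<one>]
    show "\<forall>\<^sub>F h in nhdsin T \<one>. \<forall>x\<in>carrier G.
        norm ((\<lambda>x\<in>carrier G. f (g \<otimes> x)) (x \<otimes> h) - (\<lambda>x\<in>carrier G. f (g \<otimes> x)) x) < \<epsilon>"
      by eventually_elim (use g in \<open>auto simp: topspace_eq m_assoc[symmetric]\<close>)
  qed
  ultimately show ?thesis using Cb by (simp add: Chu_def Cbu_iff)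
qed

end

section \<open>Characters of the bounded functions on a discrete space\<close>

abbreviation ellinf :: "'a set \<Rightarrow> ('a \<Rightarrow> complex) set" where
  "ellinf X \<equiv> Cb (discrete_topology X)"

lemma ellinf_iff: "f \<in> ellinf X \<longleftrightarrow> f \<in> extensional X \<and> (\<exists>C. \<forall>x\<in>X. norm (f x) \<le> C)"
  by (simp add: Cb_iff)

lemma ellinfI: "(\<And>x. x \<in> X \<Longrightarrow> norm (f x) \<le> C) \<Longrightarrow> (\<lambda>x\<in>X. f x) \<in> ellinf X"
  unfolding ellinf_iff by auto

lemma charactersD:
  assumes "\<phi> \<in> characters X A"
  shows "\<And>f g. f \<in> A \<Longrightarrow> g \<in> A \<Longrightarrow> \<phi> (\<lambda>x\<in>X. f x + g x) = \<phi> f + \<phi> g"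
    "\<And>c f. f \<in> A \<Longrightarrow> \<phi> (\<lambda>x\<in>X. c * f x) = c * \<phi> f"
    "\<And>f g. f \<in> A \<Longrightarrow> g \<in> A \<Longrightarrow> \<phi> (\<lambda>x\<in>X. f x * g x) = \<phi> f * \<phi> g"
    "\<phi> \<in> extensional A"
  using assms by (auto simp: characters_def)

lemma character_const:
  assumes \<phi>: "\<phi> \<in> characters X (ellinf X)"
  shows "\<phi> (\<lambda>x\<in>X. c) = c"
proof -
  obtain f where f: "f \<in> ellinf X" "\<phi> f \<noteq> 0" using \<phi> by (auto simp: characters_def)
  have one: "(\<lambda>x\<in>X. 1) \<in> ellinf X" by (rule ellinfI[where C = 1]) simp
  have "(\<lambda>x\<in>X. f x * (\<lambda>x\<in>X. 1) x) = f"
    using f(1) by (auto simp: ellinf_iff extensional_def)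
  then have "\<phi> (\<lambda>x\<in>X. 1) = 1"
    using charactersD(3)[OF \<phi> f(1) one] f(2) by simp
  then show ?thesis
    using charactersD(2)[OF \<phi> one, of c] by (simp cong: restrict_cong)
qed

text \<open>Otherwise \<open>f\<close> minus the scalar \<open>\<phi> f\<close> would be bounded
  away from zero, hence invertible among the bounded functions, while \<open>\<phi>\<close> maps it
  to zero. Characters are defined purely algebraically, and this supplies their continuity.\<close>

lemma character_norm_le:
  assumes \<phi>: "\<phi> \<in> characters X (ellinf X)" and f: "f \<in> ellinf X" and C: "\<And>x. x \<in> X \<Longrightarrow> norm (f x) \<le> C"
  shows "norm (\<phi> f) \<le> C"
proof (rule ccontr)
  assume "\<not> norm (\<phi> f) \<le> C"
  define c where "c = \<phi> f"
  have c: "norm c > C" using \<open>\<not> norm (\<phi> f) \<le> C\<close> by (simp add: c_def)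
  have low: "norm (f x - c) \<ge> norm c - C" if "x \<in> X" for x
    using C[OF that] norm_triangle_ineq2[of c "f x"] by (simp add: norm_minus_commute)
  have const: "(\<lambda>x\<in>X. - c) \<in> ellinf X" by (rule ellinfI[where C = "norm c"]) simp
  define g where "g = (\<lambda>x\<in>X. f x + (\<lambda>x\<in>X. - c) x)"
  have g: "g \<in> ellinf X" using Cb_add[OF f const] by (simp add: g_def)
  have h: "(\<lambda>x\<in>X. inverse (f x - c)) \<in> ellinf X"
  proof (rule ellinfI[where C = "inverse (norm c - C)"])
    fix x assume "x \<in> X"
    then show "norm (inverse (f x - c)) \<le> inverse (norm c - C)"
      unfolding norm_inverse using c low by (intro le_imp_inverse_le) auto
  qed
  have "\<phi> g = 0"
    using charactersD(1)[OF \<phi> f const] character_const[OF \<phi>, of "- c"] by (simp add: g_def c_def)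
  moreover have "(\<lambda>x\<in>X. g x * (\<lambda>x\<in>X. inverse (f x - c)) x) = (\<lambda>x\<in>X. 1)"
  proof (rule restrict_ext)
    fix x assume "x \<in> X"
    moreover from this have "f x - c \<noteq> 0" using low c by fastforce
    ultimately show "g x * (\<lambda>x\<in>X. inverse (f x - c)) x = 1" by (simp add: g_def)
  qed
  ultimately have "\<phi> (\<lambda>x\<in>X. 1) = 0"
    using charactersD(3)[OF \<phi> g h] by simp
  then show False using character_const[OF \<phi>, of 1] by simp
qed

lemma character_diff:
  assumes \<phi>: "\<phi> \<in> characters X (ellinf X)" and f: "f \<in> ellinf X" and g: "g \<in> ellinf X"
  shows "\<phi> (\<lambda>x\<in>X. f x - g x) = \<phi> f - \<phi> g"
proof -
  have "(\<lambda>x\<in>X. - 1 * g x) \<in> ellinf X"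
    using Cb_mult[OF Cb_const[where T = "discrete_topology X" and c = "- 1"] g] by (simp cong: restrict_cong)
  from charactersD(1)[OF \<phi> f this] show ?thesis
    using charactersD(2)[OF \<phi> g, of "- 1"] by (simp cong: restrict_cong)
qed

definition delta :: "'a set \<Rightarrow> 'a \<Rightarrow> 'a \<Rightarrow> complex" where
  "delta X a = (\<lambda>x\<in>X. of_bool (x = a))"

lemma delta_ellinf: "delta X a \<in> ellinf X"
  unfolding delta_def by (rule ellinfI[where C = 1]) simp

text \<open>The product of \<open>f\<close> with \<open>delta X a\<close> is \<open>f a\<close>
  times \<open>delta X a\<close>; by multiplicativity the nonzero value at \<open>delta X a\<close>
  can be cancelled.\<close>

lemma character_delta_nonzero:
  assumes \<phi>: "\<phi> \<in> characters X (ellinf X)" and nz: "\<phi> (delta X a) \<noteq> 0" and a: "a \<in> X"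
  shows "\<phi> = point_eval (ellinf X) a"
proof (rule extensionalityI[where A = "ellinf X"])
  show "\<phi> \<in> extensional (ellinf X)" by (rule charactersD(4)[OF \<phi>])
  show "point_eval (ellinf X) a \<in> extensional (ellinf X)" by (simp add: point_eval_def)
  fix f assume f: "f \<in> ellinf X"
  have "(\<lambda>x\<in>X. f x * delta X a x) = (\<lambda>x\<in>X. f a * delta X a x)"
    by (auto simp: delta_def restrict_def)
  then have "\<phi> f * \<phi> (delta X a) = f a * \<phi> (delta X a)"
    using charactersD(3)[OF \<phi> f delta_ellinf] charactersD(2)[OF \<phi> delta_ellinf] by metis
  then show "\<phi> f = point_eval (ellinf X) a f" using nz f by (simp add: point_eval_def)
qed

text \<open>A function of finite support is a linear combination of functions
  \<open>delta X a\<close>; splitting off one point at a time finds one of them that the character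
  does not kill.\<close>

lemma character_finite_support:
  assumes \<phi>: "\<phi> \<in> characters X (ellinf X)" and "finite S"
  shows "f \<in> ellinf X \<Longrightarrow> (\<And>x. x \<in> X - S \<Longrightarrow> f x = 0) \<Longrightarrow> \<phi> f \<noteq> 0 \<Longrightarrow> \<exists>a\<in>X. \<phi> (delta X a) \<noteq> 0"
  using \<open>finite S\<close>
proof (induction S arbitrary: f rule: finite_induct)
  case empty
  then have "(\<lambda>x\<in>X. 0 * f x) = f"
    by (auto simp: ellinf_iff extensional_def)
  then have "\<phi> f = 0" using charactersD(2)[OF \<phi> empty(1), of 0] by simp
  then show ?case using empty by simp
next
  case (insert a S)
  show ?case
  proof (cases "a \<in> X")
    case False
    then show ?thesis using insert by (intro insert.IH[of f]) auto
  next
    case True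
    obtain C where C: "\<And>x. x \<in> X \<Longrightarrow> norm (f x) \<le> C" using insert.prems(1) by (auto simp: ellinf_iff)
    define g where "g = (\<lambda>x\<in>X. if x = a then 0 else f x)"
    have g: "g \<in> ellinf X"
      unfolding g_def using C order_trans[OF norm_ge_zero C] by (intro ellinfI[where C = C]) auto
    have d: "(\<lambda>x\<in>X. f a * delta X a x) \<in> ellinf X"
      using Cb_mult[OF Cb_const[where T = "discrete_topology X" and c = "f a"] delta_ellinf]
      by (simp cong: restrict_cong)
    have "(\<lambda>x\<in>X. g x + (\<lambda>x\<in>X. f a * delta X a x) x) = f"
      using insert.prems(1) by (auto simp: ellinf_iff extensional_def g_def delta_def restrict_def)
    then have "\<phi> f = \<phi> g + f a * \<phi> (delta X a)"
      using charactersD(1)[OF \<phi> g d] charactersD(2)[OF \<phi> delta_ellinf] by simp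
    then consider "\<phi> (delta X a) \<noteq> 0" | "\<phi> g \<noteq> 0" using insert.prems(3) by fastforce
    then show ?thesis
    proof cases
      case 1
      then show ?thesis using True by blast
    next
      case 2
      show ?thesis
        by (rule insert.IH[OF g _ 2]) (use insert.prems(2) in \<open>auto simp: g_def\<close>)
    qed
  qed
qed

lemma closedin_Collect_ball:
  assumes "\<And>i. i \<in> I \<Longrightarrow> closedin P {x \<in> topspace P. Q i x}"
  shows "closedin P {x \<in> topspace P. \<forall>i\<in>I. Q i x}"
proof (cases "I = {}")
  case False
  have "{x \<in> topspace P. \<forall>i\<in>I. Q i x} = (\<Inter>i\<in>I. {x \<in> topspace P. Q i x})"
    using False by auto
  then show ?thesis using assms False by (auto intro!: closedin_Inter)
qed simp

text \<open>The norm bound places the characters in a product of discs, compact by Tychonoff, and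
  the defining equations are closed conditions on coordinates. The extra equations for
  \<open>D\<close> make the part over the boundary, which is cut out by such equations, compact as
  well.\<close>

lemma compactin_characters_vanishing:
  assumes D: "D \<subseteq> ellinf X"
  shows "compactin (stone_cech X) {\<phi> \<in> characters X (ellinf X). \<forall>f\<in>D. \<phi> f = 0}" (is "compactin _ ?S")
proof -
  let ?A = "ellinf X"
  define P where "P = product_topology (\<lambda>f :: 'a \<Rightarrow> complex. euclidean :: complex topology) ?A"
  have topP: "topspace P = extensional ?A" by (auto simp: P_def PiE_def)
  obtain C where C: "\<And>f x. f \<in> ?A \<Longrightarrow> x \<in> X \<Longrightarrow> norm (f x) \<le> C f"
    using ellinf_iff by metis
  have "compactin P (PiE ?A (\<lambda>f. cball 0 (C f)))"
    unfolding P_def compactin_PiE by auto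
  moreover have "?S \<subseteq> PiE ?A (\<lambda>f. cball 0 (C f))"
  proof
    fix \<phi> assume "\<phi> \<in> ?S"
    then have "\<phi> \<in> characters X ?A" by simp
    then show "\<phi> \<in> PiE ?A (\<lambda>f. cball 0 (C f))"
      using character_norm_le[OF _ _ C] charactersD(4) by (auto simp: PiE_def)
  qed
  moreover have "closedin P ?S"
  proof -
    have coord: "continuous_map P euclidean (\<lambda>\<phi>. \<phi> f)" if "f \<in> ?A" for f
      unfolding P_def using that
      by (rule continuous_map_product_coordinates[where T = "\<lambda>_. euclidean"])
    have eq: "closedin P {\<phi> \<in> topspace P. a \<phi> = b \<phi>}"
      if "continuous_map P euclidean a" "continuous_map P euclidean b" for a b :: "_ \<Rightarrow> complex"
      using closedin_continuous_maps_eq[OF _ that] by simp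
    have one: "(\<lambda>x\<in>X. 1) \<in> ?A" by (rule ellinfI[where C = 1]) simp
    \<comment> \<open>Being nonzero is not a closed condition; for a multiplicative functional it is
      replaced by the value 1 at the constant function 1.\<close>
    have "closedin P ({\<phi> \<in> topspace P. \<forall>f\<in>?A. \<forall>g\<in>?A. \<phi> (\<lambda>x\<in>X. f x + g x) = \<phi> f + \<phi> g} \<inter>
       {\<phi> \<in> topspace P. \<forall>c\<in>UNIV. \<forall>f\<in>?A. \<phi> (\<lambda>x\<in>X. c * f x) = c * \<phi> f} \<inter>
       {\<phi> \<in> topspace P. \<forall>f\<in>?A. \<forall>g\<in>?A. \<phi> (\<lambda>x\<in>X. f x * g x) = \<phi> f * \<phi> g} \<inter>
       {\<phi> \<in> topspace P. \<phi> (\<lambda>x\<in>X. 1) = 1} \<inter> {\<phi> \<in> topspace P. \<forall>f\<in>D. \<phi> f = 0})"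
    proof (intro closedin_Int closedin_Collect_ball eq continuous_map_add continuous_map_times coord)
      fix f g assume f: "f \<in> ?A" and g: "g \<in> ?A"
      show "(\<lambda>x\<in>X. f x + g x) \<in> ?A" "(\<lambda>x\<in>X. f x * g x) \<in> ?A"
        using Cb_add[OF f g] Cb_mult[OF f g] by simp_all
      show "(\<lambda>x\<in>X. c * f x) \<in> ?A" for c
        using Cb_mult[OF Cb_const[where T = "discrete_topology X" and c = c] f] by (simp cong: restrict_cong)
    qed (use D one in auto)
    also have "\<dots> = ?S"
      unfolding topP using character_const[of _ X 1] one
      by (auto simp: characters_def) (metis zero_neq_one)
    finally show ?thesis .
  qed
  ultimately have "compactin P ?S" by (rule closed_compactin)
  then show ?thesis
    unfolding stone_cech_def spectrum_def P_def[symmetric] compactin_subtopology by auto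
qed

section \<open>The adjoint action on the Stone-Cech compactification\<close>

context group
begin

abbreviation "\<Omega> \<equiv> stone_cech_minus_one G"

lemma topspace_\<Omega>:
  "topspace \<Omega> = characters (carrier G) (ellinf (carrier G)) - {point_eval (ellinf (carrier G)) \<one>}"
  by (auto simp: stone_cech_minus_one_def stone_cech_def topspace_spectrum)

lemma \<Omega>_characters: "z \<in> topspace \<Omega> \<Longrightarrow> z \<in> characters (carrier G) (ellinf (carrier G))"
  by (simp add: topspace_\<Omega>)

lemma continuous_map_\<Omega>_coordinate:
  "f \<in> ellinf (carrier G) \<Longrightarrow> continuous_map \<Omega> euclidean (\<lambda>z. z f)"
  unfolding stone_cech_minus_one_def stone_cech_def spectrum_def
  by (intro continuous_map_from_subtopology continuous_map_product_coordinates[where T = "\<lambda>_. euclidean"])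

lemma continuous_map_into_\<Omega>:
  assumes "\<And>f. f \<in> ellinf (carrier G) \<Longrightarrow> continuous_map Z euclidean (\<lambda>z. h z f)"
    and "\<And>z. z \<in> topspace Z \<Longrightarrow> h z \<in> topspace \<Omega>"
  shows "continuous_map Z \<Omega> h"
proof -
  let ?A = "ellinf (carrier G)"
  have h: "h z \<in> characters (carrier G) ?A" "h z \<noteq> point_eval ?A \<one>" if "z \<in> topspace Z" for z
    using assms(2)[OF that] by (simp_all add: topspace_\<Omega>)
  have "h ` topspace Z \<subseteq> extensional ?A"
    using charactersD(4)[OF h(1)] by blast
  then have "continuous_map Z (product_topology (\<lambda>_. euclidean) ?A) h"
    unfolding continuous_map_componentwise using assms(1) by blast
  then show ?thesis
    unfolding stone_cech_minus_one_def stone_cech_def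
    using h by (auto simp: continuous_map_in_subtopology spectrum_def characters_def PiE_def)
qed

definition conj_function :: "'a \<Rightarrow> ('a \<Rightarrow> complex) \<Rightarrow> 'a \<Rightarrow> complex" where
  "conj_function a f = (\<lambda>x\<in>carrier G. f (a \<otimes> x \<otimes> inv a))"

lemma conj_function_ellinf:
  "a \<in> carrier G \<Longrightarrow> f \<in> ellinf (carrier G) \<Longrightarrow> conj_function a f \<in> ellinf (carrier G)"
  unfolding conj_function_def ellinf_iff by auto

lemma stone_cech_ad_apply:
  "f \<in> ellinf (carrier G) \<Longrightarrow> stone_cech_ad G a z f = z (conj_function a f)"
  by (simp add: stone_cech_ad_def spectrum_map_def conj_function_def)

lemma conj_function_delta:
  assumes "a \<in> carrier G" "b \<in> carrier G"
  shows "conj_function a (delta (carrier G) b) = delta (carrier G) (inv a \<otimes> b \<otimes> a)"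
proof -
  have "a \<otimes> x \<otimes> inv a = b \<longleftrightarrow> x = inv a \<otimes> b \<otimes> a" if "x \<in> carrier G" for x
    using assms that by (metis inv_closed inv_inv inv_solve_left inv_solve_right m_assoc m_closed)
  then show ?thesis
    using assms by (auto simp: conj_function_def delta_def restrict_def)
qed

lemma stone_cech_ad_\<Omega>:
  assumes a: "a \<in> carrier G" and z: "z \<in> topspace \<Omega>"
  shows "stone_cech_ad G a z \<in> topspace \<Omega>"
proof -
  let ?A = "ellinf (carrier G)"
  have zc: "z \<in> characters (carrier G) ?A" by (rule \<Omega>_characters[OF z])
  have one: "(\<lambda>x\<in>carrier G. 1) \<in> ?A" by (rule ellinfI[where C = 1]) simp
  have "stone_cech_ad G a z \<in> characters (carrier G) ?A"
    unfolding characters_def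
  proof (intro CollectI conjI ballI allI)
    show "stone_cech_ad G a z \<in> extensional ?A" by (simp add: stone_cech_ad_def spectrum_map_def)
    fix f assume f: "f \<in> ?A"
    note cf = conj_function_ellinf[OF a f]
    show "stone_cech_ad G a z (\<lambda>x\<in>carrier G. c * f x) = c * stone_cech_ad G a z f" for c
    proof -
      have "(\<lambda>x\<in>carrier G. c * f x) \<in> ?A"
        using Cb_mult[OF Cb_const[where T = "discrete_topology (carrier G)" and c = c] f]
        by (simp cong: restrict_cong)
      moreover have "conj_function a (\<lambda>x\<in>carrier G. c * f x) = (\<lambda>x\<in>carrier G. c * conj_function a f x)"
        using a by (auto simp: conj_function_def restrict_def)
      ultimately show ?thesis using charactersD(2)[OF zc cf] f by (simp add: stone_cech_ad_apply)
    qed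
    fix g assume g: "g \<in> ?A"
    note cg = conj_function_ellinf[OF a g]
    have fg: "(\<lambda>x\<in>carrier G. f x + g x) \<in> ?A" "(\<lambda>x\<in>carrier G. f x * g x) \<in> ?A"
      using Cb_add[OF f g] Cb_mult[OF f g] by simp_all
    have "conj_function a (\<lambda>x\<in>carrier G. f x + g x) = (\<lambda>x\<in>carrier G. conj_function a f x + conj_function a g x)"
      "conj_function a (\<lambda>x\<in>carrier G. f x * g x) = (\<lambda>x\<in>carrier G. conj_function a f x * conj_function a g x)"
      using a by (auto simp: conj_function_def restrict_def)
    then show "stone_cech_ad G a z (\<lambda>x\<in>carrier G. f x + g x) = stone_cech_ad G a z f + stone_cech_ad G a z g"
      "stone_cech_ad G a z (\<lambda>x\<in>carrier G. f x * g x) = stone_cech_ad G a z f * stone_cech_ad G a z g"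
      using charactersD(1,3)[OF zc cf cg] f g fg by (simp_all add: stone_cech_ad_apply)
  next
    have "conj_function a (\<lambda>x\<in>carrier G. 1) = (\<lambda>x\<in>carrier G. 1)"
      using a by (auto simp: conj_function_def restrict_def)
    then have "stone_cech_ad G a z (\<lambda>x\<in>carrier G. 1) = 1"
      using character_const[OF zc, of 1] one by (simp add: stone_cech_ad_apply)
    then show "\<exists>f\<in>?A. stone_cech_ad G a z f \<noteq> 0" using one by force
  qed
  \<comment> \<open>Conjugation fixes the identity, so \<open>z\<close> would take the value 1 at
    its point mass and be the very evaluation that \<open>\<Omega>\<close> excludes.\<close>
  moreover have "stone_cech_ad G a z \<noteq> point_eval ?A \<one>"
  proof
    assume "stone_cech_ad G a z = point_eval ?A \<one>"
    then have "stone_cech_ad G a z (delta (carrier G) \<one>) = point_eval ?A \<one> (delta (carrier G) \<one>)" by simp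
    then have "z (delta (carrier G) \<one>) = 1"
      using a conj_function_delta[OF a one_closed]
      by (simp add: stone_cech_ad_apply delta_ellinf point_eval_def) (simp add: delta_def)
    then have "z = point_eval ?A \<one>" by (intro character_delta_nonzero[OF zc]) auto
    then show False using z by (simp add: topspace_\<Omega>)
  qed
  ultimately show ?thesis by (simp add: topspace_\<Omega>)
qed

lemma continuous_map_stone_cech_ad:
  assumes a: "a \<in> carrier G" shows "continuous_map \<Omega> \<Omega> (stone_cech_ad G a)"
  by (rule continuous_map_into_\<Omega>)
    (use a in \<open>simp_all add: stone_cech_ad_apply stone_cech_ad_\<Omega> continuous_map_\<Omega>_coordinate conj_function_ellinf\<close>)

definition invariant_measure :: "(('a \<Rightarrow> complex) \<Rightarrow> complex) measure \<Rightarrow> bool" where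
  "invariant_measure \<mu> \<longleftrightarrow> \<mu> \<in> Prob \<Omega> \<and>
     (\<forall>\<gamma>\<in>carrier G. distr \<mu> (borel_on \<Omega>) (stone_cech_ad G \<gamma>) = \<mu>)"

lemma invariant_measure_vimage:
  assumes \<mu>: "invariant_measure \<mu>" and a: "a \<in> carrier G" and E: "E \<in> sets (borel_on \<Omega>)"
  shows "measure \<mu> (stone_cech_ad G a -` E \<inter> topspace \<Omega>) = measure \<mu> E"
proof -
  have P: "\<mu> \<in> Prob \<Omega>" and d: "distr \<mu> (borel_on \<Omega>) (stone_cech_ad G a) = \<mu>"
    using \<mu> a by (auto simp: invariant_measure_def)
  have "stone_cech_ad G a \<in> \<mu> \<rightarrow>\<^sub>M borel_on \<Omega>"
    using continuous_map_measurable_borel_on[OF continuous_map_stone_cech_ad[OF a]]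
      measurable_cong_sets[OF ProbD(2)[OF P] refl] by blast
  from measure_distr[OF this E] show ?thesis
    unfolding d by (simp add: ProbD(3)[OF P])
qed

lemma open_character_nonzero:
  assumes "f \<in> ellinf (carrier G)" shows "openin \<Omega> {z \<in> topspace \<Omega>. z f \<noteq> 0}"
proof -
  have "openin \<Omega> {z \<in> topspace \<Omega>. z f \<in> - {0}}"
    by (rule openin_continuous_map_preimage[OF continuous_map_\<Omega>_coordinate[OF assms]]) auto
  then show ?thesis by simp
qed

text \<open>The point masses at the elements of an infinite conjugacy class are all equal, hence zero.\<close>

lemma icc_no_atoms:
  assumes \<mu>: "invariant_measure \<mu>" and icc: "icc G" and b: "b \<in> carrier G"
  shows "measure \<mu> {z \<in> topspace \<Omega>. z (delta (carrier G) b) \<noteq> 0} = 0"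
proof (cases "b = \<one>")
  case True
  \<comment> \<open>The ICC property says nothing about the class of the identity, but that point
    has been removed from the space.\<close>
  have "z (delta (carrier G) b) = 0" if "z \<in> topspace \<Omega>" for z
    using character_delta_nonzero[OF \<Omega>_characters[OF that], of \<one>] that True by (auto simp: topspace_\<Omega>)
  then have "{z \<in> topspace \<Omega>. z (delta (carrier G) b) \<noteq> 0} = {}" by blast
  then show ?thesis by (simp only: measure_empty)
next
  case False
  have P: "\<mu> \<in> Prob \<Omega>" using \<mu> by (auto simp: invariant_measure_def)
  interpret \<mu>: prob_space \<mu> using ProbD(1)[OF P] .
  define E where "E c = {z \<in> topspace \<Omega>. z (delta (carrier G) c) \<noteq> 0}" for c
  have EM: "E c \<in> sets (borel_on \<Omega>)" for c
    unfolding E_def by (intro openin_borel_on open_character_nonzero delta_ellinf)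
  have eq: "measure \<mu> (E (a \<otimes> b \<otimes> inv a)) = measure \<mu> (E b)" if a: "a \<in> carrier G" for a
  proof -
    have "stone_cech_ad G (inv a) -` E b \<inter> topspace \<Omega> = E (a \<otimes> b \<otimes> inv a)"
      using a b stone_cech_ad_\<Omega>[of "inv a"]
      by (auto simp: E_def stone_cech_ad_apply delta_ellinf conj_function_delta)
    then show ?thesis using invariant_measure_vimage[OF \<mu> _ EM, of "inv a" b] a by simp
  qed
  have disj: "E c \<inter> E d = {}" if "c \<noteq> d" "c \<in> carrier G" for c d
  proof -
    have "z (delta (carrier G) d) = 0" if "z \<in> E c" for z
    proof -
      have "z \<in> topspace \<Omega>" "z (delta (carrier G) c) \<noteq> 0" using that by (auto simp: E_def)
      then have "z = point_eval (ellinf (carrier G)) c"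
        using character_delta_nonzero[OF \<Omega>_characters] \<open>c \<in> carrier G\<close> by blast
      then show ?thesis using \<open>c \<noteq> d\<close> \<open>c \<in> carrier G\<close>
        by (simp add: point_eval_def delta_ellinf) (simp add: delta_def)
    qed
    then show ?thesis by (auto simp: E_def)
  qed
  show ?thesis
  proof (rule ccontr)
    assume "\<not> ?thesis"
    then have pos: "measure \<mu> (E b) > 0" using zero_less_measure_iff by (auto simp: E_def)
    \<comment> \<open>So many disjoint sets of equal mass, one for each of \<open>n\<close>
      conjugates of \<open>b\<close>, would have total mass above 1.\<close>
    then obtain n :: nat where n: "1 < real n * measure \<mu> (E b)" by (metis reals_Archimedean3)
    have "infinite ((\<lambda>a. a \<otimes> b \<otimes> inv a) ` carrier G)"
      using icc b False by (auto simp: icc_def)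
    then obtain S where S: "S \<subseteq> (\<lambda>a. a \<otimes> b \<otimes> inv a) ` carrier G" "finite S" "card S = n"
      by (meson infinite_arbitrarily_large)
    have "real n * measure \<mu> (E b) = (\<Sum>c\<in>S. measure \<mu> (E c))"
      using S eq by (subst sum.cong[OF refl, of S _ "\<lambda>_. measure \<mu> (E b)"]) auto
    also have "\<dots> = measure \<mu> (\<Union>c\<in>S. E c)"
    proof (rule \<mu>.finite_measure_finite_Union[symmetric, OF S(2)])
      show "E ` S \<subseteq> sets \<mu>" using EM ProbD(2)[OF P] by auto
      show "disjoint_family_on E S"
        unfolding disjoint_family_on_def using disj S(1) b by fastforce
    qed
    also have "\<dots> \<le> 1" by (rule \<mu>.prob_le_1)
    finally show False using n by simp
  qed
qed

end

section \<open>The part of the measure that lives over the boundary of a factor\<close>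

text \<open>One factor is treated at a time: \<open>p\<close> stands for the projection of
  \<open>\<Gamma>\<close> to it, and the cutoffs \<open>u\<close> exhaust it. Fixing a sequence
  describes the part over the boundary by countably many equations, which makes it
  measurable.\<close>

locale inner_amenable_projection = lcsc_group G T + Gam: group \<Gamma>
  for G :: "('a, 'm) monoid_scheme" (structure) and T :: "'a topology" and \<Gamma> :: "('b, 'k) monoid_scheme" +
  fixes p :: "'b \<Rightarrow> 'a" and \<mu> :: "(('b \<Rightarrow> complex) \<Rightarrow> complex) measure" and u :: "nat \<Rightarrow> 'a \<Rightarrow> real"
  assumes hom: "p \<in> hom \<Gamma> G"
    and invariant: "Gam.invariant_measure \<mu>"
    and u_Cc: "\<And>k. u k \<in> Cc T"
    and u_unit: "\<And>k x. x \<in> topspace T \<Longrightarrow> 0 \<le> u k x \<and> u k x \<le> 1"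
    and u_eventually: "\<And>K. compactin T K \<Longrightarrow> \<forall>\<^sub>F k in sequentially. \<forall>x\<in>K. u k x = 1"
begin

lemma p_carrier: "x \<in> carrier \<Gamma> \<Longrightarrow> p x \<in> carrier G"
  and p_mult: "x \<in> carrier \<Gamma> \<Longrightarrow> y \<in> carrier \<Gamma> \<Longrightarrow> p (x \<otimes>\<^bsub>\<Gamma>\<^esub> y) = p x \<otimes> p y"
  using hom by (auto simp: hom_def)

lemma p_inv: "x \<in> carrier \<Gamma> \<Longrightarrow> p (inv\<^bsub>\<Gamma>\<^esub> x) = inv (p x)"
  by (rule group_hom.hom_inv[of \<Gamma> G p]) (simp_all add: group_hom_def group_hom_axioms_def hom Gam.is_group)

definition uc :: "nat \<Rightarrow> 'a \<Rightarrow> complex" where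
  "uc k = (\<lambda>x\<in>topspace T. complex_of_real (u k x))"

definition pull :: "('a \<Rightarrow> complex) \<Rightarrow> 'b \<Rightarrow> complex" where
  "pull f = (\<lambda>x\<in>carrier \<Gamma>. f (p x))"

text \<open>\<open>B\<close> is the preimage of \<open>\<nu>\<^sup>uG\<close> under the extension \<open>\<pi>\<close> of \<open>p\<close> to \<open>\<Delta>\<^sub>\<beta>\<Gamma> - {e}\<close>, since the functions
  \<open>u k\<close> exhaust \<open>G\<close>; and \<open>q g z\<close> is the point \<open>g \<pi>(z)\<close>.\<close>

definition B :: "(('b \<Rightarrow> complex) \<Rightarrow> complex) set" where
  "B = {z \<in> topspace Gam.\<Omega>. \<forall>k. z (pull (uc k)) = 0}"

definition q :: "'a \<Rightarrow> (('b \<Rightarrow> complex) \<Rightarrow> complex) \<Rightarrow> ('a \<Rightarrow> complex) \<Rightarrow> complex" where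
  "q g z = (\<lambda>f\<in>Chu G T. z (pull (\<lambda>x\<in>carrier G. f (g \<otimes> x))))"

lemma uc_Cc: "uc k \<in> Cc T"
proof -
  obtain K where K: "compactin T K" "\<forall>x\<in>topspace T - K. u k x = 0" and "u k \<in> Cb T"
    using u_Cc[of k] by (auto simp: Cc_def)
  have "continuous_map T euclidean (\<lambda>x. complex_of_real (u k x))"
    using continuous_map_compose[OF Cb_continuous[OF \<open>u k \<in> Cb T\<close>], of euclidean complex_of_real]
    by (simp add: o_def continuous_on_of_real_id)
  then have "uc k \<in> Cb T"
    unfolding uc_def using u_unit[of _ k] by (intro restrict_Cb[where C = 1]) auto
  then show ?thesis
    using K by (auto simp: Cc_def uc_def)
qed

lemma pull_ellinf:
  assumes "f \<in> Cb T" shows "pull f \<in> ellinf (carrier \<Gamma>)"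
proof -
  obtain C where "\<And>x. x \<in> topspace T \<Longrightarrow> norm (f x) \<le> C" using Cb_bound[OF assms] by blast
  then show ?thesis
    unfolding pull_def by (intro ellinfI[where C = C]) (simp add: topspace_eq p_carrier)
qed

lemma Cc_Cb: "f \<in> Cc T \<Longrightarrow> f \<in> Cb T"
  by (simp add: Cc_def)

lemma C0_Cb: "f \<in> C0 T \<Longrightarrow> f \<in> Cb T"
  by (simp add: C0_def)

lemma B_characters: "z \<in> B \<Longrightarrow> z \<in> characters (carrier \<Gamma>) (ellinf (carrier \<Gamma>))"
  by (simp add: B_def Gam.\<Omega>_characters)

text \<open>Where \<open>f\<close> is not small some \<open>u k\<close> equals 1, so
  \<open>f\<close> is within \<open>\<epsilon>\<close> of \<open>f * u k\<close> in sup norm;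
  \<open>z\<close> kills this product by multiplicativity and is contractive. Consequently
  \<open>B\<close> does not depend on the choice of \<open>u\<close>.\<close>

lemma B_vanishes_C0:
  assumes z: "z \<in> B" and f: "f \<in> C0 T"
  shows "z (pull f) = 0"
proof -
  have zc: "z \<in> characters (carrier \<Gamma>) (ellinf (carrier \<Gamma>))" by (rule B_characters[OF z])
  note pf = pull_ellinf[OF C0_Cb[OF f]]
  have "norm (z (pull f)) \<le> \<epsilon>" if "\<epsilon> > 0" for \<epsilon>
  proof -
    obtain K where K: "compactin T K" "\<forall>x\<in>topspace T - K. norm (f x) < \<epsilon>"
      using f \<open>\<epsilon> > 0\<close> by (auto simp: C0_def)
    obtain k where k: "\<forall>x\<in>K. u k x = 1"
      using eventually_happens'[OF sequentially_bot u_eventually[OF K(1)]] by blast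
    note pu = pull_ellinf[OF Cc_Cb[OF uc_Cc[of k]]]
    have m: "(\<lambda>x\<in>carrier \<Gamma>. pull f x * pull (uc k) x) \<in> ellinf (carrier \<Gamma>)"
      using Cb_mult[OF pf pu] by simp
    have "norm (z (\<lambda>x\<in>carrier \<Gamma>. pull f x - (\<lambda>x\<in>carrier \<Gamma>. pull f x * pull (uc k) x) x)) \<le> \<epsilon>"
    proof (rule character_norm_le[OF zc])
      show "(\<lambda>x\<in>carrier \<Gamma>. pull f x - (\<lambda>x\<in>carrier \<Gamma>. pull f x * pull (uc k) x) x) \<in> ellinf (carrier \<Gamma>)"
        using Cb_add[OF pf Cb_mult[OF Cb_const[where T = "discrete_topology (carrier \<Gamma>)" and c = "- 1"] m]]
        by (simp cong: restrict_cong)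
      fix x assume x: "x \<in> carrier \<Gamma>"
      have px: "p x \<in> topspace T" using p_carrier[OF x] by (simp add: topspace_eq)
      have "norm (f (p x) - f (p x) * complex_of_real (u k (p x))) \<le> \<epsilon>"
      proof (cases "p x \<in> K")
        case True
        then show ?thesis using k \<open>\<epsilon> > 0\<close> by simp
      next
        case False
        have "norm (f (p x) - f (p x) * complex_of_real (u k (p x))) = norm (f (p x) * complex_of_real (1 - u k (p x)))"
          by (simp add: algebra_simps)
        also have "\<dots> = norm (f (p x)) * (1 - u k (p x))"
          unfolding norm_mult norm_of_real using u_unit[OF px, of k] by simp
        also have "\<dots> \<le> norm (f (p x)) * 1"
          using u_unit[OF px, of k] by (intro mult_left_mono) auto
        also have "\<dots> \<le> \<epsilon>" using K(2) False px by (simp add: less_imp_le)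
        finally show ?thesis .
      qed
      then show "norm ((\<lambda>x\<in>carrier \<Gamma>. pull f x - (\<lambda>x\<in>carrier \<Gamma>. pull f x * pull (uc k) x) x) x) \<le> \<epsilon>"
        using x px by (simp add: pull_def uc_def)
    qed
    moreover have "z (\<lambda>x\<in>carrier \<Gamma>. pull f x * pull (uc k) x) = 0"
      using charactersD(3)[OF zc pf pu] z by (simp add: B_def)
    ultimately show ?thesis
      using character_diff[OF zc pf m] by simp
  qed
  then have "norm (z (pull f)) \<le> 0" by (rule field_le_epsilon[of _ 0, simplified])
  then show ?thesis by simp
qed

lemma ltrans_Cb:
  assumes "f \<in> Chu G T" "g \<in> carrier G"
  shows "(\<lambda>x\<in>carrier G. f (g \<otimes> x)) \<in> Cb T"
  by (rule Chu_Cb[OF Chu_ltrans[OF assms]])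

text \<open>Removing the identity from the Stone-Cech space could destroy compactness. But the
  identity never satisfies the equations of \<open>B\<close>, since some \<open>u k\<close> is 1 at
  its projection, so nothing is removed from their compact solution set.\<close>

lemma compactin_B: "compactin Gam.\<Omega> B"
proof -
  let ?A = "ellinf (carrier \<Gamma>)"
  have ex: "\<exists>k. uc k \<one> = 1"
  proof -
    have "compactin T {\<one>}" by (simp add: topspace_eq)
    from eventually_happens'[OF sequentially_bot u_eventually[OF this]]
    obtain k where "u k \<one> = 1" by auto
    then show ?thesis by (intro exI[of _ k]) (simp add: uc_def topspace_eq)
  qed
  have p_one: "p \<one>\<^bsub>\<Gamma>\<^esub> = \<one>"
    using hom_one[OF hom Gam.is_group is_group] .
  have "point_eval ?A \<one>\<^bsub>\<Gamma>\<^esub> (pull (uc k)) = uc k \<one>" for k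
    using pull_ellinf[OF Cc_Cb[OF uc_Cc[of k]]] by (simp add: point_eval_def pull_def p_one)
  then have "B = {\<phi> \<in> characters (carrier \<Gamma>) ?A. \<forall>f\<in>range (\<lambda>k. pull (uc k)). \<phi> f = 0}"
    using ex unfolding B_def Gam.topspace_\<Omega> by fastforce
  moreover have "compactin (stone_cech (carrier \<Gamma>)) \<dots>"
    using pull_ellinf[OF Cc_Cb[OF uc_Cc]] by (intro compactin_characters_vanishing) auto
  ultimately have "compactin (stone_cech (carrier \<Gamma>)) B" by simp
  then show ?thesis
    unfolding stone_cech_minus_one_def compactin_subtopology
    by (auto simp: B_def Gam.topspace_\<Omega> stone_cech_def topspace_spectrum)
qed

lemma q_characters:
  assumes z: "z \<in> B" and g: "g \<in> carrier G"
  shows "q g z \<in> characters (carrier G) (Chu G T)"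
  unfolding characters_def
proof (intro CollectI conjI ballI allI)
  have zc: "z \<in> characters (carrier \<Gamma>) (ellinf (carrier \<Gamma>))" by (rule B_characters[OF z])
  let ?l = "\<lambda>f. pull (\<lambda>x\<in>carrier G. f (g \<otimes> x))"
  have l: "?l f \<in> ellinf (carrier \<Gamma>)" if "f \<in> Chu G T" for f
    by (rule pull_ellinf[OF ltrans_Cb[OF that g]])
  show "q g z \<in> extensional (Chu G T)" by (simp add: q_def)
  fix f assume f: "f \<in> Chu G T"
  show "q g z (\<lambda>x\<in>carrier G. c * f x) = c * q g z f" for c
  proof -
    have "?l (\<lambda>x\<in>carrier G. c * f x) = (\<lambda>x\<in>carrier \<Gamma>. c * ?l f x)"
      using g p_carrier by (auto simp: pull_def restrict_def)
    then show ?thesis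
      using f Chu_cmult[OF f] charactersD(2)[OF zc l[OF f]] by (simp add: q_def)
  qed
  fix f' assume f': "f' \<in> Chu G T"
  have "?l (\<lambda>x\<in>carrier G. f x + f' x) = (\<lambda>x\<in>carrier \<Gamma>. ?l f x + ?l f' x)"
    "?l (\<lambda>x\<in>carrier G. f x * f' x) = (\<lambda>x\<in>carrier \<Gamma>. ?l f x * ?l f' x)"
    using g p_carrier by (auto simp: pull_def restrict_def)
  then show "q g z (\<lambda>x\<in>carrier G. f x + f' x) = q g z f + q g z f'"
    "q g z (\<lambda>x\<in>carrier G. f x * f' x) = q g z f * q g z f'"
    using f f' Chu_add[OF f f'] Chu_mult[OF f f'] charactersD(1,3)[OF zc l[OF f] l[OF f']]
    by (simp_all add: q_def)
next
  have zc: "z \<in> characters (carrier \<Gamma>) (ellinf (carrier \<Gamma>))" by (rule B_characters[OF z])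
  have "pull (\<lambda>x\<in>carrier G. (\<lambda>x\<in>carrier G. 1) (g \<otimes> x)) = (\<lambda>x\<in>carrier \<Gamma>. 1)"
    using g p_carrier by (auto simp: pull_def restrict_def)
  then have "q g z (\<lambda>x\<in>carrier G. 1) = 1"
    using character_const[OF zc, of 1] Chu_const[of 1] by (simp add: q_def)
  then show "\<exists>f\<in>Chu G T. q g z f \<noteq> 0"
    using Chu_const[of 1] by force
qed

lemma topspace_nu: "topspace (nu G T) = characters (carrier G) (Chu G T) - point_eval (Chu G T) ` carrier G"
  by (auto simp: nu_def hu_def topspace_spectrum)

text \<open>Some \<open>u k\<close> is 1 at \<open>x\<close>, whereas its translate by
  \<open>g\<close> has compact support and is therefore killed by \<open>z\<close>; so
  \<open>q g z\<close> is not the evaluation at \<open>x\<close>.\<close>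

lemma q_nu:
  assumes z: "z \<in> B" and g: "g \<in> carrier G"
  shows "q g z \<in> topspace (nu G T)"
proof -
  have "q g z \<noteq> point_eval (Chu G T) x" if x: "x \<in> carrier G" for x
  proof -
    have "compactin T {x}" using x by (simp add: topspace_eq)
    from eventually_happens'[OF sequentially_bot u_eventually[OF this]]
    obtain k where "u k x = 1" by auto
    then have ux: "uc k x = 1" using x by (simp add: uc_def topspace_eq)
    have "(\<lambda>x\<in>carrier G. uc k (g \<otimes> x)) \<in> C0 T"
      using Cc_ltrans[OF uc_Cc g] Cc_subset_C0 by blast
    then have "q g z (uc k) = 0"
      using B_vanishes_C0[OF z] Cc_Chu[OF uc_Cc] by (simp add: q_def)
    moreover have "point_eval (Chu G T) x (uc k) = 1"
      using ux Cc_Chu[OF uc_Cc] by (simp add: point_eval_def)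
    ultimately show ?thesis by auto
  qed
  then show ?thesis
    using q_characters[OF z g] by (auto simp: topspace_nu)
qed

lemma continuous_map_into_nu:
  assumes "\<And>f. f \<in> Chu G T \<Longrightarrow> continuous_map Z euclidean (\<lambda>z. h z f)"
    and "\<And>z. z \<in> topspace Z \<Longrightarrow> h z \<in> topspace (nu G T)"
  shows "continuous_map Z (nu G T) h"
proof -
  have h: "h z \<in> characters (carrier G) (Chu G T)" "h z \<notin> point_eval (Chu G T) ` carrier G"
    if "z \<in> topspace Z" for z
    using assms(2)[OF that] by (simp_all add: topspace_nu)
  have "h ` topspace Z \<subseteq> extensional (Chu G T)"
    using charactersD(4)[OF h(1)] by blast
  then have "continuous_map Z (product_topology (\<lambda>_. euclidean) (Chu G T)) h"
    unfolding continuous_map_componentwise using assms(1) by blast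
  then show ?thesis
    unfolding nu_def hu_def
    using h by (auto simp: continuous_map_in_subtopology spectrum_def characters_def PiE_def)
qed

lemma topspace_B: "topspace (subtopology Gam.\<Omega> B) = B"
  by (auto simp: B_def)

lemma continuous_map_q:
  assumes g: "g \<in> carrier G"
  shows "continuous_map (subtopology Gam.\<Omega> B) (nu G T) (q g)"
proof (rule continuous_map_into_nu)
  fix f assume f: "f \<in> Chu G T"
  show "continuous_map (subtopology Gam.\<Omega> B) euclidean (\<lambda>z. q g z f)"
    using f pull_ellinf[OF ltrans_Cb[OF f g]]
    by (simp add: q_def continuous_map_from_subtopology Gam.continuous_map_\<Omega>_coordinate)
qed (use q_nu g in \<open>simp add: topspace_B\<close>)

lemma hu_left_action_q:
  assumes g: "g \<in> carrier G" and z: "z \<in> B"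
  shows "hu_left_action G T g (q \<one> z) = q g z"
proof -
  have *: "pull (\<lambda>x\<in>carrier G. (\<lambda>x\<in>carrier G. f (g \<otimes> x)) (\<one> \<otimes> x)) = pull (\<lambda>x\<in>carrier G. f (g \<otimes> x))" for f
    using p_carrier by (auto simp: pull_def restrict_def)
  show ?thesis
    unfolding hu_left_action_def spectrum_map_def q_def
  proof (rule restrict_ext)
    fix f assume f: "f \<in> Chu G T"
    show "(\<lambda>f\<in>Chu G T. z (pull (\<lambda>x\<in>carrier G. f (\<one> \<otimes> x)))) (\<lambda>x\<in>carrier G. f (g \<otimes> x)) =
        z (pull (\<lambda>x\<in>carrier G. f (g \<otimes> x)))"
      by (subst restrict_apply'[OF Chu_ltrans[OF f g]]) (simp only: *)
  qed
qed

lemma conj_function_pull: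
  assumes "\<gamma> \<in> carrier \<Gamma>"
  shows "Gam.conj_function \<gamma> (pull f) = pull (\<lambda>x\<in>carrier G. f (p \<gamma> \<otimes> x \<otimes> inv (p \<gamma>)))"
  using assms by (auto simp: Gam.conj_function_def pull_def restrict_def p_mult p_inv p_carrier)

lemma Cc_conj:
  assumes "f \<in> Cc T" "g \<in> carrier G"
  shows "(\<lambda>x\<in>carrier G. f (g \<otimes> x \<otimes> inv g)) \<in> Cc T"
proof -
  have "(\<lambda>x\<in>carrier G. rtrans G (inv g) f (g \<otimes> x)) \<in> Cc T"
    using Cc_ltrans[OF Cc_rtrans[OF assms(1), of "inv g"] assms(2)] assms(2) by simp
  then show ?thesis using assms(2) by (simp add: rtrans_def cong: restrict_cong)
qed

text \<open>Conjugation by \<open>p \<gamma>\<close> preserves compactly supported functions, and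
  points of \<open>B\<close> kill all of these, not only the cutoffs.\<close>

lemma ad_in_B:
  assumes \<gamma>: "\<gamma> \<in> carrier \<Gamma>" and z: "z \<in> topspace Gam.\<Omega>"
  shows "stone_cech_ad \<Gamma> \<gamma> z \<in> B \<longleftrightarrow> z \<in> B"
proof
  have ad: "stone_cech_ad \<Gamma> \<gamma> z (pull f) = z (pull (\<lambda>x\<in>carrier G. f (p \<gamma> \<otimes> x \<otimes> inv (p \<gamma>))))"
    if "f \<in> Cc T" for f
    using Gam.stone_cech_ad_apply[OF pull_ellinf[OF Cc_Cb[OF that]]] conj_function_pull[OF \<gamma>] by simp
  note pg = p_carrier[OF \<gamma>]
  show "stone_cech_ad \<Gamma> \<gamma> z \<in> B" if zB: "z \<in> B"
  proof -
    have "stone_cech_ad \<Gamma> \<gamma> z (pull (uc k)) = 0" for k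
      unfolding ad[OF uc_Cc] using B_vanishes_C0[OF zB] Cc_conj[OF uc_Cc pg] Cc_subset_C0 by blast
    then show ?thesis using Gam.stone_cech_ad_\<Omega>[OF \<gamma> z] by (simp add: B_def)
  qed
  show "z \<in> B" if aB: "stone_cech_ad \<Gamma> \<gamma> z \<in> B"
  proof -
    have "z (pull (uc k)) = 0" for k
    proof -
      \<comment> \<open>The cutoff is conjugated backwards, so that conjugation by
        \<open>p \<gamma>\<close> returns it.\<close>
      let ?f = "\<lambda>x\<in>carrier G. uc k (inv (p \<gamma>) \<otimes> x \<otimes> inv (inv (p \<gamma>)))"
      have f: "?f \<in> Cc T" using Cc_conj[OF uc_Cc, of "inv (p \<gamma>)"] pg by simp
      have "inv (p \<gamma>) \<otimes> (p \<gamma> \<otimes> x \<otimes> inv (p \<gamma>)) \<otimes> p \<gamma> = x" if "x \<in> carrier G" for x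
        using pg that by (simp add: m_assoc) (simp add: m_assoc[symmetric])
      then have "pull (\<lambda>x\<in>carrier G. ?f (p \<gamma> \<otimes> x \<otimes> inv (p \<gamma>))) = pull (uc k)"
        using pg p_carrier by (auto simp: pull_def restrict_def)
      then have "z (pull (uc k)) = stone_cech_ad \<Gamma> \<gamma> z (pull ?f)"
        using ad[OF f] by simp
      also have "\<dots> = 0" using B_vanishes_C0[OF aB] f Cc_subset_C0 by blast
      finally show ?thesis .
    qed
    then show ?thesis using z by (simp add: B_def)
  qed
qed

text \<open>The right action of \<open>G\<close> on the boundary is trivial, so that conjugation acts there as left
  translation.\<close>

lemma q_ad:
  assumes \<gamma>: "\<gamma> \<in> carrier \<Gamma>" and z: "z \<in> B"
  shows "q \<one> (stone_cech_ad \<Gamma> \<gamma> z) = q (p \<gamma>) z"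
proof (rule extensionalityI[where A = "Chu G T"])
  fix f assume f: "f \<in> Chu G T"
  have zc: "z \<in> characters (carrier \<Gamma>) (ellinf (carrier \<Gamma>))" by (rule B_characters[OF z])
  let ?g = "p \<gamma>"
  have g: "?g \<in> carrier G" by (rule p_carrier[OF \<gamma>])
  \<comment> \<open>This is the defining property of \<open>Chu\<close> for the right translation by
    the inverse. Left translation by \<open>p \<gamma>\<close> turns the difference into that of the
    conjugated and the left translated function, still vanishing at infinity and hence killed by
    \<open>z\<close>.\<close>
  have "(\<lambda>x\<in>carrier G. rtrans G (inv ?g) f x - f x) \<in> C0 T"
    using f g by (simp add: Chu_def)
  from C0_ltrans[OF this g] have d: "(\<lambda>x\<in>carrier G. f (?g \<otimes> x \<otimes> inv ?g) - f (?g \<otimes> x)) \<in> C0 T"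
    using g by (simp add: rtrans_def cong: restrict_cong)
  have one: "pull (\<lambda>x\<in>carrier G. f (\<one> \<otimes> x)) = pull f"
    using p_carrier by (auto simp: pull_def restrict_def)
  have pf: "pull f \<in> ellinf (carrier \<Gamma>)" by (rule pull_ellinf[OF Chu_Cb[OF f]])
  have c: "pull (\<lambda>x\<in>carrier G. f (?g \<otimes> x \<otimes> inv ?g)) \<in> ellinf (carrier \<Gamma>)"
    using Gam.conj_function_ellinf[OF \<gamma> pf] conj_function_pull[OF \<gamma>] by simp
  have l: "pull (\<lambda>x\<in>carrier G. f (?g \<otimes> x)) \<in> ellinf (carrier \<Gamma>)"
    by (rule pull_ellinf[OF ltrans_Cb[OF f g]])
  have "(\<lambda>x\<in>carrier \<Gamma>. pull (\<lambda>x\<in>carrier G. f (?g \<otimes> x \<otimes> inv ?g)) x - pull (\<lambda>x\<in>carrier G. f (?g \<otimes> x)) x)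
      = pull (\<lambda>x\<in>carrier G. f (?g \<otimes> x \<otimes> inv ?g) - f (?g \<otimes> x))"
    using p_carrier by (auto simp: pull_def restrict_def)
  then have "z (pull (\<lambda>x\<in>carrier G. f (?g \<otimes> x \<otimes> inv ?g))) = z (pull (\<lambda>x\<in>carrier G. f (?g \<otimes> x)))"
    using character_diff[OF zc c l] B_vanishes_C0[OF z d] by simp
  then show "q \<one> (stone_cech_ad \<Gamma> \<gamma> z) f = q ?g z f"
    using f by (simp add: q_def one Gam.stone_cech_ad_apply[OF pf] conj_function_pull[OF \<gamma>])
qed (simp_all add: q_def)

text \<open>Conditioning on \<open>B\<close> gives mass one when \<open>B\<close> is not null.
  Taking \<open>B\<close> itself as the underlying space makes \<open>q g\<close> take values in the
  boundary everywhere, not only almost everywhere.\<close>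

definition M :: "(('b \<Rightarrow> complex) \<Rightarrow> complex) measure" where
  "M = restrict_space (uniform_measure \<mu> B) B"

lemma \<mu>_Prob: "\<mu> \<in> Prob Gam.\<Omega>"
  using invariant by (simp add: Gam.invariant_measure_def)

lemma B_sets: "B \<in> sets \<mu>"
proof -
  have "B = topspace Gam.\<Omega> - (\<Union>k. {z \<in> topspace Gam.\<Omega>. z (pull (uc k)) \<noteq> 0})"
    by (auto simp: B_def)
  also have "\<dots> \<in> sets (borel_on Gam.\<Omega>)"
    using openin_borel_on[OF Gam.open_character_nonzero[OF pull_ellinf[OF Cc_Cb[OF uc_Cc]]]]
    by (intro sets.compl_sets[of _ "borel_on Gam.\<Omega>", unfolded space_borel_on] sets.countable_UN) auto
  finally show ?thesis using ProbD(2)[OF \<mu>_Prob] by simp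
qed

lemma space_M: "space M = B"
  using sets.sets_into_space[OF B_sets] by (auto simp: M_def space_restrict_space)

lemma sets_M: "sets M = {A \<in> sets \<mu>. A \<subseteq> B}"
  using sets.sets_into_space[OF B_sets] B_sets
  by (auto simp: M_def sets_restrict_space_iff inf_absorb1)

lemma emeasure_M: "A \<in> sets \<mu> \<Longrightarrow> A \<subseteq> B \<Longrightarrow> emeasure M A = emeasure \<mu> A / emeasure \<mu> B"
  unfolding M_def using B_sets by (subst emeasure_restrict_space) (auto simp: inf_absorb2)

lemma prob_space_M:
  assumes pos: "measure \<mu> B > 0" shows "prob_space M"
proof
  interpret \<mu>: prob_space \<mu> using ProbD(1)[OF \<mu>_Prob] .
  have "emeasure \<mu> B / emeasure \<mu> B = 1"
    using pos by (simp add: \<mu>.emeasure_eq_measure divide_ennreal)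
  then show "emeasure M (space M) = 1"
    using emeasure_M[OF B_sets] by (simp add: space_M)
qed

lemma continuous_measurable_M:
  fixes h :: "_ \<Rightarrow> real"
  assumes "continuous_map (subtopology Gam.\<Omega> B) euclidean h"
  shows "h \<in> borel_measurable M"
proof (rule borel_measurableI)
  fix S :: "real set" assume "open S"
  then have "openin (subtopology Gam.\<Omega> B) {z \<in> B. h z \<in> S}"
    using openin_continuous_map_preimage[OF assms, of S] unfolding topspace_B by simp
  then obtain U where "openin Gam.\<Omega> U" "{z \<in> B. h z \<in> S} = U \<inter> B"
    unfolding openin_subtopology by blast
  moreover have "h -` S \<inter> space M = {z \<in> B. h z \<in> S}" by (auto simp: space_M)
  ultimately show "h -` S \<inter> space M \<in> sets M"
    using B_sets openin_borel_on[of Gam.\<Omega> U] ProbD(2)[OF \<mu>_Prob] by (auto simp: sets_M)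
qed

text \<open>Since the adjoint action preserves \<open>B\<close>, preimages inside \<open>B\<close>
  agree with preimages in the whole space, where \<open>\<mu>\<close> is invariant; the normalizing
  factor is the same on both sides.\<close>

lemma distr_M_ad:
  assumes \<gamma>: "\<gamma> \<in> carrier \<Gamma>"
  shows "stone_cech_ad \<Gamma> \<gamma> \<in> M \<rightarrow>\<^sub>M M" "distr M M (stone_cech_ad \<Gamma> \<gamma>) = M"
proof -
  let ?a = "stone_cech_ad \<Gamma> \<gamma>"
  interpret \<mu>: prob_space \<mu> using ProbD(1)[OF \<mu>_Prob] .
  have vim: "?a -` A \<inter> space M = ?a -` A \<inter> topspace Gam.\<Omega>" if "A \<subseteq> B" for A
    using that ad_in_B[OF \<gamma>] by (auto simp: space_M B_def)
  have am: "?a \<in> borel_on Gam.\<Omega> \<rightarrow>\<^sub>M borel_on Gam.\<Omega>"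
    by (rule continuous_map_measurable_borel_on[OF Gam.continuous_map_stone_cech_ad[OF \<gamma>]])
  have vim_sets: "?a -` A \<inter> space M \<in> sets \<mu>" "?a -` A \<inter> space M \<subseteq> B" if "A \<in> sets M" for A
    using measurable_sets[OF am, of A] that ProbD(2)[OF \<mu>_Prob] by (auto simp: vim sets_M) (auto simp: ad_in_B[OF \<gamma>])
  show meas: "?a \<in> M \<rightarrow>\<^sub>M M"
  proof (rule measurableI)
    show "?a z \<in> space M" if "z \<in> space M" for z
      using that ad_in_B[OF \<gamma>] by (auto simp: space_M B_def)
    show "?a -` A \<inter> space M \<in> sets M" if "A \<in> sets M" for A
      using vim_sets[OF that] by (simp add: sets_M)
  qed
  show "distr M M ?a = M"
  proof (rule measure_eqI)
    fix A assume "A \<in> sets (distr M M ?a)"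
    then have A: "A \<in> sets M" by simp
    then have A': "A \<in> sets \<mu>" "A \<subseteq> B" by (auto simp: sets_M)
    have "emeasure (distr M M ?a) A = emeasure M (?a -` A \<inter> space M)"
      by (rule emeasure_distr[OF meas A])
    also have "\<dots> = emeasure \<mu> (?a -` A \<inter> topspace Gam.\<Omega>) / emeasure \<mu> B"
      using emeasure_M[OF vim_sets[OF A]] vim[OF A'(2)] by simp
    also have "emeasure \<mu> (?a -` A \<inter> topspace Gam.\<Omega>) = emeasure \<mu> A"
      using Gam.invariant_measure_vimage[OF invariant \<gamma>, of A] A'(1) ProbD(2)[OF \<mu>_Prob]
      by (simp add: \<mu>.emeasure_eq_measure)
    also have "emeasure \<mu> A / emeasure \<mu> B = emeasure M A"
      using emeasure_M[OF A'] by simp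
    finally show "emeasure (distr M M ?a) A = emeasure M A" .
  qed simp
qed

lemma continuous_map_comp_q:
  assumes "continuous_map (nu G T) euclidean h" "g \<in> carrier G"
  shows "continuous_map (subtopology Gam.\<Omega> B) euclidean (\<lambda>z. h (q g z))"
  using continuous_map_compose[OF continuous_map_q[OF assms(2)] assms(1)] by (simp add: o_def)

section \<open>Invariance under the projection and under its closure\<close>

lemma integral_q_projection:
  fixes h :: "_ \<Rightarrow> real"
  assumes h: "continuous_map (nu G T) euclidean h" and g: "g \<in> p ` carrier \<Gamma>"
  shows "(\<integral>z. h (q g z) \<partial>M) = (\<integral>z. h (q \<one> z) \<partial>M)"
proof -
  obtain \<gamma> where \<gamma>: "\<gamma> \<in> carrier \<Gamma>" "g = p \<gamma>" using g by blast
  have "(\<integral>z. h (q \<one> z) \<partial>M) = (\<integral>z. h (q \<one> z) \<partial>distr M M (stone_cech_ad \<Gamma> \<gamma>))"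
    using distr_M_ad(2)[OF \<gamma>(1)] by simp
  also have "\<dots> = (\<integral>z. h (q \<one> (stone_cech_ad \<Gamma> \<gamma> z)) \<partial>M)"
    by (rule integral_distr[OF distr_M_ad(1)[OF \<gamma>(1)] continuous_measurable_M[OF continuous_map_comp_q[OF h one_closed]]])
  also have "\<dots> = (\<integral>z. h (q g z) \<partial>M)"
    using q_ad[OF \<gamma>(1)] \<gamma>(2) by (intro Bochner_Integration.integral_cong) (auto simp: space_M)
  finally show ?thesis by simp
qed

text \<open>The translates of \<open>f\<close> by \<open>s k\<close> converge in sup norm to the
  translate by \<open>g\<close>, and \<open>z\<close> is contractive, so every coordinate
  converges.\<close>

lemma limitin_q:
  assumes z: "z \<in> B" and s: "\<And>k. s k \<in> carrier G" and lim: "limitin T s g sequentially"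
  shows "limitin (nu G T) (\<lambda>k. q (s k) z) (q g z) sequentially"
proof -
  have g: "g \<in> carrier G" using limitin_topspace[OF lim] by (simp add: topspace_eq)
  have zc: "z \<in> characters (carrier \<Gamma>) (ellinf (carrier \<Gamma>))" by (rule B_characters[OF z])
  have coord: "(\<lambda>k. q (s k) z f) \<longlonglongrightarrow> q g z f" if f: "f \<in> Chu G T" for f
    unfolding tendsto_iff
  proof (intro allI impI)
    fix \<epsilon> :: real assume "\<epsilon> > 0"
    then have "\<epsilon> / 2 > 0" by simp
    moreover have "g \<in> topspace T" using g by (simp add: topspace_eq)
    ultimately obtain S where S: "openin T S" "g \<in> S"
      "\<forall>h\<in>S. \<forall>x\<in>carrier G. norm (f (h \<otimes> x) - f (g \<otimes> x)) < \<epsilon> / 2"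
      using Chu_left_uniformly_continuous[OF f g] unfolding eventually_nhdsin by meson
    have "\<forall>\<^sub>F k in sequentially. s k \<in> S"
      using limitinD[OF lim S(1,2)] .
    then show "\<forall>\<^sub>F k in sequentially. dist (q (s k) z f) (q g z f) < \<epsilon>"
    proof eventually_elim
      case (elim k)
      let ?l = "\<lambda>g. pull (\<lambda>x\<in>carrier G. f (g \<otimes> x))"
      have l: "?l (s k) \<in> ellinf (carrier \<Gamma>)" "?l g \<in> ellinf (carrier \<Gamma>)"
        using pull_ellinf[OF ltrans_Cb[OF f]] s g by auto
      have "norm (z (\<lambda>x\<in>carrier \<Gamma>. ?l (s k) x - ?l g x)) \<le> \<epsilon> / 2"
      proof (rule character_norm_le[OF zc])
        have b: "norm (?l (s k) x - ?l g x) \<le> \<epsilon> / 2" if "x \<in> carrier \<Gamma>" for x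
          using S(3) elim p_carrier[OF that] that by (auto simp: pull_def intro: less_imp_le)
        show "(\<lambda>x\<in>carrier \<Gamma>. ?l (s k) x - ?l g x) \<in> ellinf (carrier \<Gamma>)"
          by (rule ellinfI[OF b])
        show "norm ((\<lambda>x\<in>carrier \<Gamma>. ?l (s k) x - ?l g x) x) \<le> \<epsilon> / 2" if "x \<in> carrier \<Gamma>" for x
          using b[OF that] that by simp
      qed
      then show ?case
        using character_diff[OF zc l] f \<open>\<epsilon> > 0\<close> by (simp add: q_def dist_norm)
    qed
  qed
  have "limitin (product_topology (\<lambda>_. euclidean) (Chu G T)) (\<lambda>k. q (s k) z) (q g z) sequentially"
    unfolding limitin_componentwise using coord by (auto simp: q_def)
  moreover have "q (s k) z \<in> topspace (nu G T)" "q g z \<in> topspace (nu G T)" for k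
    using q_nu[OF z] s g by auto
  ultimately show ?thesis
    unfolding nu_def hu_def spectrum_def limitin_subtopology
    by (auto simp: characters_def PiE_def)
qed

text \<open>Dominated convergence works along sequences, and second countability makes
  \<open>g\<close> the limit of a sequence in the projection. Boundedness of \<open>h\<close>
  provides the dominating constant.\<close>

lemma integral_q_closure:
  fixes h :: "_ \<Rightarrow> real"
  assumes pos: "measure \<mu> B > 0" and h: "continuous_map (nu G T) euclidean h" and bd: "bounded (h ` topspace (nu G T))"
    and g: "g \<in> T closure_of (p ` carrier \<Gamma>)"
  shows "(\<integral>z. h (q g z) \<partial>M) = (\<integral>z. h (q \<one> z) \<partial>M)"
proof -
  interpret M: prob_space M by (rule prob_space_M[OF pos])
  have gG: "g \<in> carrier G" using closure_of_subset_topspace[of T] g by (auto simp: topspace_eq)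
  obtain \<B> where \<B>: "countable \<B>" "\<And>V. V \<in> \<B> \<Longrightarrow> openin T V"
    "\<And>W x. openin T W \<Longrightarrow> x \<in> W \<Longrightarrow> \<exists>V\<in>\<B>. x \<in> V \<and> V \<subseteq> W"
    using second_countable unfolding second_countable_space_def by metis
  define \<C> where "\<C> = {V \<in> \<B>. g \<in> V}"
  have "\<C> \<noteq> {}" using \<B>(3)[OF openin_topspace, of g] gG by (auto simp: \<C>_def topspace_eq)
  moreover have "countable \<C>" using \<B>(1) by (auto simp: \<C>_def)
  ultimately obtain V :: "nat \<Rightarrow> 'a set" where V: "range V = \<C>"
    using range_from_nat_into[of \<C>] by blast
  have VC: "openin T (V l)" "g \<in> V l" for l
  proof -
    have "V l \<in> \<C>" using V by blast
    then show "openin T (V l)" "g \<in> V l" using \<B>(2) by (auto simp: \<C>_def)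
  qed
  \<comment> \<open>Intersecting the first \<open>k + 1\<close> members of an enumerated base at
    \<open>g\<close> makes the chosen points converge even if the enumeration is not
    decreasing.\<close>
  have "\<exists>y. y \<in> p ` carrier \<Gamma> \<and> y \<in> (\<Inter>l\<le>k. V l)" for k
  proof -
    have "openin T (\<Inter>l\<le>k. V l)" "g \<in> (\<Inter>l\<le>k. V l)" using VC by auto
    then show ?thesis using g unfolding in_closure_of by blast
  qed
  then obtain s where s: "\<And>k. s k \<in> p ` carrier \<Gamma>" "\<And>k. s k \<in> (\<Inter>l\<le>k. V l)" by metis
  have sG: "s k \<in> carrier G" for k using s(1)[of k] p_carrier by auto
  have lim: "limitin T s g sequentially"
    unfolding limitin_def
  proof (intro conjI allI impI)
    show "g \<in> topspace T" using gG by (simp add: topspace_eq)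
    fix U assume "openin T U \<and> g \<in> U"
    then obtain W where "W \<in> \<B>" "g \<in> W" "W \<subseteq> U" using \<B>(3) by blast
    then have "W \<in> \<C>" by (simp add: \<C>_def)
    then obtain l where "W = V l" using V by blast
    then have "s k \<in> U" if "l \<le> k" for k using s(2)[of k] that \<open>W \<subseteq> U\<close> by auto
    then show "\<forall>\<^sub>F k in sequentially. s k \<in> U" using eventually_sequentially by blast
  qed
  obtain C where C: "\<And>y. y \<in> topspace (nu G T) \<Longrightarrow> norm (h y) \<le> C"
    using bd unfolding bounded_iff by auto
  have "(\<lambda>k. \<integral>z. h (q (s k) z) \<partial>M) \<longlonglongrightarrow> (\<integral>z. h (q g z) \<partial>M)"
  proof (rule integral_dominated_convergence[where w = "\<lambda>_. C"])
    show "AE z in M. (\<lambda>k. h (q (s k) z)) \<longlonglongrightarrow> h (q g z)"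
      using continuous_map_limit[OF h limitin_q[OF _ sG lim]]
      by (intro AE_I2) (simp add: space_M o_def)
    show "AE z in M. norm (h (q (s k) z)) \<le> C" for k
      using C q_nu[OF _ sG] by (intro AE_I2) (simp add: space_M)
  qed (use continuous_measurable_M[OF continuous_map_comp_q[OF h]] gG sG in auto)
  moreover have "(\<integral>z. h (q (s k) z) \<partial>M) = (\<integral>z. h (q \<one> z) \<partial>M)" for k
    by (rule integral_q_projection[OF h s(1)])
  ultimately show ?thesis
    by (simp add: LIMSEQ_const_iff)
qed

text \<open>The compact set for the equivariance estimate is the image of \<open>B\<close> under
  \<open>q \<one>\<close>. Elements of the closure act on its points through \<open>q g\<close>,
  whose integrals have just been seen not to depend on \<open>g\<close>.\<close>

lemma boundary_mean:
  assumes bi: "bi_exact G T" and pos: "measure \<mu> B > 0"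
    and H: "H \<subseteq> T closure_of (p ` carrier \<Gamma>)"
  shows "\<exists>\<Phi>. invariant_Borel_mean G T H \<Phi>"
proof (rule amenable_action_invariant_mean)
  show "topologically_amenable G T (nu G T) (hu_left_action G T)"
    using bi by (simp add: bi_exact_def)
  show "prob_space M" by (rule prob_space_M[OF pos])
  show "compactin (nu G T) (q \<one> ` B)"
    by (rule image_compactin[OF _ continuous_map_q[OF one_closed]])
      (simp add: compactin_subtopology compactin_B)
  show "q \<one> z \<in> q \<one> ` B" if "z \<in> space M" for z using that by (simp add: space_M)
  show HG: "H \<subseteq> carrier G"
    using H closure_of_subset_topspace[of T] by (auto simp: topspace_eq)
  show "hu_left_action G T g (q \<one> z) \<in> topspace (nu G T)" if "g \<in> H" "z \<in> space M" for g z
    using that HG by (simp add: space_M hu_left_action_q q_nu subset_iff)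
  show "(\<lambda>z. h (q \<one> z)) \<in> borel_measurable M" if "continuous_map (nu G T) euclidean h" for h :: "_ \<Rightarrow> real"
    by (rule continuous_measurable_M[OF continuous_map_comp_q[OF that one_closed]])
  show "(\<lambda>z. h (hu_left_action G T g (q \<one> z))) \<in> borel_measurable M"
    if "g \<in> H" "continuous_map (nu G T) euclidean h" for g and h :: "_ \<Rightarrow> real"
  proof (rule measurable_cong[THEN iffD1])
    show "(\<lambda>z. h (q g z)) \<in> borel_measurable M"
      using that HG by (intro continuous_measurable_M[OF continuous_map_comp_q[OF that(2)]]) auto
    show "h (q g z) = h (hu_left_action G T g (q \<one> z))" if "z \<in> space M" for z
      using that \<open>g \<in> H\<close> HG by (simp add: space_M hu_left_action_q subset_iff)
  qed
  show "(\<integral>z. h (hu_left_action G T g (q \<one> z)) \<partial>M) = (\<integral>z. h (q \<one> z) \<partial>M)"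
    if "g \<in> H" "continuous_map (nu G T) euclidean h" "bounded (h ` topspace (nu G T))" for g and h :: "_ \<Rightarrow> real"
  proof -
    have "(\<integral>z. h (hu_left_action G T g (q \<one> z)) \<partial>M) = (\<integral>z. h (q g z) \<partial>M)"
      using that HG by (intro Bochner_Integration.integral_cong) (auto simp: space_M hu_left_action_q)
    also have "\<dots> = (\<integral>z. h (q \<one> z) \<partial>M)"
      using that H by (intro integral_q_closure[OF pos]) auto
    finally show ?thesis .
  qed
qed

end

section \<open>Discrete subgroups of products\<close>

lemma character_prod:
  assumes \<phi>: "\<phi> \<in> characters X (ellinf X)" and "finite I"
  shows "(\<And>i. i \<in> I \<Longrightarrow> f i \<in> ellinf X) \<Longrightarrow>
    (\<lambda>x\<in>X. \<Prod>i\<in>I. f i x) \<in> ellinf X \<and> \<phi> (\<lambda>x\<in>X. \<Prod>i\<in>I. f i x) = (\<Prod>i\<in>I. \<phi> (f i))"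
  using \<open>finite I\<close>
proof (induction I rule: finite_induct)
  case empty
  have "(\<lambda>x\<in>X. 1) \<in> ellinf X" by (rule ellinfI[where C = 1]) simp
  then show ?case unfolding prod.empty using character_const[OF \<phi>] by (intro conjI)
next
  case (insert i I)
  let ?g = "\<lambda>x\<in>X. \<Prod>i\<in>I. f i x"
  have g: "?g \<in> ellinf X" "\<phi> ?g = (\<Prod>i\<in>I. \<phi> (f i))" and fi: "f i \<in> ellinf X"
    using insert.IH insert.prems by blast+
  have eq: "(\<lambda>x\<in>X. \<Prod>i\<in>insert i I. f i x) = (\<lambda>x\<in>X. f i x * ?g x)"
    using insert.hyps by (auto simp: restrict_def)
  have "(\<lambda>x\<in>X. f i x * ?g x) \<in> ellinf X"
    using Cb_mult[OF fi g(1)] by simp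
  moreover have "\<phi> (\<lambda>x\<in>X. f i x * ?g x) = (\<Prod>i\<in>insert i I. \<phi> (f i))"
    unfolding charactersD(3)[OF \<phi> fi g(1)] g(2) prod.insert[OF insert.hyps] ..
  ultimately show ?case unfolding eq by (rule conjI)
qed

lemma continuous_map_product_group_mult_inv:
  assumes lcsc: "\<And>i. i \<in> I \<Longrightarrow> lcsc_group (G i) (T i)"
  shows "continuous_map (prod_topology (product_topology T I) (product_topology T I)) (product_topology T I)
    (\<lambda>(a, b). a \<otimes>\<^bsub>product_group I G\<^esub> inv\<^bsub>product_group I G\<^esub> b)"
proof -
  let ?P = "product_topology T I"
  have grp: "group (G i)" if "i \<in> I" for i using lcsc[OF that] by (simp add: lcsc_group_def)
  have top: "topspace (T i) = carrier (G i)" if "i \<in> I" for i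
    using lcsc_group.topspace_eq[OF lcsc[OF that]] .
  have "continuous_map (prod_topology ?P ?P) ?P (\<lambda>p. \<lambda>i\<in>I. fst p i \<otimes>\<^bsub>G i\<^esub> inv\<^bsub>G i\<^esub> snd p i)"
    unfolding continuous_map_componentwise
  proof (intro conjI ballI)
    fix i assume i: "i \<in> I"
    have "continuous_map (prod_topology ?P ?P) (prod_topology (T i) (T i)) (\<lambda>p. (fst p i, snd p i))"
      using continuous_map_compose[OF continuous_map_fst continuous_map_product_coordinates[OF i]]
        continuous_map_compose[OF continuous_map_snd continuous_map_product_coordinates[OF i]]
      by (intro continuous_map_pairedI) (simp_all add: o_def)
    from continuous_map_compose[OF this lcsc_group.continuous_map_mult_inv[OF lcsc[OF i]]]
    show "continuous_map (prod_topology ?P ?P) (T i)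
        (\<lambda>p. (\<lambda>i\<in>I. fst p i \<otimes>\<^bsub>G i\<^esub> inv\<^bsub>G i\<^esub> snd p i) i)"
      using i by (simp add: o_def)
  qed auto
  then show ?thesis
  proof (rule continuous_map_eq)
    fix p assume "p \<in> topspace (prod_topology ?P ?P)"
    then have "snd p \<in> (\<Pi>\<^sub>E i\<in>I. carrier (G i))"
      using top by (auto simp: PiE_iff)
    from inv_product_group[OF this grp]
    show "(\<lambda>i\<in>I. fst p i \<otimes>\<^bsub>G i\<^esub> inv\<^bsub>G i\<^esub> snd p i) =
        (case p of (a, b) \<Rightarrow> a \<otimes>\<^bsub>product_group I G\<^esub> inv\<^bsub>product_group I G\<^esub> b)"
      by (auto simp: case_prod_unfold cong: restrict_cong)
  qed
qed

text \<open>The sets \<open>H i\<close> unify the two alternatives on the projections: what counts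
  is a set in the closure of the projection under which no mean is invariant. This makes each
  \<open>B i\<close> null.\<close>

lemma not_inner_amenable_subgroup_of_product:
  fixes G :: "'i \<Rightarrow> ('a, 'm) monoid_scheme" and T :: "'i \<Rightarrow> 'a topology"
  assumes I: "finite I"
    and lcsc: "\<And>i. i \<in> I \<Longrightarrow> lcsc_group (G i) (T i)"
    and bi_exact: "\<And>i. i \<in> I \<Longrightarrow> bi_exact (G i) (T i)"
    and disc: "discrete_subgroup \<Gamma> (product_group I G) (product_topology T I)"
    and countable: "countable \<Gamma>"
    and icc: "icc (product_group I G \<lparr>carrier := \<Gamma>\<rparr>)"
    and no_mean: "\<And>i \<Phi>. i \<in> I \<Longrightarrow> H i \<subseteq> T i closure_of ((\<lambda>x. x i) ` \<Gamma>) \<and> \<not> invariant_Borel_mean (G i) (T i) (H i) \<Phi>"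
  shows "\<not> inner_amenable (product_group I G \<lparr>carrier := \<Gamma>\<rparr>)"
proof
  let ?P = "product_group I G"
  define D where "D = ?P\<lparr>carrier := \<Gamma>\<rparr>"
  have grp: "group (G i)" if "i \<in> I" for i using lcsc[OF that] by (simp add: lcsc_group_def)
  have top: "topspace (T i) = carrier (G i)" if "i \<in> I" for i
    using lcsc_group.topspace_eq[OF lcsc[OF that]] .
  have P: "group ?P" by (rule product_group[OF grp])
  have \<Gamma>: "subgroup \<Gamma> ?P" using disc by (simp add: discrete_subgroup_def)
  have \<Gamma>P: "x \<in> (\<Pi>\<^sub>E i\<in>I. carrier (G i))" if "x \<in> \<Gamma>" for x
    using subgroup.mem_carrier[OF \<Gamma> that] by simp
  have carrier_D [simp]: "carrier D = \<Gamma>" by (simp add: D_def)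
  interpret D: group D
    unfolding D_def by (rule subgroup.subgroup_is_group[OF \<Gamma> P])
  assume "inner_amenable (product_group I G \<lparr>carrier := \<Gamma>\<rparr>)"
  then obtain \<mu> where \<mu>: "D.invariant_measure \<mu>"
    unfolding inner_amenable_def D_def[symmetric] D.invariant_measure_def by auto
  then have \<mu>P: "\<mu> \<in> Prob D.\<Omega>" by (simp add: D.invariant_measure_def)
  interpret \<mu>: prob_space \<mu> using ProbD(1)[OF \<mu>P] .
  define exhausts where "exhausts i u \<longleftrightarrow> (\<forall>k. u k \<in> Cc (T i)) \<and>
      (\<forall>k. \<forall>x\<in>topspace (T i). 0 \<le> u k x \<and> u k x \<le> 1) \<and>
      (\<forall>K. compactin (T i) K \<longrightarrow> (\<forall>\<^sub>F k in sequentially. \<forall>x\<in>K. u k x = 1))"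
    for i and u :: "nat \<Rightarrow> 'a \<Rightarrow> real"
  have "\<exists>u. exhausts i u" if i: "i \<in> I" for i
  proof -
    interpret lcsc_group "G i" "T i" by (rule lcsc[OF i])
    have sc: "second_countable (T i)" using second_countable by (simp add: second_countable_space_iff)
    obtain c :: "nat \<Rightarrow> 'a \<Rightarrow> real" where
      c: "\<And>k. c k \<in> Cc (T i)" "\<And>k x. x \<in> topspace (T i) \<Longrightarrow> 0 \<le> c k x \<and> c k x \<le> 1"
      "\<And>k x. x \<in> topspace (T i) - topspace (T i) \<Longrightarrow> c k x = 0"
      "\<And>K. compactin (T i) K \<Longrightarrow> K \<subseteq> topspace (T i) \<Longrightarrow> \<forall>\<^sub>F k in sequentially. \<forall>x\<in>K. c k x = 1"
      by (fact open_cutoffs[OF locally_compact Hausdorff sc openin_topspace])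
    show ?thesis
      using c(1,2,4) compactin_subset_topspace[of "T i"] by (intro exI[of _ c]) (simp add: exhausts_def)
  qed
  then obtain u where u: "\<And>i. i \<in> I \<Longrightarrow> exhausts i (u i)" by metis
  have loc: "inner_amenable_projection (G i) (T i) D (\<lambda>x. x i) \<mu> (u i)" if i: "i \<in> I" for i
  proof -
    have "(\<lambda>x. x i) \<in> hom D (G i)"
      using \<Gamma>P i by (auto simp: hom_def D_def)
    then show ?thesis
      using u[OF i] \<mu> lcsc[OF i] D.is_group
      by (auto simp: exhausts_def inner_amenable_projection_def inner_amenable_projection_axioms_def)
  qed
  define B where "B i = inner_amenable_projection.B (T i) D (\<lambda>x. x i) (u i)" for i
  define f where "f i k = inner_amenable_projection.pull D (\<lambda>x. x i) (inner_amenable_projection.uc (T i) (u i) k)" for i k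
  have B_iff: "B i = {z \<in> topspace D.\<Omega>. \<forall>k. z (f i k) = 0}" if "i \<in> I" for i
    unfolding B_def f_def inner_amenable_projection.B_def[OF loc[OF that]] ..
  have f_apply: "f i k x = complex_of_real (u i k (x i))" if "i \<in> I" "x \<in> \<Gamma>" for i k x
    using \<Gamma>P[OF that(2)] that top[OF that(1)]
    by (simp add: f_def inner_amenable_projection.pull_def[OF loc[OF that(1)]]
        inner_amenable_projection.uc_def[OF loc[OF that(1)]] PiE_iff)
  have f_ellinf: "f i k \<in> ellinf \<Gamma>" if "i \<in> I" for i k
    using inner_amenable_projection.pull_ellinf[OF loc[OF that] inner_amenable_projection.Cc_Cb[OF loc[OF that]
        inner_amenable_projection.uc_Cc[OF loc[OF that]]]]
    by (simp add: f_def)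
  have B_null: "B i \<in> null_sets \<mu>" if i: "i \<in> I" for i
  proof -
    have "\<not> measure \<mu> (B i) > 0"
      using inner_amenable_projection.boundary_mean[OF loc[OF i] bi_exact[OF i], of "H i"] no_mean[OF i]
      unfolding B_def by auto
    then have "measure \<mu> (B i) = 0" using measure_nonneg[of \<mu> "B i"] by linarith
    moreover have "B i \<in> sets \<mu>"
      unfolding B_def by (rule inner_amenable_projection.B_sets[OF loc[OF i]])
    ultimately show ?thesis by (simp add: null_sets_def \<mu>.emeasure_eq_measure)
  qed
  define E where "E \<gamma> = {z \<in> topspace D.\<Omega>. z (delta \<Gamma> \<gamma>) \<noteq> 0}" for \<gamma>
  have E_null: "E \<gamma> \<in> null_sets \<mu>" if "\<gamma> \<in> \<Gamma>" for \<gamma>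
  proof -
    have "measure \<mu> (E \<gamma>) = 0"
      using D.icc_no_atoms[OF \<mu>, of \<gamma>] icc that by (simp add: E_def D_def)
    moreover have "E \<gamma> \<in> sets \<mu>"
      using openin_borel_on[OF D.open_character_nonzero[of "delta \<Gamma> \<gamma>"]] ProbD(2)[OF \<mu>P] delta_ellinf[of \<Gamma>]
      by (simp add: E_def)
    ultimately show ?thesis by (simp add: null_sets_def \<mu>.emeasure_eq_measure)
  qed
  have "topspace D.\<Omega> \<subseteq> (\<Union>i\<in>I. B i) \<union> (\<Union>\<gamma>\<in>\<Gamma>. E \<gamma>)"
  proof
    fix z assume z: "z \<in> topspace D.\<Omega>"
    have zc: "z \<in> characters \<Gamma> (ellinf \<Gamma>)" using D.\<Omega>_characters[OF z] by simp
    show "z \<in> (\<Union>i\<in>I. B i) \<union> (\<Union>\<gamma>\<in>\<Gamma>. E \<gamma>)"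
    proof (cases "z \<in> (\<Union>i\<in>I. B i)")
      case False
      then have "\<forall>i\<in>I. \<exists>k. z (f i k) \<noteq> 0" using z B_iff by blast
      then obtain k where k: "\<And>i. i \<in> I \<Longrightarrow> z (f i (k i)) \<noteq> 0" by metis
      have "\<forall>i\<in>I. \<exists>L. compactin (T i) L \<and> (\<forall>x\<in>topspace (T i) - L. u i (k i) x = 0)"
        using u by (auto simp: exhausts_def Cc_def)
      then obtain L where L: "\<And>i. i \<in> I \<Longrightarrow> compactin (T i) (L i)"
        "\<And>i x. i \<in> I \<Longrightarrow> x \<in> topspace (T i) - L i \<Longrightarrow> u i (k i) x = 0" by metis
      have "compactin (product_topology T I) (PiE I L)"
        using L(1) by (simp add: compactin_PiE)
      moreover have "topspace (product_topology T I) = carrier ?P"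
        using top by (auto intro!: PiE_cong)
      ultimately have fin: "finite (\<Gamma> \<inter> PiE I L)"
        using group.finite_discrete_subgroup_Int_compact[OF P _
            continuous_map_product_group_mult_inv[OF lcsc] disc] by blast
      \<comment> \<open>The product of one cutoff per factor is supported on the finite set just
        found, while its value under \<open>z\<close> is a product of nonzero numbers; so
        \<open>z\<close> does not kill some point mass of \<open>\<Gamma>\<close>.\<close>
      let ?F = "\<lambda>x\<in>\<Gamma>. \<Prod>i\<in>I. f i (k i) x"
      have F: "?F \<in> ellinf \<Gamma>" "z ?F = (\<Prod>i\<in>I. z (f i (k i)))"
        using character_prod[OF zc I, of "\<lambda>i. f i (k i)"] f_ellinf by auto
      have "z ?F \<noteq> 0" using F(2) k I by simp
      moreover have "?F x = 0" if x: "x \<in> \<Gamma> - \<Gamma> \<inter> PiE I L" for x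
      proof -
        have "x \<in> (\<Pi>\<^sub>E i\<in>I. carrier (G i))" "x \<notin> PiE I L" using x \<Gamma>P by auto
        then obtain i where i: "i \<in> I" "x i \<in> topspace (T i) - L i"
          using top by (auto simp: PiE_iff)
        then have "f i (k i) x = 0" using f_apply[OF i(1)] L(2)[OF i] x by simp
        then show ?thesis using x i(1) I by auto
      qed
      ultimately have "\<exists>\<gamma>\<in>\<Gamma>. z (delta \<Gamma> \<gamma>) \<noteq> 0"
        using character_finite_support[OF zc fin F(1)] by blast
      then show ?thesis using z by (auto simp: E_def)
    qed simp
  qed
  \<comment> \<open>Null sets are closed under countable unions, so this is where countability of
    \<open>\<Gamma>\<close> enters.\<close>
  moreover have "(\<Union>i\<in>I. B i) \<union> (\<Union>\<gamma>\<in>\<Gamma>. E \<gamma>) \<in> null_sets \<mu>"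
    using B_null E_null I countable by (intro null_sets.Un null_sets_UN') (auto intro: countable_finite)
  ultimately have "emeasure \<mu> (space \<mu>) = 0"
    by (metis ProbD(3)[OF \<mu>P] emeasure_eq_0 null_setsD1 null_setsD2)
  then show False using \<mu>.emeasure_space_1 by simp
qed

theorem theorem3p1:
  fixes n :: nat
    and G :: "nat \<Rightarrow> ('a, 'm) monoid_scheme"
    and T :: "nat \<Rightarrow> 'a topology"
    and \<Gamma> :: "(nat \<Rightarrow> 'a) set"
  assumes lcsc: "\<And>i. i \<in> {1..n} \<Longrightarrow> lcsc_group (G i) (T i)"
    and nonamenable: "\<And>i. i \<in> {1..n} \<Longrightarrow> \<not> amenable (G i) (T i)"
    and bi_exact: "\<And>i. i \<in> {1..n} \<Longrightarrow> bi_exact (G i) (T i)"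
    and discrete: "discrete_subgroup \<Gamma> (product_group {1..n} G) (product_topology T {1..n})"
    and countable: "countable \<Gamma>"
    and icc: "icc (product_group {1..n} G \<lparr>carrier := \<Gamma>\<rparr>)"
    and projections:
      "(\<forall>i\<in>{1..n}. \<exists>\<Lambda> \<subseteq> (\<lambda>x. x i) ` \<Gamma>. discrete_subgroup \<Lambda> (G i) (T i) \<and>
           \<not> amenable (G i \<lparr>carrier := \<Lambda>\<rparr>) (subtopology (T i) \<Lambda>)) \<or>
       (\<forall>i\<in>{1..n}. T i closure_of ((\<lambda>x. x i) ` \<Gamma>) = topspace (T i))"
  shows "\<not> inner_amenable (product_group {1..n} G \<lparr>carrier := \<Gamma>\<rparr>)"
proof -
  have top: "topspace (T i) = carrier (G i)" if "i \<in> {1..n}" for i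
    using lcsc_group.topspace_eq[OF lcsc[OF that]] .
  \<comment> \<open>In the first alternative \<open>H\<close> is the discrete subgroup, which lies
    in the projection itself; in the second it is the whole factor, which density places in the
    closure.\<close>
  have "\<exists>H. H \<subseteq> T i closure_of ((\<lambda>x. x i) ` \<Gamma>) \<and> (\<forall>\<Phi>. \<not> invariant_Borel_mean (G i) (T i) H \<Phi>)"
    if i: "i \<in> {1..n}" for i
    using projections
  proof
    assume "\<forall>i\<in>{1..n}. \<exists>\<Lambda> \<subseteq> (\<lambda>x. x i) ` \<Gamma>. discrete_subgroup \<Lambda> (G i) (T i) \<and>
           \<not> amenable (G i \<lparr>carrier := \<Lambda>\<rparr>) (subtopology (T i) \<Lambda>)"
    then obtain \<Lambda> where \<Lambda>: "\<Lambda> \<subseteq> (\<lambda>x. x i) ` \<Gamma>" "discrete_subgroup \<Lambda> (G i) (T i)"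
      "\<not> amenable (G i \<lparr>carrier := \<Lambda>\<rparr>) (subtopology (T i) \<Lambda>)"
      using i by blast
    have "\<Gamma> \<subseteq> (\<Pi>\<^sub>E i\<in>{1..n}. carrier (G i))"
      using discrete subgroup.subset by (fastforce simp: discrete_subgroup_def)
    then have "(\<lambda>x. x i) ` \<Gamma> \<subseteq> topspace (T i)"
      using i top[OF i] by (auto simp: PiE_iff)
    then have "\<Lambda> \<subseteq> T i closure_of ((\<lambda>x. x i) ` \<Gamma>)"
      using \<Lambda>(1) closure_of_subset by blast
    moreover have "countable \<Lambda>"
      using \<Lambda>(1) countable by (meson countable_image countable_subset)
    ultimately show ?thesis
      using lcsc_group.invariant_Borel_mean_discrete_amenable[OF lcsc[OF i] _ order_refl \<Lambda>(2)] \<Lambda>(3) by blast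
  next
    assume "\<forall>i\<in>{1..n}. T i closure_of ((\<lambda>x. x i) ` \<Gamma>) = topspace (T i)"
    then have "carrier (G i) \<subseteq> T i closure_of ((\<lambda>x. x i) ` \<Gamma>)" using i top[OF i] by simp
    then show ?thesis
      using lcsc_group.invariant_Borel_mean_amenable[OF lcsc[OF i]] nonamenable[OF i] by blast
  qed
  then obtain H where "\<And>i. i \<in> {1..n} \<Longrightarrow> H i \<subseteq> T i closure_of ((\<lambda>x. x i) ` \<Gamma>) \<and>
      (\<forall>\<Phi>. \<not> invariant_Borel_mean (G i) (T i) (H i) \<Phi>)"
    by metis
  then show ?thesis
    by (intro not_inner_amenable_subgroup_of_product[OF _ lcsc bi_exact discrete countable icc, where H = H]) auto
qed

end
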